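(* Let $H$ be a linear cycle set, $I$ a trivial linear cycle set, and $\diamond\colon H\times I\to I$, $\leftthreetimes\colon I\times H\to I$ maps such that for all $h,h'\in H$ and $y,y'\in I$: $h\diamond(y+y')=h\diamond y+h\diamond y'$; $0\diamond y=y$; $0\leftthreetimes h=0$; $y\leftthreetimes0=0$; $y\leftthreetimes(h+h')=y\leftthreetimes h+y\leftthreetimes h'$; $(y+y')\leftthreetimes h=y\leftthreetimes h+y'\leftthreetimes h$; $(h+h')\diamond y=(h\cdot h')\diamond(h\diamond y)$; $(h\diamond y)\leftthreetimes(h\cdot h')=h\diamond(y\leftthreetimes h')+\bigl(h\diamond(y\leftthreetimes h)\bigr)\leftthreetimes(h\cdot h')$; and the maps $y\mapsto h\diamond y$ are permutations of $I$. Then there is a bijective correspondence $$\mathrm{Ext}_{\diamond,\leftthreetimes}(H,I)\longleftrightarrow\mathrm H^2_{\diamond,\leftthreetimes}(H,I).$$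
   Context: A linear cycle set is an abelian group $(A,+)$ with a binary operation $\cdot$ such that for each $b\in A$ the map $a\mapsto b\cdot a$ is bijective, and $a\cdot(b+c)=a\cdot b+a\cdot c$ and $(a+b)\cdot c=(a\cdot b)\cdot(a\cdot c)$ for all $a,b,c$. It is trivial if $a\cdot b=b$ for all $a,b$. Morphisms preserve $+$ and $\cdot$. An extension $(\iota,B,\pi)$ of $H$ by $I$ is a short exact sequence of abelian groups $0\to I\xrightarrow{\iota}B\xrightarrow{\pi}H\to0$ with $B$ a linear cycle set and $\iota,\pi$ morphisms of linear cycle sets. Two extensions $(\iota,B,\pi)$, $(\iota',B',\pi')$ are equivalent if there is a linear cycle set morphism $\phi\colon B\to B'$ with $\pi'\circ\phi=\pi$ and $\phi\circ\iota=\iota'$. $\mathrm{Ext}_{\diamond,\leftthreetimes}(H,I)$ is the set of equivalence classes of extensions $(\iota,B,\pi)$ of $H$ by $I$ such that, for every set-theoretic section $s$ of $\pi$ with $s(0)=0$, one has $s(h)\cdot\iota(y)=\iota(h\diamond y)$ and $\iota(y)\cdot s(h)-s(h)=\iota(y\leftthreetimes h)$ for all $h\in H$, $y\in I$. Let $\overline H=H\setminus\{0\}$. For $s\ge1$ let $\mathbb Z[\overline H^s]$ be the free abelian group on $\overline H^s$ (and $\mathbb Z[\overline H^0]=\mathbb Z$), and let $\mathrm{sh}(\mathbb Z[\overline H^s])$ be the subgroup generated by the shuffles $\sum_{\sigma\in\mathrm{sh}_{l,s-l}}\mathrm{sg}(\sigma)(h_{\sigma^{-1}(1)},\dots,h_{\sigma^{-1}(s)})$,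 for $1\le l<s$ and $h_k\in\overline H$, where $\mathrm{sh}_{l,s-l}$ is the set of permutations $\sigma$ of $\{1,\dots,s\}$ with $\sigma(1)<\dots<\sigma(l)$ and $\sigma(l+1)<\dots<\sigma(s)$. Put $\overline M(s)=\mathbb Z[\overline H^s]/\mathrm{sh}(\mathbb Z[\overline H^s])$ and denote by $[h_1,\dots,h_s]$ the class of $(h_1,\dots,h_s)$. For $r\ge0$, $s\ge1$ let $\widehat C_N^{rs}(H,I)=\mathrm{Hom}(\mathbb Z[\overline H^r]\otimes\overline M(s),I)$. We write $f(h_1,\dots,h_r,[h_{r+1},\dots,h_{r+s}])$ for the value of $f$ on $(h_1,\dots,h_r)\otimes[h_{r+1},\dots,h_{r+s}]$; by convention this value is $0$ if some $h_i=0$. For $r\ge0$, $s\ge1$ let $R_{rs}(h_1,\dots,h_{r+s})=(h_1+\dots+h_r)\cdot(h_{r+1}+\dots+h_{r+s})\in H$. The maps $\partial_{\mathrm h}^{r+1,s}\colon\widehat C_N^{rs}(H,I)\to\widehat C_N^{r+1,s}(H,I)$, $\partial_{\mathrm v}^{r,s+1}\colon\widehat C_N^{rs}(H,I)\to\widehat C_N^{r,s+1}(H,I)$ and $D_{rs}^{r+s,1}\colon\widehat C_N^{rs}(H,I)\to\widehat C_N^{r+s,1}(H,I)$ are \begin{align*} \partial_{\mathrm h}^{r+1,s}(f)(h_1,\dots,h_{r+1},[h_{r+2},\dots,h_{r+s+1}])&=f(h_1\cdot h_2,\dots,h_1\cdot h_{r+1},[h_1\cdot h_{r+2},\dots,h_1\cdot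 h_{r+s+1}])\\ &+\sum_{j=1}^r(-1)^jf(h_1,\dots,h_{j-1},h_j+h_{j+1},h_{j+2},\dots,h_{r+1},[h_{r+2},\dots,h_{r+s+1}])\\ &+(-1)^{r+1}R_{r1}(h_1,\dots,h_{r+1})\diamond f(h_1,\dots,h_r,[h_{r+2},\dots,h_{r+s+1}]),\\ \partial_{\mathrm v}^{r,s+1}(f)(h_1,\dots,h_r,[h_{r+1},\dots,h_{r+s+1}])&=(-1)^rf(h_1,\dots,h_r,[h_{r+2},\dots,h_{r+s+1}])\\ &+\sum_{j=r+1}^{r+s}(-1)^jf(h_1,\dots,h_r,[h_{r+1},\dots,h_{j-1},h_j+h_{j+1},h_{j+2},\dots,h_{r+s+1}])\\ &+(-1)^{r+s+1}f(h_1,\dots,h_r,[h_{r+1},\dots,h_{r+s}]),\\ D_{rs}^{r+s,1}(f)(h_1,\dots,h_{r+s},[h_{r+s+1}])&=(-1)^{r+s}\bigl(R_{rs}(h_1,\dots,h_{r+s})\diamond f(h_1,\dots,h_r,[h_{r+1},\dots,h_{r+s}])\bigr)\leftthreetimes R_{r+s,1}(h_1,\dots,h_{r+s+1}). \end{align*} For $n\ge1$, $\widehat C_N^n(H,I)=\bigoplus_{r=0}^{n-1}\widehat C_N^{r,n-r}(H,I)$. The degree-one maps $\partial$ and $D$ on $\widehat C_N^*(H,I)$ are $\partial=\partial_{\mathrm h}+\partial_{\mathrm v}$ and $D(f_{0n},\dots,f_{n-1,1})=\sum_{k=1}^nD_{n-k,k}^{n1}(f_{n-k,k})$. $(\widehat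 C_N^*(H,I),\partial+D)$ is a cochain complex and $\mathrm H^*_{\diamond,\leftthreetimes}(H,I)$ denotes its cohomology. *)

theory Defs
  imports "HOL-Algebra.Free_Abelian_Groups" "HOL-Combinatorics.Permutations"
begin

section \<open>Linear cycle sets\<close>

text \<open>
  Abelian groups are commutative groups of \<^theory>\<open>HOL-Algebra.Group\<close>, hence written
  multiplicatively: \<open>x \<otimes> y\<close> is the sum, \<open>\<one>\<close> is zero, \<open>inv x\<close> is the negative
  and \<open>x [^] k\<close> is the integer multiple. The second operation of a linear
  cycle set is \<open>x \<cdot> y\<close>.
\<close>

record 'a linear_cycle_set = "'a monoid" +
  cdot :: "'a \<Rightarrow> 'a \<Rightarrow> 'a" (infixl "\<cdot>\<index>" 70)

locale linear_cycle_set = comm_group A for A :: "('a, 'm) linear_cycle_set_scheme" (structure) +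
  assumes cdot_bij: "b \<in> carrier A \<Longrightarrow> bij_betw (\<lambda>a. b \<cdot> a) (carrier A) (carrier A)"
    and cdot_add_right: "\<lbrakk>a \<in> carrier A; b \<in> carrier A; c \<in> carrier A\<rbrakk>
          \<Longrightarrow> a \<cdot> (b \<otimes> c) = (a \<cdot> b) \<otimes> (a \<cdot> c)"
    and cdot_add_left: "\<lbrakk>a \<in> carrier A; b \<in> carrier A; c \<in> carrier A\<rbrakk>
          \<Longrightarrow> (a \<otimes> b) \<cdot> c = (a \<cdot> b) \<cdot> (a \<cdot> c)"

locale trivial_linear_cycle_set = linear_cycle_set +
  assumes cdot_trivial: "\<lbrakk>a \<in> carrier A; b \<in> carrier A\<rbrakk> \<Longrightarrow> a \<cdot> b = b"

definition lcs_hom :: "'a linear_cycle_set \<Rightarrow> 'b linear_cycle_set \<Rightarrow> ('a \<Rightarrow> 'b) set" where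
  "lcs_hom A B = {f \<in> hom A B.
     \<forall>x\<in>carrier A. \<forall>y\<in>carrier A. f (x \<cdot>\<^bsub>A\<^esub> y) = f x \<cdot>\<^bsub>B\<^esub> f y}"


section \<open>Extensions\<close>

type_synonym ('i, 'b, 'h) extension = "('i \<Rightarrow> 'b) \<times> 'b linear_cycle_set \<times> ('b \<Rightarrow> 'h)"

definition is_extension ::
  "'h linear_cycle_set \<Rightarrow> 'i linear_cycle_set \<Rightarrow> ('i, 'b, 'h) extension \<Rightarrow> bool" where
  "is_extension H I = (\<lambda>(\<iota>, B, \<pi>).
     linear_cycle_set B \<and> \<iota> \<in> lcs_hom I B \<and> \<pi> \<in> lcs_hom B H \<and>
     inj_on \<iota> (carrier I) \<and> \<iota> ` carrier I = kernel B H \<pi> \<and> \<pi> ` carrier B = carrier H)"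

definition equivalent_extensions ::
  "'h linear_cycle_set \<Rightarrow> 'i linear_cycle_set
    \<Rightarrow> ('i, 'b, 'h) extension \<Rightarrow> ('i, 'b, 'h) extension \<Rightarrow> bool" where
  "equivalent_extensions H I = (\<lambda>(\<iota>, B, \<pi>) (\<iota>', B', \<pi>').
     \<exists>\<phi> \<in> lcs_hom B B'. (\<forall>b\<in>carrier B. \<pi>' (\<phi> b) = \<pi> b) \<and> (\<forall>y\<in>carrier I. \<phi> (\<iota> y) = \<iota>' y))"

definition normalized_section ::
  "'h linear_cycle_set \<Rightarrow> 'b linear_cycle_set \<Rightarrow> ('b \<Rightarrow> 'h) \<Rightarrow> ('h \<Rightarrow> 'b) \<Rightarrow> bool" where
  "normalized_section H B \<pi> s \<longleftrightarrow>
     s \<in> carrier H \<rightarrow> carrier B \<and> (\<forall>h\<in>carrier H. \<pi> (s h) = h) \<and> s \<one>\<^bsub>H\<^esub> = \<one>\<^bsub>B\<^esub>"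

definition extensions_with_actions ::
  "'h linear_cycle_set \<Rightarrow> 'i linear_cycle_set \<Rightarrow> ('h \<Rightarrow> 'i \<Rightarrow> 'i) \<Rightarrow> ('i \<Rightarrow> 'h \<Rightarrow> 'i)
    \<Rightarrow> ('i, 'b, 'h) extension set" where
  "extensions_with_actions H I dia lt = {(\<iota>, B, \<pi>). is_extension H I (\<iota>, B, \<pi>) \<and>
     (\<forall>s. normalized_section H B \<pi> s \<longrightarrow> (\<forall>h\<in>carrier H. \<forall>y\<in>carrier I.
        s h \<cdot>\<^bsub>B\<^esub> \<iota> y = \<iota> (dia h y) \<and>
        (\<iota> y \<cdot>\<^bsub>B\<^esub> s h) \<otimes>\<^bsub>B\<^esub> inv\<^bsub>B\<^esub> s h = \<iota> (lt y h)))}"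

text \<open>
  The type \<open>'b\<close> of the middle terms plays the role of the universe in which
  the extensions live; the carrier of a middle term may be any subset of it.
\<close>

definition Ext ::
  "'h linear_cycle_set \<Rightarrow> 'i linear_cycle_set \<Rightarrow> ('h \<Rightarrow> 'i \<Rightarrow> 'i) \<Rightarrow> ('i \<Rightarrow> 'h \<Rightarrow> 'i)
    \<Rightarrow> ('i, 'b, 'h) extension set set" where
  "Ext H I dia lt = extensions_with_actions H I dia lt //
     {(E, E'). E \<in> extensions_with_actions H I dia lt \<and>
               E' \<in> extensions_with_actions H I dia lt \<and> equivalent_extensions H I E E'}"


section \<open>Hom groups and tensor products of abelian groups\<close>

text \<open>Homomorphisms are made extensional, so that they are determined by their values on the carrier.\<close>

definition Hom_group :: "('a, 'm) monoid_scheme \<Rightarrow> ('b, 'n) monoid_scheme \<Rightarrow> ('a \<Rightarrow> 'b) monoid" where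
  "Hom_group A B = \<lparr>carrier = hom A B \<inter> extensional (carrier A),
     monoid.mult = (\<lambda>f g. \<lambda>x\<in>carrier A. f x \<otimes>\<^bsub>B\<^esub> g x),
     one = (\<lambda>x\<in>carrier A. \<one>\<^bsub>B\<^esub>)\<rparr>"

definition tensor_relations ::
  "('a, 'm) monoid_scheme \<Rightarrow> ('b, 'n) monoid_scheme \<Rightarrow> ('a \<times> 'b \<Rightarrow>\<^sub>0 int) set" where
  "tensor_relations A B =
     {frag_of (a \<otimes>\<^bsub>A\<^esub> a', b) - frag_of (a, b) - frag_of (a', b) | a a' b.
        a \<in> carrier A \<and> a' \<in> carrier A \<and> b \<in> carrier B} \<union>
     {frag_of (a, b \<otimes>\<^bsub>B\<^esub> b') - frag_of (a, b) - frag_of (a, b') | a b b'.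
        a \<in> carrier A \<and> b \<in> carrier B \<and> b' \<in> carrier B}"

definition tensor_kernel ::
  "('a, 'm) monoid_scheme \<Rightarrow> ('b, 'n) monoid_scheme \<Rightarrow> ('a \<times> 'b \<Rightarrow>\<^sub>0 int) set" where
  "tensor_kernel A B = generate (free_Abelian_group (carrier A \<times> carrier B)) (tensor_relations A B)"

definition tensor_group ::
  "('a, 'm) monoid_scheme \<Rightarrow> ('b, 'n) monoid_scheme \<Rightarrow> ('a \<times> 'b \<Rightarrow>\<^sub>0 int) set monoid" where
  "tensor_group A B = free_Abelian_group (carrier A \<times> carrier B) Mod tensor_kernel A B"

definition pure_tensor ::
  "('a, 'm) monoid_scheme \<Rightarrow> ('b, 'n) monoid_scheme \<Rightarrow> 'a \<Rightarrow> 'b \<Rightarrow> ('a \<times> 'b \<Rightarrow>\<^sub>0 int) set" where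
  "pure_tensor A B a b =
     tensor_kernel A B #>\<^bsub>free_Abelian_group (carrier A \<times> carrier B)\<^esub> frag_of (a, b)"


section \<open>Shuffles\<close>

text \<open>Tuples are lists, whose entries are numbered from 0.\<close>

definition nonzero_tuples :: "'h linear_cycle_set \<Rightarrow> nat \<Rightarrow> 'h list set" where
  "nonzero_tuples H s = {hs. length hs = s \<and> set hs \<subseteq> carrier H - {\<one>\<^bsub>H\<^esub>}}"

definition shuffle_perms :: "nat \<Rightarrow> nat \<Rightarrow> (nat \<Rightarrow> nat) set" where
  "shuffle_perms l s =
     {\<sigma>. \<sigma> permutes {..<s} \<and> strict_mono_on {..<l} \<sigma> \<and> strict_mono_on {l..<s} \<sigma>}"

definition shuffle :: "nat \<Rightarrow> 'h list \<Rightarrow> ('h list \<Rightarrow>\<^sub>0 int)" where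
  "shuffle l hs = (\<Sum>\<sigma>\<in>shuffle_perms l (length hs).
     frag_cmul (sign \<sigma>) (frag_of (map (\<lambda>k. hs ! (inv_into UNIV \<sigma> k)) [0..<length hs])))"

definition shuffle_subgroup :: "'h linear_cycle_set \<Rightarrow> nat \<Rightarrow> ('h list \<Rightarrow>\<^sub>0 int) set" where
  "shuffle_subgroup H s = generate (free_Abelian_group (nonzero_tuples H s))
     {shuffle l hs | l hs. 1 \<le> l \<and> l < s \<and> hs \<in> nonzero_tuples H s}"

definition Mbar :: "'h linear_cycle_set \<Rightarrow> nat \<Rightarrow> ('h list \<Rightarrow>\<^sub>0 int) set monoid" where
  "Mbar H s = free_Abelian_group (nonzero_tuples H s) Mod shuffle_subgroup H s"

definition Mbar_class :: "'h linear_cycle_set \<Rightarrow> 'h list \<Rightarrow> ('h list \<Rightarrow>\<^sub>0 int) set" where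
  "Mbar_class H hs = shuffle_subgroup H (length hs)
     #>\<^bsub>free_Abelian_group (nonzero_tuples H (length hs))\<^esub> frag_of hs"


section \<open>Cochains\<close>

type_synonym 'h chain = "(('h list \<Rightarrow>\<^sub>0 int) \<times> ('h list \<Rightarrow>\<^sub>0 int) set \<Rightarrow>\<^sub>0 int) set"

definition cochains ::
  "'h linear_cycle_set \<Rightarrow> 'i linear_cycle_set \<Rightarrow> nat \<Rightarrow> nat \<Rightarrow> ('h chain \<Rightarrow> 'i) monoid" where
  "cochains H I r s =
     Hom_group (tensor_group (free_Abelian_group (nonzero_tuples H r)) (Mbar H s)) I"

definition chain_basis :: "'h linear_cycle_set \<Rightarrow> 'h list \<Rightarrow> 'h list \<Rightarrow> 'h chain" where
  "chain_basis H hs ks = pure_tensor (free_Abelian_group (nonzero_tuples H (length hs)))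
     (Mbar H (length ks)) (frag_of hs) (Mbar_class H ks)"

text \<open>The value \<open>f(h\<^sub>1, \<dots>, h\<^sub>r, [k\<^sub>1, \<dots>, k\<^sub>s])\<close>.\<close>

definition cochain_value ::
  "'h linear_cycle_set \<Rightarrow> 'i linear_cycle_set \<Rightarrow> ('h chain \<Rightarrow> 'i) \<Rightarrow> 'h list \<Rightarrow> 'h list \<Rightarrow> 'i" where
  "cochain_value H I f hs ks =
     (if \<one>\<^bsub>H\<^esub> \<in> set hs \<union> set ks then \<one>\<^bsub>I\<^esub> else f (chain_basis H hs ks))"

text \<open>
  The cochain with prescribed values on the elements \<open>(h\<^sub>1, \<dots>, h\<^sub>r) \<otimes> [k\<^sub>1, \<dots>, k\<^sub>s]\<close>.
  These generate the chain group, so there is at most one; the existence for the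
  formulas below amounts to their compatibility with the shuffles.
\<close>

definition cochain_with_values ::
  "'h linear_cycle_set \<Rightarrow> 'i linear_cycle_set \<Rightarrow> nat \<Rightarrow> nat \<Rightarrow> ('h list \<Rightarrow> 'h list \<Rightarrow> 'i)
    \<Rightarrow> ('h chain \<Rightarrow> 'i)" where
  "cochain_with_values H I r s F = (THE g. g \<in> carrier (cochains H I r s) \<and>
     (\<forall>hs\<in>nonzero_tuples H r. \<forall>ks\<in>nonzero_tuples H s. g (chain_basis H hs ks) = F hs ks))"


section \<open>The differentials\<close>

definition R_map :: "'h linear_cycle_set \<Rightarrow> nat \<Rightarrow> nat \<Rightarrow> 'h list \<Rightarrow> 'h" where
  "R_map H r s hs = (\<Otimes>\<^bsub>H\<^esub>i\<in>{..<r}. hs ! i) \<cdot>\<^bsub>H\<^esub> (\<Otimes>\<^bsub>H\<^esub>i\<in>{r..<r+s}. hs ! i)"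

text \<open>\<open>add_adjacent H j (h\<^sub>1, \<dots>, h\<^sub>n) = (h\<^sub>1, \<dots>, h\<^bsub>j-1\<^esub>, h\<^sub>j + h\<^bsub>j+1\<^esub>, h\<^bsub>j+2\<^esub>, \<dots>, h\<^sub>n)\<close>, for \<open>1 \<le> j < n\<close>.\<close>

definition add_adjacent :: "'h linear_cycle_set \<Rightarrow> nat \<Rightarrow> 'h list \<Rightarrow> 'h list" where
  "add_adjacent H j hs = take (j - 1) hs @ [hs ! (j - 1) \<otimes>\<^bsub>H\<^esub> hs ! j] @ drop (j + 1) hs"

definition signed :: "'i linear_cycle_set \<Rightarrow> nat \<Rightarrow> 'i \<Rightarrow> 'i" where
  "signed I k y = y [^]\<^bsub>I\<^esub> ((-1::int) ^ k)"

text \<open>\<open>d_h H I dia r s\<close> and \<open>d_v H I r s\<close> and \<open>d_D H I dia lt r s\<close> are the maps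
  starting at bidegree \<open>(r, s)\<close>.\<close>

definition d_h ::
  "'h linear_cycle_set \<Rightarrow> 'i linear_cycle_set \<Rightarrow> ('h \<Rightarrow> 'i \<Rightarrow> 'i) \<Rightarrow> nat \<Rightarrow> nat
    \<Rightarrow> ('h chain \<Rightarrow> 'i) \<Rightarrow> ('h chain \<Rightarrow> 'i)" where
  "d_h H I dia r s f = cochain_with_values H I (r + 1) s (\<lambda>hs ks.
     cochain_value H I f (map (\<lambda>h. hd hs \<cdot>\<^bsub>H\<^esub> h) (tl hs)) (map (\<lambda>h. hd hs \<cdot>\<^bsub>H\<^esub> h) ks)
     \<otimes>\<^bsub>I\<^esub> (\<Otimes>\<^bsub>I\<^esub>j\<in>{1..r}. signed I j (cochain_value H I f (add_adjacent H j hs) ks))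
     \<otimes>\<^bsub>I\<^esub> signed I (r + 1) (dia (R_map H r 1 hs) (cochain_value H I f (take r hs) ks)))"

definition d_v ::
  "'h linear_cycle_set \<Rightarrow> 'i linear_cycle_set \<Rightarrow> nat \<Rightarrow> nat
    \<Rightarrow> ('h chain \<Rightarrow> 'i) \<Rightarrow> ('h chain \<Rightarrow> 'i)" where
  "d_v H I r s f = cochain_with_values H I r (s + 1) (\<lambda>hs ks.
     signed I r (cochain_value H I f hs (tl ks))
     \<otimes>\<^bsub>I\<^esub> (\<Otimes>\<^bsub>I\<^esub>j\<in>{r+1..r+s}. signed I j (cochain_value H I f hs (add_adjacent H (j - r) ks)))
     \<otimes>\<^bsub>I\<^esub> signed I (r + s + 1) (cochain_value H I f hs (butlast ks)))"

definition d_D ::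
  "'h linear_cycle_set \<Rightarrow> 'i linear_cycle_set \<Rightarrow> ('h \<Rightarrow> 'i \<Rightarrow> 'i) \<Rightarrow> ('i \<Rightarrow> 'h \<Rightarrow> 'i)
    \<Rightarrow> nat \<Rightarrow> nat \<Rightarrow> ('h chain \<Rightarrow> 'i) \<Rightarrow> ('h chain \<Rightarrow> 'i)" where
  "d_D H I dia lt r s f = cochain_with_values H I (r + s) 1 (\<lambda>hs ks.
     signed I (r + s)
       (lt (dia (R_map H r s hs) (cochain_value H I f (take r hs) (drop r hs)))
           (R_map H (r + s) 1 (hs @ ks))))"


section \<open>The total complex and its cohomology\<close>

text \<open>The component with index \<open>r\<close> of a total cochain of degree \<open>n\<close> has bidegree \<open>(r, n - r)\<close>.\<close>

definition total_cochains ::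
  "'h linear_cycle_set \<Rightarrow> 'i linear_cycle_set \<Rightarrow> nat \<Rightarrow> (nat \<Rightarrow> 'h chain \<Rightarrow> 'i) monoid" where
  "total_cochains H I n = sum_group {0..<n} (\<lambda>r. cochains H I r (n - r))"

definition total_h ::
  "'h linear_cycle_set \<Rightarrow> 'i linear_cycle_set \<Rightarrow> ('h \<Rightarrow> 'i \<Rightarrow> 'i) \<Rightarrow> nat
    \<Rightarrow> (nat \<Rightarrow> 'h chain \<Rightarrow> 'i) \<Rightarrow> (nat \<Rightarrow> 'h chain \<Rightarrow> 'i)" where
  "total_h H I dia n f = (\<lambda>r\<in>{0..<n+1}.
     if r = 0 then \<one>\<^bsub>cochains H I r (n + 1 - r)\<^esub> else d_h H I dia (r - 1) (n + 1 - r) (f (r - 1)))"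

definition total_v ::
  "'h linear_cycle_set \<Rightarrow> 'i linear_cycle_set \<Rightarrow> nat
    \<Rightarrow> (nat \<Rightarrow> 'h chain \<Rightarrow> 'i) \<Rightarrow> (nat \<Rightarrow> 'h chain \<Rightarrow> 'i)" where
  "total_v H I n f = (\<lambda>r\<in>{0..<n+1}.
     if r = n then \<one>\<^bsub>cochains H I r (n + 1 - r)\<^esub> else d_v H I r (n - r) (f r))"

definition total_D ::
  "'h linear_cycle_set \<Rightarrow> 'i linear_cycle_set \<Rightarrow> ('h \<Rightarrow> 'i \<Rightarrow> 'i) \<Rightarrow> ('i \<Rightarrow> 'h \<Rightarrow> 'i) \<Rightarrow> nat
    \<Rightarrow> (nat \<Rightarrow> 'h chain \<Rightarrow> 'i) \<Rightarrow> (nat \<Rightarrow> 'h chain \<Rightarrow> 'i)" where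
  "total_D H I dia lt n f = (\<lambda>r\<in>{0..<n+1}.
     if r = n then (\<Otimes>\<^bsub>cochains H I n 1\<^esub>k\<in>{1..n}. d_D H I dia lt (n - k) k (f (n - k)))
     else \<one>\<^bsub>cochains H I r (n + 1 - r)\<^esub>)"

definition differential ::
  "'h linear_cycle_set \<Rightarrow> 'i linear_cycle_set \<Rightarrow> ('h \<Rightarrow> 'i \<Rightarrow> 'i) \<Rightarrow> ('i \<Rightarrow> 'h \<Rightarrow> 'i) \<Rightarrow> nat
    \<Rightarrow> (nat \<Rightarrow> 'h chain \<Rightarrow> 'i) \<Rightarrow> (nat \<Rightarrow> 'h chain \<Rightarrow> 'i)" where
  "differential H I dia lt n f =
     total_h H I dia n f \<otimes>\<^bsub>total_cochains H I (n + 1)\<^esub> total_v H I n f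
     \<otimes>\<^bsub>total_cochains H I (n + 1)\<^esub> total_D H I dia lt n f"

text \<open>
  For \<open>n \<ge> 1\<close>. The complex starts in degree 1: the group \<open>total_cochains H I 0\<close>
  is an empty direct sum, hence trivial.
\<close>

definition cohomology ::
  "'h linear_cycle_set \<Rightarrow> 'i linear_cycle_set \<Rightarrow> ('h \<Rightarrow> 'i \<Rightarrow> 'i) \<Rightarrow> ('i \<Rightarrow> 'h \<Rightarrow> 'i) \<Rightarrow> nat
    \<Rightarrow> (nat \<Rightarrow> 'h chain \<Rightarrow> 'i) set monoid" where
  "cohomology H I dia lt n =
     (total_cochains H I n)
       \<lparr>carrier := kernel (total_cochains H I n) (total_cochains H I (n + 1)) (differential H I dia lt n)\<rparr>
     Mod (differential H I dia lt (n - 1) ` carrier (total_cochains H I (n - 1)))"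

end

theory Submission
  imports Defs
begin

text \<open>
  An extension with a normalized section \<open>s\<close> is determined by its factor set
  \<open>s(a) + s(b) = \<iota> \<beta>(a,b) + s(a + b)\<close> and \<open>s(a) \<cdot> s(b) = \<iota> \<gamma>(a,b) + s(a \<cdot> b)\<close>: in the coordinates
  \<open>(y, h) \<leftrightarrow> \<iota> y + s(h)\<close> both operations are given by \<open>\<beta>\<close>, \<open>\<gamma>\<close> and the two actions. The axioms of a
  linear cycle set say exactly that \<open>(-\<beta>, \<gamma>)\<close> is a 2-cocycle, and a change of section, or a morphism
  of extensions, changes it by a coboundary. On the cochain side, a cochain is a function on nonzero
  tuples killing the shuffles, which in bidegree \<open>(r, 2)\<close> means symmetry in the last two arguments.
\<close>

section \<open>Homomorphisms out of free groups, quotients and tensor products\<close>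

text \<open>The differentials are definite descriptions, so no value of one can be used before its
  formula is known to respect the shuffles; the convention on zero entries has to be matched as
  well. Total degrees 1 to 3 only involve bidegrees \<open>(r, s)\<close> with
  \<open>s \<le> 3\<close>, so only shuffles of two and three elements have to be computed. On the
  side of extensions the obstacle is the choice of section: an extension has no preferred cocycle.
  Extensions and cocycles are therefore compared through the relation of sharing coordinates. Every
  extension is related to some cocycle and every cocycle to some extension, and equivalence on one
  side is equality of classes on the other; a cocycle is selected only at the very end. The term
  \<open>(h \<diamondop> y) \<leftthreetimes> (h \<cdot> h')\<close> in the product of an extension
  arises because \<open>\<iota> y\<close> need not fix the section, and it is what \<open>D\<close>
  adds to the differential. Middle terms live in the fixed type of the values of \<open>e\<close>,
  which must have room for \<open>I \<times> H\<close>.\<close>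

lemma hom_free_Abelian_group_eq:
  assumes "group G" "f \<in> hom (free_Abelian_group S) G" "g \<in> hom (free_Abelian_group S) G"
    and "\<And>x. x \<in> S \<Longrightarrow> f (frag_of x) = g (frag_of x)"
    and "c \<in> carrier (free_Abelian_group S)"
  shows "f c = g c"
proof -
  interpret f: group_hom "free_Abelian_group S" G f
    using assms by (simp add: group_hom_def group_hom_axioms_def)
  interpret g: group_hom "free_Abelian_group S" G g
    using assms by (simp add: group_hom_def group_hom_axioms_def)
  show ?thesis
  proof (rule free_Abelian_group_induct[of c S])
    fix x y assume xy: "Poly_Mapping.keys x \<subseteq> S" "Poly_Mapping.keys y \<subseteq> S" "f x = g x" "f y = g y"
    \<comment> \<open>The induction builds elements by subtraction, whereas \<open>hom\<close>
      speaks of sums. Stated for any \<open>h\<close>, to serve \<open>f\<close> and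
      \<open>g\<close> alike.\<close>
    have "h (x - y) = h x \<otimes>\<^bsub>G\<^esub> inv\<^bsub>G\<^esub> h y" if "group_hom (free_Abelian_group S) G h" for h
    proof -
      interpret h: group_hom "free_Abelian_group S" G h by fact
      have xy': "x \<in> carrier (free_Abelian_group S)" "y \<in> carrier (free_Abelian_group S)"
        using xy by simp_all
      show ?thesis
        using h.hom_mult[OF xy'(1) group.inv_closed[OF group_free_Abelian_group xy'(2)]] h.hom_inv[OF xy'(2)] xy by simp
    qed
    then show "f (x - y) = g (x - y)" using xy f.group_hom_axioms g.group_hom_axioms by metis
  qed (use f.hom_one g.hom_one assms(4,5) in auto)
qed

lemma (in comm_group) r_coset_hom:
  assumes "subgroup N G"
  shows "(\<lambda>x. N #> x) \<in> hom G (G Mod N)"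
  using assms normal.r_coset_hom_Mod normal_iff_subgroup by blast

text \<open>The kernel of \<open>h\<close> is a subgroup, so it contains all that \<open>R\<close>
  generates, and commutativity makes that subgroup normal. Both quotients inside a chain group, by
  tensor relations and by shuffles, are handled this way.\<close>

lemma (in comm_group) Mod_generate_universal:
  assumes h: "h \<in> hom G K" and K: "group K" and R: "R \<subseteq> carrier G"
    and kill: "\<And>x. x \<in> R \<Longrightarrow> h x = \<one>\<^bsub>K\<^esub>"
  obtains g where "g \<in> hom (G Mod generate G R) K"
    "\<And>x. x \<in> carrier G \<Longrightarrow> g (generate G R #> x) = h x"
proof -
  interpret h: group_hom G K h
    using h K by (simp add: group_hom_def group_hom_axioms_def is_group)
  have "generate G R \<lhd> G"
    by (simp add: R generate_is_subgroup normal_iff_subgroup)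
  moreover have "generate G R \<subseteq> kernel G K h"
    using R kill h.subgroup_kernel by (intro generate_subgroup_incl) (auto simp: kernel_def)
  ultimately show thesis
    using h.FactGroup_universal_kernel that by blast
qed

section \<open>Tensor products: generation by pure tensors and the universal property\<close>

lemma frag_of_diff_diff_in_free:
  assumes "p \<in> S" "q \<in> S" "r \<in> S"
  shows "Poly_Mapping.keys (frag_of p - frag_of q - frag_of r) \<subseteq> S"
proof -
  have "Poly_Mapping.keys (frag_of p - frag_of q - frag_of r) \<subseteq> {p, q, r}"
    using keys_diff[of "frag_of p - frag_of q" "frag_of r"] keys_diff[of "frag_of p" "frag_of q"] by auto
  then show ?thesis using assms by blast
qed

lemma tensor_relations_subset:
  assumes "group A" "group B"
  shows "tensor_relations A B \<subseteq> carrier (free_Abelian_group (carrier A \<times> carrier B))"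
proof -
  interpret A: group A by fact
  interpret B: group B by fact
  show ?thesis
    unfolding tensor_relations_def
    by (intro Un_least subsetI; clarify; unfold carrier_free_Abelian_group_iff;
        rule frag_of_diff_diff_in_free; simp)
qed

lemma tensor_kernel_subgroup:
  assumes "group A" "group B"
  shows "subgroup (tensor_kernel A B) (free_Abelian_group (carrier A \<times> carrier B))"
  unfolding tensor_kernel_def
  using group.generate_is_subgroup tensor_relations_subset[OF assms] group_free_Abelian_group by blast

lemma comm_group_tensor_group:
  assumes "group A" "group B"
  shows "comm_group (tensor_group A B)"
  unfolding tensor_group_def
  using comm_group.abelian_FactGroup abelian_free_Abelian_group tensor_kernel_subgroup[OF assms] by blast

lemma pure_tensor_closed:
  assumes "a \<in> carrier A" "b \<in> carrier B"
  shows "pure_tensor A B a b \<in> carrier (tensor_group A B)"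
  using assms by (auto simp: tensor_group_def pure_tensor_def carrier_FactGroup)

lemma tensor_coset_hom:
  assumes "group A" "group B"
  shows "(\<lambda>x. tensor_kernel A B #>\<^bsub>free_Abelian_group (carrier A \<times> carrier B)\<^esub> x)
    \<in> hom (free_Abelian_group (carrier A \<times> carrier B)) (tensor_group A B)"
  unfolding tensor_group_def
  using comm_group.r_coset_hom abelian_free_Abelian_group tensor_kernel_subgroup[OF assms] by blast

lemma hom_tensor_group_eq:
  assumes "group A" "group B" "group G"
    and f: "f \<in> hom (tensor_group A B) G" and g: "g \<in> hom (tensor_group A B) G"
    and eq: "\<And>a b. a \<in> carrier A \<Longrightarrow> b \<in> carrier B \<Longrightarrow> f (pure_tensor A B a b) = g (pure_tensor A B a b)"
    and x: "x \<in> carrier (tensor_group A B)"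
  shows "f x = g x"
proof -
  let ?F = "free_Abelian_group (carrier A \<times> carrier B)"
  let ?q = "\<lambda>x. tensor_kernel A B #>\<^bsub>?F\<^esub> x"
  note q = tensor_coset_hom[OF assms(1,2)]
  obtain c where c: "c \<in> carrier ?F" "x = ?q c"
    using x by (auto simp: tensor_group_def carrier_FactGroup)
  have "(f \<circ> ?q) c = (g \<circ> ?q) c"
  proof (rule hom_free_Abelian_group_eq[OF \<open>group G\<close> _ _ _ c(1)])
    show "f \<circ> ?q \<in> hom ?F G" "g \<circ> ?q \<in> hom ?F G"
      using q f g hom_compose by blast+
  qed (use eq in \<open>auto simp: pure_tensor_def\<close>)
  then show ?thesis using c by simp
qed

text \<open>Both kinds of tensor relations have the shape \<open>p - q - r\<close>. Read from right
  to left, this shows that a biadditive map kills the relations; read from left to right, that pure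
  tensors are biadditive.\<close>

lemma hom_frag_of_diff_diff:
  assumes "comm_group G" "f \<in> hom (free_Abelian_group S) G" "p \<in> S" "q \<in> S" "r \<in> S"
  shows "f (frag_of p - frag_of q - frag_of r) = \<one>\<^bsub>G\<^esub> \<longleftrightarrow>
         f (frag_of p) = f (frag_of q) \<otimes>\<^bsub>G\<^esub> f (frag_of r)"
proof -
  interpret G: comm_group G by fact
  let ?d = "frag_of p - frag_of q - frag_of r"
  have qr: "frag_of q + frag_of r \<in> carrier (free_Abelian_group S)"
    using assms keys_add[of "frag_of q" "frag_of r"] by auto
  have d: "?d \<in> carrier (free_Abelian_group S)"
    using frag_of_diff_diff_in_free[OF assms(3-5)] by simp
  have "f (frag_of p) = f ?d \<otimes>\<^bsub>G\<^esub> f (frag_of q + frag_of r)"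
    using hom_mult[OF assms(2) d qr] by (simp add: algebra_simps)
  moreover have "f (frag_of q \<otimes>\<^bsub>free_Abelian_group S\<^esub> frag_of r) = f (frag_of q) \<otimes>\<^bsub>G\<^esub> f (frag_of r)"
    using hom_mult[OF assms(2), of "frag_of q" "frag_of r"] assms by simp
  ultimately have "f (frag_of p) = f ?d \<otimes>\<^bsub>G\<^esub> (f (frag_of q) \<otimes>\<^bsub>G\<^esub> f (frag_of r))"
    by simp
  moreover have "f ?d \<in> carrier G" "f (frag_of q) \<in> carrier G" "f (frag_of r) \<in> carrier G"
    using d assms hom_in_carrier[OF assms(2)] by auto
  ultimately show ?thesis
    using G.r_cancel_one[of "f (frag_of q) \<otimes>\<^bsub>G\<^esub> f (frag_of r)" "f ?d"] by simp
qed

lemma (in comm_group) tensor_group_universal: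
  assumes A: "group A" and B: "group B"
    and closed: "\<And>a b. a \<in> carrier A \<Longrightarrow> b \<in> carrier B \<Longrightarrow> \<phi> a b \<in> carrier G"
    and left: "\<And>a a' b. a \<in> carrier A \<Longrightarrow> a' \<in> carrier A \<Longrightarrow> b \<in> carrier B
      \<Longrightarrow> \<phi> (a \<otimes>\<^bsub>A\<^esub> a') b = \<phi> a b \<otimes> \<phi> a' b"
    and right: "\<And>a b b'. a \<in> carrier A \<Longrightarrow> b \<in> carrier B \<Longrightarrow> b' \<in> carrier B
      \<Longrightarrow> \<phi> a (b \<otimes>\<^bsub>B\<^esub> b') = \<phi> a b \<otimes> \<phi> a b'"
  obtains g where "g \<in> hom (tensor_group A B) G"
    "\<And>a b. a \<in> carrier A \<Longrightarrow> b \<in> carrier B \<Longrightarrow> g (pure_tensor A B a b) = \<phi> a b"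
proof -
  let ?S = "carrier A \<times> carrier B"
  interpret A: group A by fact
  interpret B: group B by fact
  have "case_prod \<phi> ` ?S \<subseteq> carrier G" using closed by auto
  then obtain h where h: "h \<in> hom (free_Abelian_group ?S) G"
    and hv: "\<And>p. p \<in> ?S \<Longrightarrow> h (frag_of p) = case_prod \<phi> p"
    using free_Abelian_group_universal by blast
  have kill: "h x = \<one>" if "x \<in> tensor_relations A B" for x
    using that left right
    by (auto simp: tensor_relations_def hom_frag_of_diff_diff[OF comm_group_axioms h] hv)
  obtain g where g: "g \<in> hom (free_Abelian_group ?S Mod tensor_kernel A B) G"
    and gv: "\<And>x. x \<in> carrier (free_Abelian_group ?S) \<Longrightarrow> g (tensor_kernel A B #>\<^bsub>free_Abelian_group ?S\<^esub> x) = h x"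
    using comm_group.Mod_generate_universal[OF abelian_free_Abelian_group h is_group
        tensor_relations_subset[OF A B] kill]
    unfolding tensor_kernel_def by blast
  show thesis
    by (rule that[of g]) (use g gv hv in \<open>auto simp: tensor_group_def pure_tensor_def\<close>)
qed

lemma pure_tensor_hom:
  assumes "group A" "group B"
  shows pure_tensor_hom_left: "b \<in> carrier B \<Longrightarrow> (\<lambda>a. pure_tensor A B a b) \<in> hom A (tensor_group A B)"
    and pure_tensor_hom_right: "a \<in> carrier A \<Longrightarrow> (\<lambda>b. pure_tensor A B a b) \<in> hom B (tensor_group A B)"
proof -
  let ?S = "carrier A \<times> carrier B"
  interpret A: group A by fact
  interpret B: group B by fact
  note q = tensor_coset_hom[OF assms]
  have one: "tensor_kernel A B #>\<^bsub>free_Abelian_group ?S\<^esub> x = \<one>\<^bsub>tensor_group A B\<^esub>"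
    if "x \<in> tensor_relations A B" for x
    using group.coset_join2[OF group_free_Abelian_group _ tensor_kernel_subgroup[OF assms], of x] that
      tensor_relations_subset[OF assms]
    by (auto simp: tensor_group_def tensor_kernel_def generate.incl)
  note iff = hom_frag_of_diff_diff[OF comm_group_tensor_group[OF assms] q]
  show "(\<lambda>a. pure_tensor A B a b) \<in> hom A (tensor_group A B)" if "b \<in> carrier B"
  proof (rule homI)
    fix a a' assume "a \<in> carrier A" "a' \<in> carrier A"
    then show "pure_tensor A B (a \<otimes>\<^bsub>A\<^esub> a') b = pure_tensor A B a b \<otimes>\<^bsub>tensor_group A B\<^esub> pure_tensor A B a' b"
      unfolding pure_tensor_def using that
      by (subst iff[symmetric]; (intro one)?) (auto simp: tensor_relations_def)
  qed (use that in \<open>simp add: pure_tensor_closed\<close>)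
  show "(\<lambda>b. pure_tensor A B a b) \<in> hom B (tensor_group A B)" if "a \<in> carrier A"
  proof (rule homI)
    fix b b' assume "b \<in> carrier B" "b' \<in> carrier B"
    then show "pure_tensor A B a (b \<otimes>\<^bsub>B\<^esub> b') = pure_tensor A B a b \<otimes>\<^bsub>tensor_group A B\<^esub> pure_tensor A B a b'"
      unfolding pure_tensor_def using that
      by (subst iff[symmetric]; (intro one)?) (auto simp: tensor_relations_def)
  qed (use that in \<open>simp add: pure_tensor_closed\<close>)
qed

lemma hom_mult_closed:
  assumes "group A" "comm_group G" "f \<in> hom A G" "g \<in> hom A G"
  shows "(\<lambda>x. f x \<otimes>\<^bsub>G\<^esub> g x) \<in> hom A G"
proof -
  interpret G: comm_group G by fact
  show ?thesis
    using assms(3,4) by (intro homI) (simp_all add: hom_in_carrier[of f] hom_in_carrier[of g] hom_mult G.m_ac)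
qed

lemma restrict_in_hom [simp]:
  assumes "group A"
  shows "restrict f (carrier A) \<in> hom A G \<longleftrightarrow> f \<in> hom A G"
proof -
  interpret A: group A by fact
  show ?thesis by (auto simp: hom_def Pi_iff)
qed

lemma comm_group_Hom_group:
  assumes "group A" "comm_group G"
  shows "comm_group (Hom_group A G)"
proof -
  interpret A: group A by fact
  interpret G: comm_group G by fact
  note closed = hom_in_carrier[of _ A G]
  show ?thesis
  proof (rule comm_groupI)
    fix f assume f: "f \<in> carrier (Hom_group A G)"
    then have "f \<in> hom A G" by (simp add: Hom_group_def)
    then interpret f: group_hom A G f by (simp add: group_hom_def group_hom_axioms_def A.is_group)
    have "(\<lambda>x. inv\<^bsub>G\<^esub> f x) \<in> hom A G"
      by (rule homI) (simp_all add: G.inv_mult)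
    then show "\<exists>g\<in>carrier (Hom_group A G). g \<otimes>\<^bsub>Hom_group A G\<^esub> f = \<one>\<^bsub>Hom_group A G\<^esub>"
      by (intro bexI[of _ "\<lambda>x\<in>carrier A. inv\<^bsub>G\<^esub> f x"]) (auto simp: Hom_group_def assms intro!: restrict_ext)
    show "\<one>\<^bsub>Hom_group A G\<^esub> \<otimes>\<^bsub>Hom_group A G\<^esub> f = f"
      using f by (auto simp: Hom_group_def fun_eq_iff extensional_def)
  next
    show "\<one>\<^bsub>Hom_group A G\<^esub> \<in> carrier (Hom_group A G)"
      by (auto simp: Hom_group_def assms intro: homI)
  next
    fix f g assume fg: "f \<in> carrier (Hom_group A G)" "g \<in> carrier (Hom_group A G)"
    then show "f \<otimes>\<^bsub>Hom_group A G\<^esub> g \<in> carrier (Hom_group A G)"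
      by (auto simp: Hom_group_def assms intro: hom_mult_closed)
    show "f \<otimes>\<^bsub>Hom_group A G\<^esub> g = g \<otimes>\<^bsub>Hom_group A G\<^esub> f"
      using fg by (auto simp: Hom_group_def closed G.m_comm intro!: restrict_ext)
  next
    fix f g h assume "f \<in> carrier (Hom_group A G)" "g \<in> carrier (Hom_group A G)" "h \<in> carrier (Hom_group A G)"
    then show "f \<otimes>\<^bsub>Hom_group A G\<^esub> g \<otimes>\<^bsub>Hom_group A G\<^esub> h
        = f \<otimes>\<^bsub>Hom_group A G\<^esub> (g \<otimes>\<^bsub>Hom_group A G\<^esub> h)"
      by (auto simp: Hom_group_def closed G.m_assoc intro!: restrict_ext)
  qed
qed

section \<open>Cochains as functions\<close>

definition tuples :: "'h linear_cycle_set \<Rightarrow> nat \<Rightarrow> 'h list set" where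
  "tuples H n = {hs. length hs = n \<and> set hs \<subseteq> carrier H}"

lemma nonzero_tuples_iff: "hs \<in> nonzero_tuples H n \<longleftrightarrow> hs \<in> tuples H n \<and> \<one>\<^bsub>H\<^esub> \<notin> set hs"
  by (auto simp: nonzero_tuples_def tuples_def)

lemma tuples_0: "hs \<in> tuples H 0 \<longleftrightarrow> hs = []"
  by (auto simp: tuples_def)

lemma tuples_Suc: "hs \<in> tuples H (Suc n) \<longleftrightarrow> (\<exists>h ks. hs = h # ks \<and> h \<in> carrier H \<and> ks \<in> tuples H n)"
  by (auto simp: tuples_def length_Suc_conv)

section \<open>The shuffle quotient and the groups of cochains\<close>

lemma shuffle_in_free:
  assumes "hs \<in> nonzero_tuples H s"
  shows "Poly_Mapping.keys (shuffle l hs) \<subseteq> nonzero_tuples H s"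
proof -
  have "map (\<lambda>k. hs ! (inv_into UNIV \<sigma> k)) [0..<length hs] \<in> nonzero_tuples H s"
    if "\<sigma> \<in> shuffle_perms l (length hs)" for \<sigma>
  proof -
    have "inv_into UNIV \<sigma> permutes {..<length hs}"
      using that by (simp add: shuffle_perms_def permutes_inv)
    then have "hs ! inv_into UNIV \<sigma> k \<in> set hs" if "k < length hs" for k
      using permutes_in_image[of "inv_into UNIV \<sigma>" "{..<length hs}" k] that by simp
    then have "set (map (\<lambda>k. hs ! (inv_into UNIV \<sigma> k)) [0..<length hs]) \<subseteq> set hs"
      by auto
    then show ?thesis
      using assms unfolding nonzero_tuples_def mem_Collect_eq length_map length_upt by (metis diff_zero order_trans)
  qed
  then have "shuffle l hs \<in> carrier (free_Abelian_group (nonzero_tuples H s))"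
    unfolding shuffle_def carrier_free_Abelian_group_iff
    by (intro order_trans[OF keys_sum] UN_least order_trans[OF keys_cmul]) auto
  then show ?thesis by simp
qed

lemma shuffles_subset:
  "{shuffle l hs | l hs. 1 \<le> l \<and> l < s \<and> hs \<in> nonzero_tuples H s}
    \<subseteq> carrier (free_Abelian_group (nonzero_tuples H s))"
  using shuffle_in_free by fastforce

lemma shuffle_subgroup_subgroup:
  "subgroup (shuffle_subgroup H s) (free_Abelian_group (nonzero_tuples H s))"
  unfolding shuffle_subgroup_def
  by (intro group.generate_is_subgroup group_free_Abelian_group shuffles_subset)

lemma comm_group_Mbar: "comm_group (Mbar H s)"
  unfolding Mbar_def
  using comm_group.abelian_FactGroup abelian_free_Abelian_group shuffle_subgroup_subgroup by blast

lemma group_Mbar [simp]: "group (Mbar H s)"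
  using comm_group_Mbar comm_group.axioms(2) by blast

lemma Mbar_coset_hom:
  "(\<lambda>x. shuffle_subgroup H s #>\<^bsub>free_Abelian_group (nonzero_tuples H s)\<^esub> x)
    \<in> hom (free_Abelian_group (nonzero_tuples H s)) (Mbar H s)"
  unfolding Mbar_def
  using comm_group.r_coset_hom abelian_free_Abelian_group shuffle_subgroup_subgroup by blast

lemma Mbar_class_closed:
  assumes "ks \<in> nonzero_tuples H s"
  shows "Mbar_class H ks \<in> carrier (Mbar H s)"
  using assms by (auto simp: Mbar_class_def Mbar_def carrier_FactGroup nonzero_tuples_def)

lemma chain_basis_closed:
  assumes "hs \<in> nonzero_tuples H r" "ks \<in> nonzero_tuples H s"
  shows "chain_basis H hs ks
    \<in> carrier (tensor_group (free_Abelian_group (nonzero_tuples H r)) (Mbar H s))"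
  using assms Mbar_class_closed[OF assms(2)]
  by (auto simp: chain_basis_def nonzero_tuples_def intro!: pure_tensor_closed)

lemma comm_group_chains:
  "comm_group (tensor_group (free_Abelian_group (nonzero_tuples H r)) (Mbar H s))"
  by (intro comm_group_tensor_group) simp_all

lemma comm_group_cochains:
  assumes "comm_group I"
  shows "comm_group (cochains H I r s)"
  unfolding cochains_def
  using assms comm_group_Hom_group comm_group_chains comm_group.axioms(2) by blast

text \<open>Generation in three layers: classes of tuples generate \<open>Mbar\<close>, tuples
  generate the left factor, and pure tensors generate the tensor product. Agreement is carried from
  the basis upwards, fixing one tensor factor at a time.\<close>

lemma cochain_eqI:
  assumes I: "comm_group I" and f: "f \<in> carrier (cochains H I r s)" and g: "g \<in> carrier (cochains H I r s)"
    and eq: "\<And>hs ks. hs \<in> nonzero_tuples H r \<Longrightarrow> ks \<in> nonzero_tuples H s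
      \<Longrightarrow> f (chain_basis H hs ks) = g (chain_basis H hs ks)"
  shows "f = g"
proof -
  let ?A = "free_Abelian_group (nonzero_tuples H r)" and ?M = "Mbar H s"
  let ?F = "free_Abelian_group (nonzero_tuples H s)"
  let ?q = "\<lambda>x. shuffle_subgroup H s #>\<^bsub>?F\<^esub> x"
  have GI: "group I" using I comm_group.axioms(2) by blast
  have fh: "f \<in> hom (tensor_group ?A ?M) I" and gh: "g \<in> hom (tensor_group ?A ?M) I"
    and ext: "f \<in> extensional (carrier (tensor_group ?A ?M))" "g \<in> extensional (carrier (tensor_group ?A ?M))"
    using f g by (auto simp: cochains_def Hom_group_def)
  have 1: "f (pure_tensor ?A ?M (frag_of hs) m) = g (pure_tensor ?A ?M (frag_of hs) m)"
    if hs: "hs \<in> nonzero_tuples H r" and m: "m \<in> carrier ?M" for hs m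
  proof -
    let ?t = "\<lambda>m. pure_tensor ?A ?M (frag_of hs) m"
    have t: "?t \<in> hom ?M (tensor_group ?A ?M)"
      using hs by (intro pure_tensor_hom_right) simp_all
    obtain c where c: "c \<in> carrier ?F" "m = ?q c"
      using m by (auto simp: Mbar_def carrier_FactGroup)
    have "(f \<circ> (?t \<circ> ?q)) c = (g \<circ> (?t \<circ> ?q)) c"
    proof (rule hom_free_Abelian_group_eq[OF GI _ _ _ c(1)])
      show "f \<circ> (?t \<circ> ?q) \<in> hom ?F I" "g \<circ> (?t \<circ> ?q) \<in> hom ?F I"
        using Mbar_coset_hom t fh gh by (meson hom_compose)+
      fix ks assume "ks \<in> nonzero_tuples H s"
      then show "(f \<circ> (?t \<circ> ?q)) (frag_of ks) = (g \<circ> (?t \<circ> ?q)) (frag_of ks)"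
        using eq[OF hs, of ks] hs by (simp add: chain_basis_def Mbar_class_def nonzero_tuples_def)
    qed
    then show ?thesis using c by simp
  qed
  have 2: "f (pure_tensor ?A ?M a m) = g (pure_tensor ?A ?M a m)"
    if a: "a \<in> carrier ?A" and m: "m \<in> carrier ?M" for a m
  proof -
    let ?t = "\<lambda>a. pure_tensor ?A ?M a m"
    have t: "?t \<in> hom ?A (tensor_group ?A ?M)"
      using m by (intro pure_tensor_hom_left) simp_all
    have "(f \<circ> ?t) a = (g \<circ> ?t) a"
      by (rule hom_free_Abelian_group_eq[OF GI hom_compose[OF t fh] hom_compose[OF t gh] _ a]) (simp add: 1 m)
    then show ?thesis by simp
  qed
  show ?thesis
    using hom_tensor_group_eq[OF _ _ GI fh gh] 2 by (intro extensionalityI[OF ext]) auto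
qed

text \<open>\<open>F\<close> is only a function on tuples, while a shuffle is a combination of
  tuples. Quantifying over the homomorphisms that extend \<open>F\<close>, which all agree on the
  free group, avoids naming the linear extension.\<close>

definition kills_shuffles ::
  "'h linear_cycle_set \<Rightarrow> 'i linear_cycle_set \<Rightarrow> nat \<Rightarrow> ('h list \<Rightarrow> 'i) \<Rightarrow> bool" where
  "kills_shuffles H I s F \<longleftrightarrow> (\<forall>\<phi> \<in> hom (free_Abelian_group (nonzero_tuples H s)) I.
     (\<forall>ks\<in>nonzero_tuples H s. \<phi> (frag_of ks) = F ks) \<longrightarrow>
     (\<forall>l ks. 1 \<le> l \<and> l < s \<and> ks \<in> nonzero_tuples H s \<longrightarrow> \<phi> (shuffle l ks) = \<one>\<^bsub>I\<^esub>))"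

text \<open>For fixed \<open>hs\<close> the function \<open>F hs\<close> descends to a homomorphism
  \<open>\<phi> hs\<close> on \<open>Mbar\<close>; for fixed \<open>m\<close> the function
  \<open>hs \<mapsto> \<phi> hs m\<close> extends to \<open>\<psi> m\<close> on the free group. The
  pairing of \<open>a\<close> and \<open>m\<close> to \<open>\<psi> m a\<close> is biadditive and so
  factors through the tensor product.\<close>

lemma cochain_exists:
  assumes I: "comm_group I"
    and closed: "\<And>hs ks. hs \<in> nonzero_tuples H r \<Longrightarrow> ks \<in> nonzero_tuples H s \<Longrightarrow> F hs ks \<in> carrier I"
    and kill: "\<And>hs. hs \<in> nonzero_tuples H r \<Longrightarrow> kills_shuffles H I s (F hs)"
  shows "\<exists>g. g \<in> carrier (cochains H I r s) \<and>
    (\<forall>hs\<in>nonzero_tuples H r. \<forall>ks\<in>nonzero_tuples H s. g (chain_basis H hs ks) = F hs ks)"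
proof -
  interpret I: comm_group I by fact
  let ?A = "free_Abelian_group (nonzero_tuples H r)" and ?M = "Mbar H s"
  let ?F = "free_Abelian_group (nonzero_tuples H s)"
  interpret M: comm_group ?M by (rule comm_group_Mbar)
  have "\<exists>\<phi>. \<phi> \<in> hom ?M I \<and> (\<forall>ks\<in>nonzero_tuples H s. \<phi> (Mbar_class H ks) = F hs ks)"
    if hs: "hs \<in> nonzero_tuples H r" for hs
  proof -
    have "F hs ` nonzero_tuples H s \<subseteq> carrier I" using closed hs by auto
    then obtain \<phi> where \<phi>: "\<phi> \<in> hom ?F I" "\<And>ks. ks \<in> nonzero_tuples H s \<Longrightarrow> \<phi> (frag_of ks) = F hs ks"
      using I.free_Abelian_group_universal by blast
    have "\<phi> x = \<one>\<^bsub>I\<^esub>" if "x \<in> {shuffle l hs | l hs. 1 \<le> l \<and> l < s \<and> hs \<in> nonzero_tuples H s}" for x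
      using kill[OF hs] \<phi> that unfolding kills_shuffles_def by blast
    then obtain \<psi> where \<psi>: "\<psi> \<in> hom ?M I"
      "\<And>x. x \<in> carrier ?F \<Longrightarrow> \<psi> (shuffle_subgroup H s #>\<^bsub>?F\<^esub> x) = \<phi> x"
      using comm_group.Mod_generate_universal[OF abelian_free_Abelian_group \<phi>(1) I.is_group shuffles_subset]
      unfolding Mbar_def shuffle_subgroup_def by blast
    have "\<psi> (Mbar_class H ks) = F hs ks" if "ks \<in> nonzero_tuples H s" for ks
      using \<psi>(2)[of "frag_of ks"] \<phi>(2)[OF that] that by (simp add: Mbar_class_def nonzero_tuples_def)
    then show ?thesis using \<psi>(1) by blast
  qed
  then obtain \<phi> where \<phi>: "\<And>hs. hs \<in> nonzero_tuples H r \<Longrightarrow> \<phi> hs \<in> hom ?M I"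
    "\<And>hs ks. hs \<in> nonzero_tuples H r \<Longrightarrow> ks \<in> nonzero_tuples H s \<Longrightarrow> \<phi> hs (Mbar_class H ks) = F hs ks"
    by metis
  have "\<exists>\<psi>. \<psi> \<in> hom ?A I \<and> (\<forall>hs\<in>nonzero_tuples H r. \<psi> (frag_of hs) = \<phi> hs m)" if m: "m \<in> carrier ?M" for m
  proof -
    have "(\<lambda>hs. \<phi> hs m) ` nonzero_tuples H r \<subseteq> carrier I" using hom_in_carrier[OF \<phi>(1) m] by auto
    then show ?thesis using I.free_Abelian_group_universal by metis
  qed
  then obtain \<psi> where \<psi>: "\<And>m. m \<in> carrier ?M \<Longrightarrow> \<psi> m \<in> hom ?A I"
    "\<And>m hs. m \<in> carrier ?M \<Longrightarrow> hs \<in> nonzero_tuples H r \<Longrightarrow> \<psi> m (frag_of hs) = \<phi> hs m"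
    by metis
  \<comment> \<open>Additivity in \<open>m\<close> is not built in, because \<open>\<psi> m\<close>
    is chosen separately for each \<open>m\<close>. It holds on basis tuples, where
    \<open>\<psi>\<close> reduces to the homomorphisms \<open>\<phi> hs\<close>, and this determines
    it.\<close>
  have right: "\<psi> (m \<otimes>\<^bsub>?M\<^esub> m') a = \<psi> m a \<otimes>\<^bsub>I\<^esub> \<psi> m' a"
    if a: "a \<in> carrier ?A" and m: "m \<in> carrier ?M" "m' \<in> carrier ?M" for a m m'
  proof (rule hom_free_Abelian_group_eq[OF I.is_group _ _ _ a])
    show "\<psi> (m \<otimes>\<^bsub>?M\<^esub> m') \<in> hom ?A I" using \<psi>(1) m by simp
    show "(\<lambda>a. \<psi> m a \<otimes>\<^bsub>I\<^esub> \<psi> m' a) \<in> hom ?A I"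
      using \<psi>(1) m by (intro hom_mult_closed) (simp_all add: I.comm_group_axioms)
    fix hs assume hs: "hs \<in> nonzero_tuples H r"
    show "\<psi> (m \<otimes>\<^bsub>?M\<^esub> m') (frag_of hs) = \<psi> m (frag_of hs) \<otimes>\<^bsub>I\<^esub> \<psi> m' (frag_of hs)"
      using \<psi>(2)[OF _ hs] m hom_mult[OF \<phi>(1)[OF hs]] by simp
  qed
  obtain g where g: "g \<in> hom (tensor_group ?A ?M) I"
    "\<And>a m. a \<in> carrier ?A \<Longrightarrow> m \<in> carrier ?M \<Longrightarrow> g (pure_tensor ?A ?M a m) = \<psi> m a"
  proof (rule I.tensor_group_universal[of ?A ?M "\<lambda>a m. \<psi> m a"])
    fix a a' m assume "a \<in> carrier ?A" "a' \<in> carrier ?A" "m \<in> carrier ?M"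
    then show "\<psi> m (a \<otimes>\<^bsub>?A\<^esub> a') = \<psi> m a \<otimes>\<^bsub>I\<^esub> \<psi> m a'"
      by (intro hom_mult[OF \<psi>(1)])
  next
    fix a m assume "a \<in> carrier ?A" "m \<in> carrier ?M"
    then show "\<psi> m a \<in> carrier I" using \<psi>(1) hom_in_carrier by metis
  qed (auto simp: right simp del: carrier_free_Abelian_group_iff mult_free_Abelian_group)
  let ?g = "restrict g (carrier (tensor_group ?A ?M))"
  show ?thesis
  proof (intro exI[of _ ?g] conjI ballI)
    show "?g \<in> carrier (cochains H I r s)"
      using g(1) unfolding cochains_def Hom_group_def
      by (simp add: restrict_in_hom[OF comm_group.axioms(2)[OF comm_group_chains]])
    fix hs ks assume hk: "hs \<in> nonzero_tuples H r" "ks \<in> nonzero_tuples H s"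
    have "?g (chain_basis H hs ks) = g (chain_basis H hs ks)"
      using chain_basis_closed[OF hk] by simp
    also have "\<dots> = g (pure_tensor ?A ?M (frag_of hs) (Mbar_class H ks))"
      using hk by (simp add: chain_basis_def nonzero_tuples_def)
    also have "\<dots> = F hs ks"
      using hk g(2)[of "frag_of hs" "Mbar_class H ks"] \<psi>(2)[of "Mbar_class H ks" hs] \<phi>(2)[OF hk] Mbar_class_closed[OF hk(2)]
      by simp
    finally show "?g (chain_basis H hs ks) = F hs ks" .
  qed
qed

text \<open>Existence and uniqueness together make the definite description denote the intended
  cochain. All values of differentials are obtained from here.\<close>

lemma cochain_with_values:
  assumes I: "comm_group I"
    and closed: "\<And>hs ks. hs \<in> nonzero_tuples H r \<Longrightarrow> ks \<in> nonzero_tuples H s \<Longrightarrow> F hs ks \<in> carrier I"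
    and kill: "\<And>hs. hs \<in> nonzero_tuples H r \<Longrightarrow> kills_shuffles H I s (F hs)"
  shows cochain_with_values_closed: "cochain_with_values H I r s F \<in> carrier (cochains H I r s)"
    and cochain_with_values_basis: "\<And>hs ks. hs \<in> nonzero_tuples H r \<Longrightarrow> ks \<in> nonzero_tuples H s
      \<Longrightarrow> cochain_with_values H I r s F (chain_basis H hs ks) = F hs ks"
proof -
  let ?P = "\<lambda>g. g \<in> carrier (cochains H I r s) \<and>
     (\<forall>hs\<in>nonzero_tuples H r. \<forall>ks\<in>nonzero_tuples H s. g (chain_basis H hs ks) = F hs ks)"
  obtain g where g: "?P g" using cochain_exists[where F = F and r = r, OF assms] by blast
  have "?P (cochain_with_values H I r s F)"
    unfolding cochain_with_values_def
  proof (rule theI[of ?P, OF g])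
    show "h = g" if "?P h" for h
      using that g by (intro cochain_eqI[OF I]) auto
  qed
  then show "cochain_with_values H I r s F \<in> carrier (cochains H I r s)"
    "\<And>hs ks. hs \<in> nonzero_tuples H r \<Longrightarrow> ks \<in> nonzero_tuples H s
      \<Longrightarrow> cochain_with_values H I r s F (chain_basis H hs ks) = F hs ks"
    by simp_all
qed

section \<open>Values of cochains on tuples that may contain zero\<close>

lemma cochain_value_closed:
  assumes "comm_group I" "f \<in> carrier (cochains H I r s)" "hs \<in> tuples H r" "ks \<in> tuples H s"
  shows "cochain_value H I f hs ks \<in> carrier I"
proof -
  interpret I: comm_group I by fact
  show ?thesis
  proof (cases "\<one>\<^bsub>H\<^esub> \<in> set hs \<union> set ks")
    case False
    have "f \<in> hom (tensor_group (free_Abelian_group (nonzero_tuples H r)) (Mbar H s)) I"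
      using assms(2) by (simp add: cochains_def Hom_group_def)
    moreover have "hs \<in> nonzero_tuples H r" "ks \<in> nonzero_tuples H s"
      using False assms by (auto simp: nonzero_tuples_iff)
    ultimately show ?thesis
      using hom_in_carrier[OF _ chain_basis_closed] False by (auto simp: cochain_value_def)
  qed (simp add: cochain_value_def)
qed

lemma cochain_value_zero:
  assumes "\<one>\<^bsub>H\<^esub> \<in> set hs \<union> set ks"
  shows "cochain_value H I f hs ks = \<one>\<^bsub>I\<^esub>"
  using assms by (simp add: cochain_value_def)

text \<open>The value at a tuple with a zero entry is zero by convention, whatever \<open>F\<close>
  says there. Hence \<open>F\<close> itself must vanish on such tuples for the formula to hold on
  all of \<open>tuples\<close>.\<close>

lemma cochain_value_cochain_with_values:
  assumes "comm_group I"
    and "\<And>hs ks. hs \<in> nonzero_tuples H r \<Longrightarrow> ks \<in> nonzero_tuples H s \<Longrightarrow> F hs ks \<in> carrier I"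
    and "\<And>hs. hs \<in> nonzero_tuples H r \<Longrightarrow> kills_shuffles H I s (F hs)"
    and zero: "\<And>hs ks. hs \<in> tuples H r \<Longrightarrow> ks \<in> tuples H s \<Longrightarrow> \<one>\<^bsub>H\<^esub> \<in> set hs \<union> set ks
      \<Longrightarrow> F hs ks = \<one>\<^bsub>I\<^esub>"
    and hk: "hs \<in> tuples H r" "ks \<in> tuples H s"
  shows "cochain_value H I (cochain_with_values H I r s F) hs ks = F hs ks"
  using cochain_with_values_basis[OF assms(1-3)] hk zero[OF hk]
  by (auto simp: cochain_value_def nonzero_tuples_iff)

lemma cochain_eq_iff:
  assumes "comm_group I" "f \<in> carrier (cochains H I r s)" "g \<in> carrier (cochains H I r s)"
  shows "f = g \<longleftrightarrow>
    (\<forall>hs\<in>tuples H r. \<forall>ks\<in>tuples H s. cochain_value H I f hs ks = cochain_value H I g hs ks)"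
    (is "_ \<longleftrightarrow> ?R")
proof
  assume R: ?R
  show "f = g"
  proof (rule cochain_eqI[OF assms])
    fix hs ks assume "hs \<in> nonzero_tuples H r" "ks \<in> nonzero_tuples H s"
    then show "f (chain_basis H hs ks) = g (chain_basis H hs ks)"
      using R by (auto simp: nonzero_tuples_iff cochain_value_def split: if_splits)
  qed
qed simp

lemma cochain_value_mult:
  assumes "comm_group I" "hs \<in> tuples H r" "ks \<in> tuples H s"
  shows "cochain_value H I (f \<otimes>\<^bsub>cochains H I r s\<^esub> g) hs ks =
    cochain_value H I f hs ks \<otimes>\<^bsub>I\<^esub> cochain_value H I g hs ks"
proof -
  interpret I: comm_group I by fact
  show ?thesis
    using assms chain_basis_closed[of hs H r ks s]
    by (auto simp: cochain_value_def cochains_def Hom_group_def nonzero_tuples_iff)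
qed

lemma cochain_value_one:
  assumes "hs \<in> tuples H r" "ks \<in> tuples H s"
  shows "cochain_value H I \<one>\<^bsub>cochains H I r s\<^esub> hs ks = \<one>\<^bsub>I\<^esub>"
  using assms chain_basis_closed[of hs H r ks s]
  by (auto simp: cochain_value_def cochains_def Hom_group_def nonzero_tuples_iff)

section \<open>Shuffles of two and three elements\<close>

text \<open>Obtained by inserting 0 into the two permutations of \<open>{1, 2}\<close>. With the six
  permutations listed, the shuffles among them are found by evaluation.\<close>

lemma permutes_lessThan_3:
  "{\<sigma>. \<sigma> permutes {..<3::nat}} =
     {id, transpose 1 2, transpose 0 1, transpose 0 1 \<circ> transpose 1 2, transpose 0 2, transpose 0 2 \<circ> transpose 1 2}"
proof -
  have 3: "{..<3::nat} = insert 0 {1, 2}" by auto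
  have "{(b, p). b \<in> insert 0 {1, 2::nat} \<and> p \<in> {p. p permutes {1, 2::nat}}}
      = {0, 1, 2} \<times> {id, transpose 1 2}"
    by (auto simp: permutes_doubleton_iff)
  then show ?thesis
    unfolding 3 permutes_insert by auto
qed

lemma shuffle_perms_1_2: "shuffle_perms 1 2 = {id, transpose 0 1}"
proof -
  have 2: "{..<2::nat} = {0, 1}" by auto
  have "strict_mono_on {..<1::nat} \<sigma>" "strict_mono_on {1..<2::nat} \<sigma>" for \<sigma> :: "nat \<Rightarrow> nat"
    by (auto simp: strict_mono_on_def)
  then show ?thesis
    by (auto simp: shuffle_perms_def 2 permutes_doubleton_iff)
qed

lemma shuffle_perms_1_3: "shuffle_perms 1 3 = {id, transpose 0 1, transpose 0 2 \<circ> transpose 1 2}"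
proof -
  have "strict_mono_on {..<1::nat} \<sigma>" for \<sigma> :: "nat \<Rightarrow> nat"
    by (auto simp: strict_mono_on_def)
  moreover have "strict_mono_on {1..<3::nat} \<sigma> \<longleftrightarrow> \<sigma> 1 < \<sigma> 2" for \<sigma> :: "nat \<Rightarrow> nat"
  proof -
    have "{1..<3::nat} = {1, 2}" by auto
    then show ?thesis by (auto simp: strict_mono_on_def)
  qed
  ultimately have "shuffle_perms 1 3 = {\<sigma> \<in> {\<sigma>. \<sigma> permutes {..<3::nat}}. \<sigma> 1 < \<sigma> 2}"
    by (auto simp: shuffle_perms_def)
  also have "\<dots> = {id, transpose 0 1, transpose 0 2 \<circ> transpose 1 2}"
    unfolding permutes_lessThan_3 by (auto simp: transpose_def)
  finally show ?thesis .
qed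

lemma shuffle_perms_2_3: "shuffle_perms 2 3 = {id, transpose 1 2, transpose 0 1 \<circ> transpose 1 2}"
proof -
  have "strict_mono_on {2..<3::nat} \<sigma>" for \<sigma> :: "nat \<Rightarrow> nat"
    by (auto simp: strict_mono_on_def)
  moreover have "strict_mono_on {..<2::nat} \<sigma> \<longleftrightarrow> \<sigma> 0 < \<sigma> 1" for \<sigma> :: "nat \<Rightarrow> nat"
  proof -
    have "{..<2::nat} = {0, 1}" by auto
    then show ?thesis by (auto simp: strict_mono_on_def)
  qed
  ultimately have "shuffle_perms 2 3 = {\<sigma> \<in> {\<sigma>. \<sigma> permutes {..<3::nat}}. \<sigma> 0 < \<sigma> 1}"
    by (auto simp: shuffle_perms_def)
  also have "\<dots> = {id, transpose 1 2, transpose 0 1 \<circ> transpose 1 2}"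
    unfolding permutes_lessThan_3 by (auto simp: transpose_def)
  finally show ?thesis .
qed

lemma inv_transpose_comp: "inv_into UNIV (transpose a b \<circ> transpose c d) = transpose c d \<circ> transpose a b"
  by (simp add: o_inv_distrib)

lemma shuffle_1_2: "shuffle 1 [a, b] = frag_of [a, b] - frag_of [b, a]"
proof -
  \<comment> \<open>Distinctness lets the sum over the explicit set of permutations be expanded term
    by term.\<close>
  have "id \<noteq> (transpose 0 1 :: nat \<Rightarrow> nat)" by (auto simp: fun_eq_iff transpose_def)
  then show ?thesis
    by (simp add: shuffle_def shuffle_perms_1_2[simplified] numeral_2_eq_2[symmetric] sign_swap_id upt_rec)
qed

text \<open>Entry \<open>i\<close> moves to position \<open>\<sigma> i\<close>: here
  \<open>a\<close> is inserted into \<open>[b, c]\<close> at each of the three places, with a sign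
  for every entry it passes.\<close>

lemma shuffle_1_3: "shuffle 1 [a, b, c] = frag_of [a, b, c] + frag_of [b, c, a] - frag_of [b, a, c]"
proof -
  have "id \<noteq> (transpose 0 1 :: nat \<Rightarrow> nat)" "id \<noteq> (transpose 0 2 \<circ> transpose 1 2 :: nat \<Rightarrow> nat)"
    "transpose 0 1 \<noteq> (transpose 0 2 \<circ> transpose 1 2 :: nat \<Rightarrow> nat)"
    by (auto simp: fun_eq_iff transpose_def)
  moreover have "[0..<3] = [0, 1, 2]" by (simp add: upt_rec)
  ultimately show ?thesis
    by (simp add: shuffle_def numeral_3_eq_3[symmetric] shuffle_perms_1_3[simplified] inv_transpose_comp
        sign_compose sign_swap_id permutation_compose permutation_swap_id)
qed

text \<open>Now \<open>c\<close> is the entry that is inserted, into \<open>[a, b]\<close> and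
  starting from the right.\<close>

lemma shuffle_2_3: "shuffle 2 [a, b, c] = frag_of [a, b, c] + frag_of [c, a, b] - frag_of [a, c, b]"
proof -
  have "id \<noteq> (transpose 1 2 :: nat \<Rightarrow> nat)" "id \<noteq> (transpose 0 1 \<circ> transpose 1 2 :: nat \<Rightarrow> nat)"
    "transpose 1 2 \<noteq> (transpose 0 1 \<circ> transpose 1 2 :: nat \<Rightarrow> nat)"
    by (auto simp: fun_eq_iff transpose_def)
  moreover have "[0..<3] = [0, 1, 2]" by (simp add: upt_rec)
  ultimately show ?thesis
    by (simp add: shuffle_def numeral_3_eq_3[symmetric] shuffle_perms_2_3 inv_transpose_comp
        sign_compose sign_swap_id permutation_compose permutation_swap_id)
qed

section \<open>Shuffle conditions on functions of one, two and three arguments\<close>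

lemma kills_shuffles_1: "kills_shuffles H I 1 F"
  by (simp add: kills_shuffles_def)

text \<open>Only \<open>l = 1\<close> occurs, with the shuffle \<open>[a, b] - [b, a]\<close>.
  Adding \<open>[b, a]\<close> back and applying \<open>\<phi>\<close> turns the symmetry of
  \<open>F\<close> into vanishing on the shuffle.\<close>

lemma kills_shuffles_2:
  assumes I: "comm_group I"
    and sym: "\<And>a b. [a, b] \<in> nonzero_tuples H 2 \<Longrightarrow> F [a, b] = F [b, a]"
  shows "kills_shuffles H I 2 F"
  unfolding kills_shuffles_def
proof (intro ballI impI allI)
  interpret I: comm_group I by fact
  fix \<phi> and l :: nat and ks assume \<phi>: "\<phi> \<in> hom (free_Abelian_group (nonzero_tuples H 2)) I"
    "\<forall>ks\<in>nonzero_tuples H 2. \<phi> (frag_of ks) = F ks"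
    and l: "1 \<le> l \<and> l < 2 \<and> ks \<in> nonzero_tuples H 2"
  then obtain a b where ks: "ks = [a, b]"
    by (auto simp: nonzero_tuples_def numeral_2_eq_2 length_Suc_conv)
  have ab: "[a, b] \<in> nonzero_tuples H 2" "[b, a] \<in> nonzero_tuples H 2"
    using l ks by (auto simp: nonzero_tuples_def)
  have "l = 1" using l by auto
  let ?S = "nonzero_tuples H 2" and ?x = "frag_of [a, b] - frag_of [b, a]"
  have x: "shuffle l ks = ?x" "Poly_Mapping.keys ?x \<subseteq> ?S"
    using shuffle_1_2[of a b] shuffle_in_free[OF ab(1), of 1] unfolding \<open>l = 1\<close> ks by simp_all
  have "\<phi> (?x \<otimes>\<^bsub>free_Abelian_group ?S\<^esub> frag_of [b, a]) = \<phi> ?x \<otimes>\<^bsub>I\<^esub> \<phi> (frag_of [b, a])"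
    using hom_mult[OF \<phi>(1), of ?x "frag_of [b, a]"] x ab by simp
  then have "\<phi> (frag_of [a, b]) = \<phi> ?x \<otimes>\<^bsub>I\<^esub> \<phi> (frag_of [b, a])"
    by simp
  moreover have "\<phi> (frag_of [a, b]) = \<phi> (frag_of [b, a])"
    using \<phi>(2) ab sym by simp
  moreover have "\<phi> ?x \<in> carrier I" "\<phi> (frag_of [b, a]) \<in> carrier I"
    using hom_in_carrier[OF \<phi>(1)] x ab by auto
  ultimately show "\<phi> (shuffle l ks) = \<one>\<^bsub>I\<^esub>"
    unfolding x(1) by simp
qed

text \<open>The two conditions are those of \<open>l = 1\<close> and \<open>l = 2\<close>, with the
  negative term of the shuffle moved to the other side so that no inverse appears.\<close>

lemma kills_shuffles_3:
  assumes I: "comm_group I"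
    and 1: "\<And>a b c. [a, b, c] \<in> nonzero_tuples H 3 \<Longrightarrow> F [a, b, c] \<otimes>\<^bsub>I\<^esub> F [b, c, a] = F [b, a, c]"
    and 2: "\<And>a b c. [a, b, c] \<in> nonzero_tuples H 3 \<Longrightarrow> F [a, b, c] \<otimes>\<^bsub>I\<^esub> F [c, a, b] = F [a, c, b]"
  shows "kills_shuffles H I 3 F"
  unfolding kills_shuffles_def
proof (intro ballI impI allI)
  interpret I: comm_group I by fact
  let ?S = "nonzero_tuples H 3"
  fix \<phi> and l :: nat and ks assume \<phi>: "\<phi> \<in> hom (free_Abelian_group ?S) I" "\<forall>ks\<in>?S. \<phi> (frag_of ks) = F ks"
    and l: "1 \<le> l \<and> l < 3 \<and> ks \<in> ?S"
  obtain a b c where ks: "ks = [a, b, c]"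
    using l by (auto simp: nonzero_tuples_def numeral_3_eq_3 length_Suc_conv)
  have eq_one: "\<phi> x = \<one>\<^bsub>I\<^esub>"
    if pqr: "p \<in> ?S" "q \<in> ?S" "r \<in> ?S" and F: "F p \<otimes>\<^bsub>I\<^esub> F q = F r" and x: "x = frag_of p + frag_of q - frag_of r"
      and kx: "Poly_Mapping.keys x \<subseteq> ?S" for p q r x
  proof -
    have "\<phi> (x \<otimes>\<^bsub>free_Abelian_group ?S\<^esub> frag_of r) = \<phi> x \<otimes>\<^bsub>I\<^esub> \<phi> (frag_of r)"
      using hom_mult[OF \<phi>(1), of x "frag_of r"] kx pqr by simp
    moreover have "\<phi> (frag_of p \<otimes>\<^bsub>free_Abelian_group ?S\<^esub> frag_of q) = \<phi> (frag_of p) \<otimes>\<^bsub>I\<^esub> \<phi> (frag_of q)"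
      using hom_mult[OF \<phi>(1), of "frag_of p" "frag_of q"] pqr by simp
    ultimately have "\<phi> x \<otimes>\<^bsub>I\<^esub> \<phi> (frag_of r) = \<phi> (frag_of r)"
      using F \<phi>(2) pqr x by simp
    moreover have "\<phi> x \<in> carrier I" "\<phi> (frag_of r) \<in> carrier I"
      using hom_in_carrier[OF \<phi>(1)] kx pqr by auto
    ultimately show ?thesis by simp
  qed
  have S: "[a, b, c] \<in> ?S" "[b, c, a] \<in> ?S" "[b, a, c] \<in> ?S" "[c, a, b] \<in> ?S" "[a, c, b] \<in> ?S"
    using l ks by (auto simp: nonzero_tuples_def)
  consider "l = 1" | "l = 2" using l by linarith
  then show "\<phi> (shuffle l ks) = \<one>\<^bsub>I\<^esub>"
  proof cases
    case 1
    show ?thesis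
      using eq_one[OF S(1,2,3) assms(2)[OF S(1)]] shuffle_1_3[of a b c] shuffle_in_free[OF S(1), of 1]
      unfolding 1 ks by simp
  next
    case 2
    show ?thesis
      using eq_one[OF S(1,4,5) assms(3)[OF S(1)]] shuffle_2_3[of a b c] shuffle_in_free[OF S(1), of 2]
      unfolding 2 ks by simp
  qed
qed

text \<open>The difference of the two tuples is itself a shuffle, so their cosets coincide. This is
  the converse of the symmetry criterion: every cochain of bidegree \<open>(r, 2)\<close> is
  symmetric in its last two arguments.\<close>

lemma Mbar_class_swap:
  assumes "[a, b] \<in> nonzero_tuples H 2"
  shows "Mbar_class H [a, b] = Mbar_class H [b, a]"
proof -
  let ?F = "free_Abelian_group (nonzero_tuples H 2)"
  interpret F: group ?F by simp
  have ba: "[b, a] \<in> nonzero_tuples H 2" using assms by (auto simp: nonzero_tuples_def)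
  have "shuffle 1 [a, b] \<in> {shuffle l hs | l hs. 1 \<le> l \<and> l < 2 \<and> hs \<in> nonzero_tuples H 2}"
    using assms by fastforce
  then have "shuffle 1 [a, b] \<in> shuffle_subgroup H 2"
    unfolding shuffle_subgroup_def by (rule generate.incl)
  then have "frag_of [a, b] \<in> shuffle_subgroup H 2 #>\<^bsub>?F\<^esub> frag_of [b, a]"
    unfolding r_coset_def by (rule UN_I) (simp add: shuffle_1_2[simplified])
  then show ?thesis
    using F.repr_independence[OF _ _ shuffle_subgroup_subgroup] ba
    by (simp add: Mbar_class_def numeral_2_eq_2[symmetric])
qed

lemma cochain_value_swap:
  assumes "a \<in> carrier H" "b \<in> carrier H"
  shows "cochain_value H I f hs [a, b] = cochain_value H I f hs [b, a]"
  using assms Mbar_class_swap[of a b H]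
  by (auto simp: cochain_value_def chain_basis_def nonzero_tuples_def)

section \<open>The low-dimensional differentials\<close>

locale lcs_actions =
  H: linear_cycle_set H + I: trivial_linear_cycle_set I
  for H :: "'h linear_cycle_set" and I :: "'i linear_cycle_set" +
  fixes dia :: "'h \<Rightarrow> 'i \<Rightarrow> 'i"  (infixr "\<diamondop>" 75)
    and lt :: "'i \<Rightarrow> 'h \<Rightarrow> 'i"  (infixl "\<leftthreetimes>" 75)
  assumes dia_closed [simp]: "\<lbrakk>h \<in> carrier H; y \<in> carrier I\<rbrakk> \<Longrightarrow> h \<diamondop> y \<in> carrier I"
    and lt_closed [simp]: "\<lbrakk>y \<in> carrier I; h \<in> carrier H\<rbrakk> \<Longrightarrow> y \<leftthreetimes> h \<in> carrier I"
    and dia_add: "\<lbrakk>h \<in> carrier H; y \<in> carrier I; y' \<in> carrier I\<rbrakk>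
          \<Longrightarrow> h \<diamondop> (y \<otimes>\<^bsub>I\<^esub> y') = (h \<diamondop> y) \<otimes>\<^bsub>I\<^esub> (h \<diamondop> y')"
    and zero_dia [simp]: "y \<in> carrier I \<Longrightarrow> \<one>\<^bsub>H\<^esub> \<diamondop> y = y"
    and lt_zero [simp]: "y \<in> carrier I \<Longrightarrow> y \<leftthreetimes> \<one>\<^bsub>H\<^esub> = \<one>\<^bsub>I\<^esub>"
    and lt_add: "\<lbrakk>y \<in> carrier I; h \<in> carrier H; h' \<in> carrier H\<rbrakk>
          \<Longrightarrow> y \<leftthreetimes> (h \<otimes>\<^bsub>H\<^esub> h') = (y \<leftthreetimes> h) \<otimes>\<^bsub>I\<^esub> (y \<leftthreetimes> h')"
    and add_lt: "\<lbrakk>y \<in> carrier I; y' \<in> carrier I; h \<in> carrier H\<rbrakk>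
          \<Longrightarrow> (y \<otimes>\<^bsub>I\<^esub> y') \<leftthreetimes> h = (y \<leftthreetimes> h) \<otimes>\<^bsub>I\<^esub> (y' \<leftthreetimes> h)"
    and add_dia: "\<lbrakk>h \<in> carrier H; h' \<in> carrier H; y \<in> carrier I\<rbrakk>
          \<Longrightarrow> (h \<otimes>\<^bsub>H\<^esub> h') \<diamondop> y = (h \<cdot>\<^bsub>H\<^esub> h') \<diamondop> (h \<diamondop> y)"
    and dia_lt: "\<lbrakk>h \<in> carrier H; h' \<in> carrier H; y \<in> carrier I\<rbrakk>
          \<Longrightarrow> (h \<diamondop> y) \<leftthreetimes> (h \<cdot>\<^bsub>H\<^esub> h')
            = (h \<diamondop> (y \<leftthreetimes> h')) \<otimes>\<^bsub>I\<^esub> ((h \<diamondop> (y \<leftthreetimes> h)) \<leftthreetimes> (h \<cdot>\<^bsub>H\<^esub> h'))"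
    and dia_bij: "h \<in> carrier H \<Longrightarrow> bij_betw (\<lambda>y. h \<diamondop> y) (carrier I) (carrier I)"

section \<open>Elementary rules for linear cycle sets, abelian groups and the actions\<close>

context linear_cycle_set
begin

lemma cdot_closed [simp]: "\<lbrakk>a \<in> carrier A; b \<in> carrier A\<rbrakk> \<Longrightarrow> a \<cdot> b \<in> carrier A"
  using cdot_bij[of a] by (auto simp: bij_betw_def)

lemma cdot_one [simp]: "a \<in> carrier A \<Longrightarrow> a \<cdot> \<one> = \<one>"
  using cdot_add_right[of a \<one> \<one>] by simp

text \<open>From \<open>(0 + 0) \<cdot> a = (0 \<cdot> 0) \<cdot> (0 \<cdot> a)\<close> the map
  \<open>0 \<cdot> _\<close> is idempotent, and an injective idempotent map is the identity.\<close>

lemma one_cdot [simp]: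
  assumes "a \<in> carrier A" shows "\<one> \<cdot> a = a"
proof -
  have "\<one> \<cdot> (\<one> \<cdot> a) = \<one> \<cdot> a"
    using cdot_add_left[of \<one> \<one> a] assms by simp
  then show ?thesis
    using cdot_bij[of \<one>] assms by (auto simp: bij_betw_def inj_on_def)
qed

end

context comm_group
begin

lemma inv_cancel_left [simp]:
  "\<lbrakk>a \<in> carrier G; b \<in> carrier G\<rbrakk> \<Longrightarrow> inv a \<otimes> (a \<otimes> b) = b"
  "\<lbrakk>a \<in> carrier G; b \<in> carrier G\<rbrakk> \<Longrightarrow> a \<otimes> (inv a \<otimes> b) = b"
  by (simp_all add: m_assoc[symmetric])

text \<open>Clears all inverses from an equation, so that what remains can be decided by
  associativity and commutativity alone.\<close>

lemma diff_eq_diff_iff: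
  assumes "a \<in> carrier G" "b \<in> carrier G" "c \<in> carrier G" "d \<in> carrier G"
  shows "a \<otimes> inv b = c \<otimes> inv d \<longleftrightarrow> a \<otimes> d = c \<otimes> b"
proof -
  have "a \<otimes> inv b = c \<otimes> inv d \<longleftrightarrow> (a \<otimes> inv b) \<otimes> (b \<otimes> d) = (c \<otimes> inv d) \<otimes> (d \<otimes> b)"
    using assms right_cancel[of "b \<otimes> d" "a \<otimes> inv b" "c \<otimes> inv d"] by (simp add: m_comm[of d b])
  then show ?thesis using assms by (simp add: m_assoc)
qed

lemma diff_mult_diff:
  assumes "a \<in> carrier G" "b \<in> carrier G" "c \<in> carrier G" "d \<in> carrier G"
  shows "(a \<otimes> inv b) \<otimes> (c \<otimes> inv d) = (a \<otimes> c) \<otimes> inv (b \<otimes> d)"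
  using assms by (simp add: inv_mult m_ac)

end

context lcs_actions
begin

abbreviation hadd (infixl "+\<^sub>H" 65) where "h +\<^sub>H k \<equiv> h \<otimes>\<^bsub>H\<^esub> k"
abbreviation hdot (infixl "\<cdot>\<^sub>H" 70) where "h \<cdot>\<^sub>H k \<equiv> h \<cdot>\<^bsub>H\<^esub> k"
abbreviation iadd (infixl "+\<^sub>I" 65) where "x +\<^sub>I y \<equiv> x \<otimes>\<^bsub>I\<^esub> y"
abbreviation idiff (infixl "-\<^sub>I" 65) where "x -\<^sub>I y \<equiv> x \<otimes>\<^bsub>I\<^esub> inv\<^bsub>I\<^esub> y"

lemma comm_group_I: "comm_group I" by (rule I.comm_group_axioms)

lemma dia_one [simp]: "h \<in> carrier H \<Longrightarrow> h \<diamondop> \<one>\<^bsub>I\<^esub> = \<one>\<^bsub>I\<^esub>"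
  using dia_add[of h "\<one>\<^bsub>I\<^esub>" "\<one>\<^bsub>I\<^esub>"] by simp

lemma one_lt [simp]: "h \<in> carrier H \<Longrightarrow> \<one>\<^bsub>I\<^esub> \<leftthreetimes> h = \<one>\<^bsub>I\<^esub>"
  using add_lt[of "\<one>\<^bsub>I\<^esub>" "\<one>\<^bsub>I\<^esub>" h] by simp

lemma dia_inv: 
  assumes "h \<in> carrier H" "y \<in> carrier I"
  shows "h \<diamondop> inv\<^bsub>I\<^esub> y = inv\<^bsub>I\<^esub> (h \<diamondop> y)"
  using assms dia_add[of h "inv\<^bsub>I\<^esub> y" y] by (intro I.inv_equality[symmetric]) (simp_all add: I.l_inv)

lemma lt_inv:
  assumes "h \<in> carrier H" "y \<in> carrier I"
  shows "inv\<^bsub>I\<^esub> y \<leftthreetimes> h = inv\<^bsub>I\<^esub> (y \<leftthreetimes> h)"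
  using assms add_lt[of "inv\<^bsub>I\<^esub> y" y h] by (intro I.inv_equality[symmetric]) (simp_all add: I.l_inv)

lemma R_map_simps:
  assumes "a \<in> carrier H" "b \<in> carrier H" "c \<in> carrier H"
  shows "R_map H 0 (Suc 0) [a] = a" "R_map H (Suc 0) (Suc 0) [a, b] = a \<cdot>\<^sub>H b"
    "R_map H 0 2 [a, b] = a +\<^sub>H b" "R_map H 2 (Suc 0) [a, b, c] = (a +\<^sub>H b) \<cdot>\<^sub>H c"
  using assms
  by (simp_all add: R_map_def numeral_2_eq_2 lessThan_Suc atLeastLessThanSuc Pi_iff H.m_comm)

lemma signed_simps:
  assumes "y \<in> carrier I"
  shows "signed I 0 y = y" "signed I (Suc 0) y = inv\<^bsub>I\<^esub> y" "signed I 2 y = y" "signed I 3 y = inv\<^bsub>I\<^esub> y"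
  using assms by (simp_all add: signed_def I.int_pow_neg)

lemma add_adjacent_simps:
  "add_adjacent H (Suc 0) (a # b # hs) = (a +\<^sub>H b) # hs"
  "add_adjacent H 2 (a # b # c # hs) = a # (b +\<^sub>H c) # hs"
  by (simp_all add: add_adjacent_def)

lemma tuples_simps:
  "hs \<in> tuples H (Suc 0) \<longleftrightarrow> (\<exists>a\<in>carrier H. hs = [a])"
  "hs \<in> tuples H 2 \<longleftrightarrow> (\<exists>a\<in>carrier H. \<exists>b\<in>carrier H. hs = [a, b])"
  "hs \<in> tuples H 3 \<longleftrightarrow> (\<exists>a\<in>carrier H. \<exists>b\<in>carrier H. \<exists>c\<in>carrier H. hs = [a, b, c])"
  by (auto simp: numeral_2_eq_2 numeral_3_eq_3 tuples_Suc tuples_0)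

lemmas nonzero_tuples_simps = nonzero_tuples_iff tuples_simps tuples_0

text \<open>An interface to the definite description for one bidegree; the next four lemmas do the
  same for the others. \<open>F\<close> is the raw formula on lists from the definition of a
  differential, \<open>G\<close> the same formula simplified on elements. Symmetry supplies the
  shuffle condition and also carries the vanishing at zero from the first argument to the
  second.\<close>

lemma cochain_with_values_02:
  assumes F: "\<And>a b. a \<in> carrier H \<Longrightarrow> b \<in> carrier H \<Longrightarrow> F [] [a, b] = G a b"
    and closed: "\<And>a b. a \<in> carrier H \<Longrightarrow> b \<in> carrier H \<Longrightarrow> G a b \<in> carrier I"
    and sym: "\<And>a b. a \<in> carrier H \<Longrightarrow> b \<in> carrier H \<Longrightarrow> G a b = G b a"
    and zero: "\<And>a. a \<in> carrier H \<Longrightarrow> G \<one>\<^bsub>H\<^esub> a = \<one>\<^bsub>I\<^esub>"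
  shows "cochain_with_values H I 0 2 F \<in> carrier (cochains H I 0 2) \<and>
    (\<forall>a\<in>carrier H. \<forall>b\<in>carrier H. cochain_value H I (cochain_with_values H I 0 2 F) [] [a, b] = G a b)"
proof -
  have c: "F hs ks \<in> carrier I" if "hs \<in> nonzero_tuples H 0" "ks \<in> nonzero_tuples H 2" for hs ks
    using that closed F by (auto simp: nonzero_tuples_simps)
  have k: "kills_shuffles H I 2 (F hs)" if "hs \<in> nonzero_tuples H 0" for hs
    using that F sym by (intro kills_shuffles_2[OF comm_group_I]) (auto simp: nonzero_tuples_simps)
  have zero': "G a \<one>\<^bsub>H\<^esub> = \<one>\<^bsub>I\<^esub>" if "a \<in> carrier H" for a
    using zero[OF that] sym[OF that H.one_closed] by simp
  have z: "F hs ks = \<one>\<^bsub>I\<^esub>" if "hs \<in> tuples H 0" "ks \<in> tuples H 2" "\<one>\<^bsub>H\<^esub> \<in> set hs \<union> set ks" for hs ks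
    using that F zero zero' by (auto simp: nonzero_tuples_simps)
  have "cochain_with_values H I 0 2 F \<in> carrier (cochains H I 0 2)"
    by (rule cochain_with_values_closed[where H = H and F = F and r = 0 and s = 2, OF comm_group_I c k])
  moreover have "cochain_value H I (cochain_with_values H I 0 2 F) [] [a, b] = G a b"
    if "a \<in> carrier H" "b \<in> carrier H" for a b
    using cochain_value_cochain_with_values[where H = H and F = F and r = 0 and s = 2 and hs = "[]" and ks = "[a, b]", OF comm_group_I c k z] that F
    by (auto simp: nonzero_tuples_simps)
  ultimately show ?thesis by blast
qed

lemma cochain_with_values_11:
  assumes F: "\<And>h a. h \<in> carrier H \<Longrightarrow> a \<in> carrier H \<Longrightarrow> F [h] [a] = G h a"
    and closed: "\<And>h a. h \<in> carrier H \<Longrightarrow> a \<in> carrier H \<Longrightarrow> G h a \<in> carrier I"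
    and zero: "\<And>a. a \<in> carrier H \<Longrightarrow> G \<one>\<^bsub>H\<^esub> a = \<one>\<^bsub>I\<^esub>" "\<And>h. h \<in> carrier H \<Longrightarrow> G h \<one>\<^bsub>H\<^esub> = \<one>\<^bsub>I\<^esub>"
  shows "cochain_with_values H I 1 1 F \<in> carrier (cochains H I 1 1) \<and>
    (\<forall>h\<in>carrier H. \<forall>a\<in>carrier H. cochain_value H I (cochain_with_values H I 1 1 F) [h] [a] = G h a)"
proof -
  have c: "F hs ks \<in> carrier I" if "hs \<in> nonzero_tuples H 1" "ks \<in> nonzero_tuples H 1" for hs ks
    using that closed F by (auto simp: nonzero_tuples_simps)
  have z: "F hs ks = \<one>\<^bsub>I\<^esub>" if "hs \<in> tuples H 1" "ks \<in> tuples H 1" "\<one>\<^bsub>H\<^esub> \<in> set hs \<union> set ks" for hs ks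
    using that F zero by (auto simp: nonzero_tuples_simps)
  have "cochain_with_values H I 1 1 F \<in> carrier (cochains H I 1 1)"
    by (rule cochain_with_values_closed[where H = H and F = F and r = 1 and s = 1, OF comm_group_I c kills_shuffles_1])
  moreover have "cochain_value H I (cochain_with_values H I 1 1 F) [h] [a] = G h a"
    if "h \<in> carrier H" "a \<in> carrier H" for h a
    using cochain_value_cochain_with_values[where H = H and F = F and r = 1 and s = 1 and hs = "[h]" and ks = "[a]", OF comm_group_I c kills_shuffles_1 z] that F
    by (auto simp: nonzero_tuples_simps)
  ultimately show ?thesis by blast
qed

lemma cochain_with_values_03:
  assumes F: "\<And>a b c. a \<in> carrier H \<Longrightarrow> b \<in> carrier H \<Longrightarrow> c \<in> carrier H \<Longrightarrow> F [] [a, b, c] = G a b c"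
    and closed: "\<And>a b c. a \<in> carrier H \<Longrightarrow> b \<in> carrier H \<Longrightarrow> c \<in> carrier H \<Longrightarrow> G a b c \<in> carrier I"
    and shuffles: "\<And>a b c. a \<in> carrier H \<Longrightarrow> b \<in> carrier H \<Longrightarrow> c \<in> carrier H \<Longrightarrow> G a b c +\<^sub>I G b c a = G b a c"
      "\<And>a b c. a \<in> carrier H \<Longrightarrow> b \<in> carrier H \<Longrightarrow> c \<in> carrier H \<Longrightarrow> G a b c +\<^sub>I G c a b = G a c b"
    and zero: "\<And>a b. a \<in> carrier H \<Longrightarrow> b \<in> carrier H \<Longrightarrow> G \<one>\<^bsub>H\<^esub> a b = \<one>\<^bsub>I\<^esub>"
      "\<And>a b. a \<in> carrier H \<Longrightarrow> b \<in> carrier H \<Longrightarrow> G a \<one>\<^bsub>H\<^esub> b = \<one>\<^bsub>I\<^esub>"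
      "\<And>a b. a \<in> carrier H \<Longrightarrow> b \<in> carrier H \<Longrightarrow> G a b \<one>\<^bsub>H\<^esub> = \<one>\<^bsub>I\<^esub>"
  shows "cochain_with_values H I 0 3 F \<in> carrier (cochains H I 0 3) \<and>
    (\<forall>a\<in>carrier H. \<forall>b\<in>carrier H. \<forall>c\<in>carrier H. cochain_value H I (cochain_with_values H I 0 3 F) [] [a, b, c] = G a b c)"
proof -
  have c: "F hs ks \<in> carrier I" if "hs \<in> nonzero_tuples H 0" "ks \<in> nonzero_tuples H 3" for hs ks
    using that closed F by (auto simp: nonzero_tuples_simps)
  have k: "kills_shuffles H I 3 (F hs)" if "hs \<in> nonzero_tuples H 0" for hs
    using that F shuffles by (intro kills_shuffles_3[OF comm_group_I]) (auto simp: nonzero_tuples_simps)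
  have z: "F hs ks = \<one>\<^bsub>I\<^esub>" if "hs \<in> tuples H 0" "ks \<in> tuples H 3" "\<one>\<^bsub>H\<^esub> \<in> set hs \<union> set ks" for hs ks
    using that F zero by (auto simp: nonzero_tuples_simps)
  have "cochain_with_values H I 0 3 F \<in> carrier (cochains H I 0 3)"
    by (rule cochain_with_values_closed[where H = H and F = F and r = 0 and s = 3, OF comm_group_I c k])
  moreover have "cochain_value H I (cochain_with_values H I 0 3 F) [] [a, b, c] = G a b c"
    if "a \<in> carrier H" "b \<in> carrier H" "c \<in> carrier H" for a b c
    using cochain_value_cochain_with_values[where H = H and F = F and r = 0 and s = 3 and hs = "[]" and ks = "[a, b, c]", OF comm_group_I c k z] that F
    by (auto simp: nonzero_tuples_simps)
  ultimately show ?thesis by blast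
qed

lemma cochain_with_values_12:
  assumes F: "\<And>h a b. h \<in> carrier H \<Longrightarrow> a \<in> carrier H \<Longrightarrow> b \<in> carrier H \<Longrightarrow> F [h] [a, b] = G h a b"
    and closed: "\<And>h a b. h \<in> carrier H \<Longrightarrow> a \<in> carrier H \<Longrightarrow> b \<in> carrier H \<Longrightarrow> G h a b \<in> carrier I"
    and sym: "\<And>h a b. h \<in> carrier H \<Longrightarrow> a \<in> carrier H \<Longrightarrow> b \<in> carrier H \<Longrightarrow> G h a b = G h b a"
    and zero: "\<And>a b. a \<in> carrier H \<Longrightarrow> b \<in> carrier H \<Longrightarrow> G \<one>\<^bsub>H\<^esub> a b = \<one>\<^bsub>I\<^esub>"
      "\<And>h a. h \<in> carrier H \<Longrightarrow> a \<in> carrier H \<Longrightarrow> G h \<one>\<^bsub>H\<^esub> a = \<one>\<^bsub>I\<^esub>"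
  shows "cochain_with_values H I 1 2 F \<in> carrier (cochains H I 1 2) \<and>
    (\<forall>h\<in>carrier H. \<forall>a\<in>carrier H. \<forall>b\<in>carrier H. cochain_value H I (cochain_with_values H I 1 2 F) [h] [a, b] = G h a b)"
proof -
  have c: "F hs ks \<in> carrier I" if "hs \<in> nonzero_tuples H 1" "ks \<in> nonzero_tuples H 2" for hs ks
    using that closed F by (auto simp: nonzero_tuples_simps)
  have k: "kills_shuffles H I 2 (F hs)" if "hs \<in> nonzero_tuples H 1" for hs
    using that F sym by (intro kills_shuffles_2[OF comm_group_I]) (auto simp: nonzero_tuples_simps)
  have zero': "G h a \<one>\<^bsub>H\<^esub> = \<one>\<^bsub>I\<^esub>" if "h \<in> carrier H" "a \<in> carrier H" for h a
    using zero(2)[OF that] sym[OF that H.one_closed] by simp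
  have z: "F hs ks = \<one>\<^bsub>I\<^esub>" if "hs \<in> tuples H 1" "ks \<in> tuples H 2" "\<one>\<^bsub>H\<^esub> \<in> set hs \<union> set ks" for hs ks
    using that F zero zero' by (auto simp: nonzero_tuples_simps)
  have "cochain_with_values H I 1 2 F \<in> carrier (cochains H I 1 2)"
    by (rule cochain_with_values_closed[where H = H and F = F and r = 1 and s = 2, OF comm_group_I c k])
  moreover have "cochain_value H I (cochain_with_values H I 1 2 F) [h] [a, b] = G h a b"
    if "h \<in> carrier H" "a \<in> carrier H" "b \<in> carrier H" for h a b
    using cochain_value_cochain_with_values[where H = H and F = F and r = 1 and s = 2 and hs = "[h]" and ks = "[a, b]", OF comm_group_I c k z] that F
    by (auto simp: nonzero_tuples_simps)
  ultimately show ?thesis by blast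
qed

lemma cochain_with_values_21:
  assumes F: "\<And>h k a. h \<in> carrier H \<Longrightarrow> k \<in> carrier H \<Longrightarrow> a \<in> carrier H \<Longrightarrow> F [h, k] [a] = G h k a"
    and closed: "\<And>h k a. h \<in> carrier H \<Longrightarrow> k \<in> carrier H \<Longrightarrow> a \<in> carrier H \<Longrightarrow> G h k a \<in> carrier I"
    and zero: "\<And>k a. k \<in> carrier H \<Longrightarrow> a \<in> carrier H \<Longrightarrow> G \<one>\<^bsub>H\<^esub> k a = \<one>\<^bsub>I\<^esub>"
      "\<And>h a. h \<in> carrier H \<Longrightarrow> a \<in> carrier H \<Longrightarrow> G h \<one>\<^bsub>H\<^esub> a = \<one>\<^bsub>I\<^esub>"
      "\<And>h k. h \<in> carrier H \<Longrightarrow> k \<in> carrier H \<Longrightarrow> G h k \<one>\<^bsub>H\<^esub> = \<one>\<^bsub>I\<^esub>"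
  shows "cochain_with_values H I 2 1 F \<in> carrier (cochains H I 2 1) \<and>
    (\<forall>h\<in>carrier H. \<forall>k\<in>carrier H. \<forall>a\<in>carrier H. cochain_value H I (cochain_with_values H I 2 1 F) [h, k] [a] = G h k a)"
proof -
  have c: "F hs ks \<in> carrier I" if "hs \<in> nonzero_tuples H 2" "ks \<in> nonzero_tuples H 1" for hs ks
    using that closed F by (auto simp: nonzero_tuples_simps)
  have z: "F hs ks = \<one>\<^bsub>I\<^esub>" if "hs \<in> tuples H 2" "ks \<in> tuples H 1" "\<one>\<^bsub>H\<^esub> \<in> set hs \<union> set ks" for hs ks
    using that F zero by (auto simp: nonzero_tuples_simps)
  have "cochain_with_values H I 2 1 F \<in> carrier (cochains H I 2 1)"
    by (rule cochain_with_values_closed[where H = H and F = F and r = 2 and s = 1, OF comm_group_I c kills_shuffles_1])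
  moreover have "cochain_value H I (cochain_with_values H I 2 1 F) [h, k] [a] = G h k a"
    if "h \<in> carrier H" "k \<in> carrier H" "a \<in> carrier H" for h k a
    using cochain_value_cochain_with_values[where H = H and F = F and r = 2 and s = 1 and hs = "[h, k]" and ks = "[a]", OF comm_group_I c kills_shuffles_1 z] that F
    by (auto simp: nonzero_tuples_simps)
  ultimately show ?thesis by blast
qed

section \<open>Explicit values of the differentials that start in total degrees 1 and 2\<close>

abbreviation val :: "('h chain \<Rightarrow> 'i) \<Rightarrow> 'h list \<Rightarrow> 'h list \<Rightarrow> 'i"
  where "val \<equiv> cochain_value H I"

lemma val_closed [simp]:
  "\<lbrakk>f \<in> carrier (cochains H I 0 (Suc 0)); a \<in> carrier H\<rbrakk> \<Longrightarrow> val f [] [a] \<in> carrier I"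
  "\<lbrakk>f \<in> carrier (cochains H I 0 2); a \<in> carrier H; b \<in> carrier H\<rbrakk> \<Longrightarrow> val f [] [a, b] \<in> carrier I"
  "\<lbrakk>f \<in> carrier (cochains H I (Suc 0) (Suc 0)); a \<in> carrier H; b \<in> carrier H\<rbrakk> \<Longrightarrow> val f [a] [b] \<in> carrier I"
  by (auto intro!: cochain_value_closed[OF comm_group_I] simp: tuples_simps tuples_0)

lemma val_zero [simp]:
  "val f [] [\<one>\<^bsub>H\<^esub>] = \<one>\<^bsub>I\<^esub>"
  "val f [] [\<one>\<^bsub>H\<^esub>, a] = \<one>\<^bsub>I\<^esub>"
  "val f [] [a, \<one>\<^bsub>H\<^esub>] = \<one>\<^bsub>I\<^esub>"
  "val f [h] [\<one>\<^bsub>H\<^esub>] = \<one>\<^bsub>I\<^esub>"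
  "val f [\<one>\<^bsub>H\<^esub>] [a] = \<one>\<^bsub>I\<^esub>"
  by (simp_all add: cochain_value_zero)

lemma Suc_0_to_2: "{Suc 0..2} = {Suc 0, 2}" by auto

lemmas differential_simps = signed_simps R_map_simps add_adjacent_simps Suc_0_to_2 Pi_iff
  numeral_2_eq_2[symmetric] numeral_3_eq_3[symmetric]
  I.inv_mult I.m_assoc I.m_comm I.m_lcomm

lemma d_v_01:
  assumes "f \<in> carrier (cochains H I 0 1)"
  shows "d_v H I 0 1 f \<in> carrier (cochains H I 0 2) \<and>
    (\<forall>a\<in>carrier H. \<forall>b\<in>carrier H. val (d_v H I 0 1 f) [] [a, b]
      = (val f [] [a] +\<^sub>I val f [] [b]) -\<^sub>I val f [] [a +\<^sub>H b])"
  unfolding d_v_def one_add_one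
proof (rule cochain_with_values_02, goal_cases)
  \<comment> \<open>This case is the symmetry demanded by the shuffles of two elements; here it is
    commutativity of \<open>H\<close> and \<open>I\<close>.\<close>
  case (3 a b)
  then show ?case using assms by (simp add: I.m_comm H.m_comm)
qed (use assms in \<open>simp_all add: differential_simps\<close>)

lemma d_h_01:
  assumes "f \<in> carrier (cochains H I 0 1)"
  shows "d_h H I dia 0 1 f \<in> carrier (cochains H I 1 1) \<and>
    (\<forall>h\<in>carrier H. \<forall>a\<in>carrier H. val (d_h H I dia 0 1 f) [h] [a]
      = val f [] [h \<cdot>\<^sub>H a] -\<^sub>I h \<diamondop> val f [] [a])"
  unfolding d_h_def add_0
  by (rule cochain_with_values_11) (use assms in \<open>simp_all add: differential_simps\<close>)

text \<open>For \<open>r = 0\<close> the first block of \<open>R_map\<close> is an empty sum, and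
  \<open>0 \<cdot> h = h\<close>. Hence \<open>h\<close> appears three times: as the acting element,
  as the argument of \<open>f\<close>, and in \<open>h \<cdot> a\<close>. In bidegree
  \<open>(0, 2)\<close> the acting element becomes \<open>h + k\<close> for the same reason.\<close>

lemma d_D_01:
  assumes "f \<in> carrier (cochains H I 0 1)"
  shows "d_D H I dia lt 0 1 f \<in> carrier (cochains H I 1 1) \<and>
    (\<forall>h\<in>carrier H. \<forall>a\<in>carrier H. val (d_D H I dia lt 0 1 f) [h] [a]
      = inv\<^bsub>I\<^esub> ((h \<diamondop> val f [] [h]) \<leftthreetimes> (h \<cdot>\<^sub>H a)))"
  unfolding d_D_def add_0
  by (rule cochain_with_values_11) (use assms in \<open>simp_all add: differential_simps\<close>)

lemma d_v_02:
  assumes "f \<in> carrier (cochains H I 0 2)"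
  shows "d_v H I 0 2 f \<in> carrier (cochains H I 0 3) \<and>
    (\<forall>a\<in>carrier H. \<forall>b\<in>carrier H. \<forall>c\<in>carrier H. val (d_v H I 0 2 f) [] [a, b, c]
      = (val f [] [b, c] +\<^sub>I val f [] [a, b +\<^sub>H c]) -\<^sub>I (val f [] [a +\<^sub>H b, c] +\<^sub>I val f [] [a, b]))"
proof -
  have 3: "2 + 1 = (3::nat)" by simp
  show ?thesis
    unfolding d_v_def 3
  proof (rule cochain_with_values_03, goal_cases)
    \<comment> \<open>Cases 3 and 4 are the shuffle conditions for \<open>l = 1\<close> and
      \<open>l = 2\<close>. After clearing inverses, both sides are the same sum up to the symmetry
      of \<open>f\<close> and commutativity in \<open>H\<close>.\<close>
    case (3 a b c)
    then show ?case using assms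
      by (simp add: I.diff_mult_diff I.diff_eq_diff_iff)
        (simp add: cochain_value_swap[of c H a] cochain_value_swap[of b H a]
          cochain_value_swap[of "b +\<^sub>H c" H a] H.m_comm[of c a] H.m_comm[of b a] I.m_ac)
  next
    case (4 a b c)
    then show ?case using assms
      by (simp add: I.diff_mult_diff I.diff_eq_diff_iff)
        (simp add: cochain_value_swap[of c H a] cochain_value_swap[of c H b]
          cochain_value_swap[of c H "a +\<^sub>H b"] H.m_comm[of c a] H.m_comm[of c b] I.m_ac)
  qed (use assms in \<open>simp_all add: differential_simps\<close>)
qed

lemma d_h_02:
  assumes "f \<in> carrier (cochains H I 0 2)"
  shows "d_h H I dia 0 2 f \<in> carrier (cochains H I 1 2) \<and>
    (\<forall>h\<in>carrier H. \<forall>a\<in>carrier H. \<forall>b\<in>carrier H. val (d_h H I dia 0 2 f) [h] [a, b]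
      = val f [] [h \<cdot>\<^sub>H a, h \<cdot>\<^sub>H b] -\<^sub>I h \<diamondop> val f [] [a, b])"
  unfolding d_h_def add_0
proof (rule cochain_with_values_12, goal_cases)
  case (3 h a b)
  then show ?case
    using cochain_value_swap[of a H b I f "[]"] cochain_value_swap[of "h \<cdot>\<^sub>H a" H "h \<cdot>\<^sub>H b" I f "[]"]
    by simp
qed (use assms in \<open>simp_all add: differential_simps\<close>)

lemma d_D_02:
  assumes "f \<in> carrier (cochains H I 0 2)"
  shows "d_D H I dia lt 0 2 f \<in> carrier (cochains H I 2 1) \<and>
    (\<forall>h\<in>carrier H. \<forall>k\<in>carrier H. \<forall>a\<in>carrier H. val (d_D H I dia lt 0 2 f) [h, k] [a]
      = ((h +\<^sub>H k) \<diamondop> val f [] [h, k]) \<leftthreetimes> ((h +\<^sub>H k) \<cdot>\<^sub>H a))"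
  unfolding d_D_def add_0
  by (rule cochain_with_values_21) (use assms in \<open>simp_all add: differential_simps\<close>)

lemma d_v_11:
  assumes "f \<in> carrier (cochains H I 1 1)"
  shows "d_v H I 1 1 f \<in> carrier (cochains H I 1 2) \<and>
    (\<forall>h\<in>carrier H. \<forall>a\<in>carrier H. \<forall>b\<in>carrier H. val (d_v H I 1 1 f) [h] [a, b]
      = val f [h] [a +\<^sub>H b] -\<^sub>I (val f [h] [a] +\<^sub>I val f [h] [b]))"
  unfolding d_v_def one_add_one
proof (rule cochain_with_values_12, goal_cases)
  case (3 h a b)
  then show ?case using assms by (simp add: I.m_comm H.m_comm)
qed (use assms in \<open>simp_all add: differential_simps\<close>)

lemma d_h_11:
  assumes "f \<in> carrier (cochains H I 1 1)"
  shows "d_h H I dia 1 1 f \<in> carrier (cochains H I 2 1) \<and>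
    (\<forall>h\<in>carrier H. \<forall>k\<in>carrier H. \<forall>a\<in>carrier H. val (d_h H I dia 1 1 f) [h, k] [a]
      = (val f [h \<cdot>\<^sub>H k] [h \<cdot>\<^sub>H a] +\<^sub>I (h \<cdot>\<^sub>H k) \<diamondop> val f [h] [a]) -\<^sub>I val f [h +\<^sub>H k] [a])"
  unfolding d_h_def one_add_one
  by (rule cochain_with_values_21) (use assms in \<open>simp_all add: differential_simps\<close>)

lemma d_D_11:
  assumes "f \<in> carrier (cochains H I 1 1)"
  shows "d_D H I dia lt 1 1 f \<in> carrier (cochains H I 2 1) \<and>
    (\<forall>h\<in>carrier H. \<forall>k\<in>carrier H. \<forall>a\<in>carrier H. val (d_D H I dia lt 1 1 f) [h, k] [a]
      = ((h \<cdot>\<^sub>H k) \<diamondop> val f [h] [k]) \<leftthreetimes> ((h +\<^sub>H k) \<cdot>\<^sub>H a))"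
  unfolding d_D_def one_add_one
  by (rule cochain_with_values_21) (use assms in \<open>simp_all add: differential_simps\<close>)

end

section \<open>The second cohomology group\<close>

context comm_group
begin

text \<open>On the left the values of the differential, on the right the corresponding conditions on factor
  sets: the cocycle conditions in bidegrees (0,3), (1,2), (2,1), then the coboundaries in (0,2), (1,1).\<close>

lemma cocycle_identities:
  assumes [simp]: "x \<in> carrier G" "y \<in> carrier G" "u \<in> carrier G" "v \<in> carrier G" "w \<in> carrier G"
  shows "(x \<otimes> y) \<otimes> inv (u \<otimes> v) = \<one> \<longleftrightarrow> inv v \<otimes> inv u = inv x \<otimes> inv y"
    and "(x \<otimes> inv u) \<otimes> (w \<otimes> inv (v \<otimes> y)) = \<one> \<longleftrightarrow> inv u \<otimes> w = v \<otimes> y \<otimes> inv x"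
    and "((x \<otimes> y) \<otimes> inv u) \<otimes> (v \<otimes> w) = \<one> \<longleftrightarrow> u \<otimes> inv w = y \<otimes> x \<otimes> v"
    and "u = ((x \<otimes> y) \<otimes> inv v) \<otimes> w \<longleftrightarrow> inv u \<otimes> inv v = inv x \<otimes> inv y \<otimes> inv w"
    and "u = ((x \<otimes> inv y) \<otimes> inv v) \<otimes> w \<longleftrightarrow> u \<otimes> inv x = inv y \<otimes> w \<otimes> inv v"
proof -
  note cl = m_closed inv_closed one_closed
  \<comment> \<open>Moves a subtracted term to the other side. Each of the five equivalences is
    proved by bringing both of its sides to one common equation without inverses.\<close>
  have D: "a \<otimes> inv b = c \<longleftrightarrow> a = c \<otimes> b" "c = a \<otimes> inv b \<longleftrightarrow> a = c \<otimes> b"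
    if "a \<in> carrier G" "b \<in> carrier G" "c \<in> carrier G" for a b c
    using diff_eq_diff_iff[of a b c \<one>] that by auto
  show "(x \<otimes> y) \<otimes> inv (u \<otimes> v) = \<one> \<longleftrightarrow> inv v \<otimes> inv u = inv x \<otimes> inv y"
  proof -
    have "inv v \<otimes> inv u = inv x \<otimes> inv y \<longleftrightarrow> inv (u \<otimes> v) = inv (x \<otimes> y)"
      by (simp add: inv_mult m_comm)
    also have "\<dots> \<longleftrightarrow> x \<otimes> y = u \<otimes> v" using inj_onD[OF inv_inj] by auto
    finally show ?thesis by (simp add: D)
  qed
  show "(x \<otimes> inv u) \<otimes> (w \<otimes> inv (v \<otimes> y)) = \<one> \<longleftrightarrow> inv u \<otimes> w = v \<otimes> y \<otimes> inv x"
  proof -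
    have "inv u \<otimes> w = v \<otimes> y \<otimes> inv x \<longleftrightarrow> w \<otimes> x = v \<otimes> y \<otimes> u"
      using diff_eq_diff_iff[of w u "v \<otimes> y" x] by (simp add: m_comm[of "inv u" w])
    moreover have "(x \<otimes> inv u) \<otimes> (w \<otimes> inv (v \<otimes> y)) = \<one> \<longleftrightarrow> x \<otimes> w = u \<otimes> (v \<otimes> y)"
      by (simp only: diff_mult_diff assms cl) (simp add: D)
    ultimately show ?thesis by (simp add: m_ac)
  qed
  show "((x \<otimes> y) \<otimes> inv u) \<otimes> (v \<otimes> w) = \<one> \<longleftrightarrow> u \<otimes> inv w = y \<otimes> x \<otimes> v"
  proof -
    have "((x \<otimes> y) \<otimes> inv u) \<otimes> (v \<otimes> w) = (x \<otimes> y \<otimes> (v \<otimes> w)) \<otimes> inv u"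
      using diff_mult_diff[of "x \<otimes> y" u "v \<otimes> w" \<one>] by simp
    then show ?thesis
      using D(1)[of u w "y \<otimes> x \<otimes> v"] D(1)[of "x \<otimes> y \<otimes> (v \<otimes> w)" u \<one>] by (simp add: m_ac eq_commute)
  qed
  show "u = ((x \<otimes> y) \<otimes> inv v) \<otimes> w \<longleftrightarrow> inv u \<otimes> inv v = inv x \<otimes> inv y \<otimes> inv w"
  proof -
    have 1: "((x \<otimes> y) \<otimes> inv v) \<otimes> w = (x \<otimes> y \<otimes> w) \<otimes> inv v"
      using diff_mult_diff[of "x \<otimes> y" v w \<one>] by simp
    have "inv u \<otimes> inv v = inv x \<otimes> inv y \<otimes> inv w \<longleftrightarrow> inv (u \<otimes> v) = inv (x \<otimes> y \<otimes> w)"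
      by (simp add: inv_mult)
    also have "\<dots> \<longleftrightarrow> u \<otimes> v = x \<otimes> y \<otimes> w" using inj_onD[OF inv_inj] by auto
    finally show ?thesis using 1 D(2)[of "x \<otimes> y \<otimes> w" v u] by auto
  qed
  show "u = ((x \<otimes> inv y) \<otimes> inv v) \<otimes> w \<longleftrightarrow> u \<otimes> inv x = inv y \<otimes> w \<otimes> inv v"
  proof -
    have 1: "((x \<otimes> inv y) \<otimes> inv v) \<otimes> w = (x \<otimes> w) \<otimes> inv (y \<otimes> v)"
      using diff_mult_diff[of x "y \<otimes> v" w \<one>] by (simp add: inv_mult m_assoc)
    have 2: "inv y \<otimes> w \<otimes> inv v = w \<otimes> inv (y \<otimes> v)"
      by (simp add: inv_mult m_ac)
    show ?thesis
      unfolding 1 2 using D(2)[of "x \<otimes> w" "y \<otimes> v" u] diff_eq_diff_iff[of u x w "y \<otimes> v"]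
      by (auto simp: m_comm)
  qed
qed

end

context lcs_actions
begin

lemma group_cochains [simp]: "group (cochains H I r s)"
  using comm_group_cochains[OF comm_group_I] comm_group.axioms(2) by blast

lemma ball_tuples:
  "(\<forall>hs\<in>tuples H 0. P hs) \<longleftrightarrow> P []"
  "(\<forall>hs\<in>tuples H (Suc 0). P hs) \<longleftrightarrow> (\<forall>a\<in>carrier H. P [a])"
  "(\<forall>hs\<in>tuples H 2. P hs) \<longleftrightarrow> (\<forall>a\<in>carrier H. \<forall>b\<in>carrier H. P [a, b])"
  "(\<forall>hs\<in>tuples H 3. P hs) \<longleftrightarrow> (\<forall>a\<in>carrier H. \<forall>b\<in>carrier H. \<forall>c\<in>carrier H. P [a, b, c])"
  by (auto simp: tuples_simps tuples_0)

lemma cochain_eq_one_iff: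
  assumes "f \<in> carrier (cochains H I r s)"
  shows "f = \<one>\<^bsub>cochains H I r s\<^esub> \<longleftrightarrow> (\<forall>hs\<in>tuples H r. \<forall>ks\<in>tuples H s. cochain_value H I f hs ks = \<one>\<^bsub>I\<^esub>)"
proof -
  interpret C: group "cochains H I r s" by simp
  show ?thesis
    by (simp add: cochain_eq_iff[OF comm_group_I assms C.one_closed] cochain_value_one)
qed

section \<open>Total cochains and their differential, component by component\<close>

lemma carrier_total_cochains:
  "carrier (total_cochains H I n) = (\<Pi>\<^sub>E r\<in>{0..<n}. carrier (cochains H I r (n - r)))"
  by (simp add: total_cochains_def carrier_sum_group)

lemma group_total_cochains [simp]: "group (total_cochains H I n)"
  by (simp add: total_cochains_def)

lemma total_cochains_2:
  "z \<in> carrier (total_cochains H I 2) \<longleftrightarrow> z \<in> extensional {0..<2}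
    \<and> z 0 \<in> carrier (cochains H I 0 2) \<and> z 1 \<in> carrier (cochains H I 1 1)"
proof -
  have "{0..<2::nat} = {0, 1}" by auto
  then show ?thesis by (auto simp: carrier_total_cochains PiE_iff)
qed

lemma total_cochains_1:
  "z \<in> carrier (total_cochains H I 1) \<longleftrightarrow> z \<in> extensional {0..<1} \<and> z 0 \<in> carrier (cochains H I 0 1)"
  by (auto simp: carrier_total_cochains PiE_iff)

text \<open>Component 0 of the target receives only the vertical map. Component 1, the last one,
  receives the horizontal map and \<open>D\<close>; all other contributions are neutral
  elements.\<close>

lemma differential_1:
  assumes "f \<in> carrier (total_cochains H I 1)"
  shows "differential H I dia lt 1 f \<in> carrier (total_cochains H I 2)"
    and "differential H I dia lt 1 f 0 = d_v H I 0 1 (f 0)"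
    and "differential H I dia lt 1 f 1 = d_h H I dia 0 1 (f 0) \<otimes>\<^bsub>cochains H I 1 1\<^esub> d_D H I dia lt 0 1 (f 0)"
proof -
  have f: "f 0 \<in> carrier (cochains H I 0 1)" using assms total_cochains_1 by blast
  note d = d_v_01[OF f, THEN conjunct1] d_h_01[OF f, THEN conjunct1] d_D_01[OF f, THEN conjunct1]
  interpret C2: group "cochains H I 0 2" by simp
  interpret C11: comm_group "cochains H I (Suc 0) (Suc 0)" by (rule comm_group_cochains[OF comm_group_I])
  have r: "r \<in> {0..<2} \<longleftrightarrow> r = 0 \<or> r = (1::nat)" for r by auto
  have "differential H I dia lt 1 f r = (if r = 0 then d_v H I 0 1 (f 0)
    else d_h H I dia 0 1 (f 0) \<otimes>\<^bsub>cochains H I 1 1\<^esub> d_D H I dia lt 0 1 (f 0))" if "r \<in> {0..<2}" for r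
    using that d unfolding r
    by (elim disjE) (simp_all add: differential_def total_cochains_def total_h_def total_v_def total_D_def
        numeral_2_eq_2[symmetric])
  \<comment> \<open>Products in a direct sum are extensional, so outside the index range the two
    functions agree by being undefined.\<close>
  moreover have "differential H I dia lt 1 f r = undefined" if "r \<notin> {0..<2}" for r
    using that by (simp add: differential_def total_cochains_def)
  ultimately have D: "differential H I dia lt 1 f = (\<lambda>r\<in>{0..<2}. if r = 0 then d_v H I 0 1 (f 0)
    else d_h H I dia 0 1 (f 0) \<otimes>\<^bsub>cochains H I 1 1\<^esub> d_D H I dia lt 0 1 (f 0))"
    by (auto simp: fun_eq_iff)
  show "differential H I dia lt 1 f 0 = d_v H I 0 1 (f 0)"
    "differential H I dia lt 1 f 1 = d_h H I dia 0 1 (f 0) \<otimes>\<^bsub>cochains H I 1 1\<^esub> d_D H I dia lt 0 1 (f 0)"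
    unfolding D by simp_all
  show "differential H I dia lt 1 f \<in> carrier (total_cochains H I 2)"
    unfolding total_cochains_2 D using d by simp
qed

text \<open>\<open>D\<close> only reaches the last bidegree \<open>(2, 1)\<close>, but collects
  there from both components: index \<open>k = 1\<close> stands for the source \<open>(1, 1)\<close>
  and \<open>k = 2\<close> for \<open>(0, 2)\<close>.\<close>

lemma differential_2:
  assumes "z \<in> carrier (total_cochains H I 2)"
  shows "differential H I dia lt 2 z = (\<lambda>r\<in>{0..<3}.
    if r = 0 then d_v H I 0 2 (z 0)
    else if r = 1 then d_h H I dia 0 2 (z 0) \<otimes>\<^bsub>cochains H I 1 2\<^esub> d_v H I 1 1 (z 1)
    else d_h H I dia 1 1 (z 1) \<otimes>\<^bsub>cochains H I 2 1\<^esub>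
      (d_D H I dia lt 1 1 (z 1) \<otimes>\<^bsub>cochains H I 2 1\<^esub> d_D H I dia lt 0 2 (z 0)))"
proof -
  have z: "z 0 \<in> carrier (cochains H I 0 2)" "z 1 \<in> carrier (cochains H I 1 1)"
    using assms total_cochains_2 by blast+
  note d = d_v_02[OF z(1), THEN conjunct1] d_h_02[OF z(1), THEN conjunct1] d_D_02[OF z(1), THEN conjunct1]
    d_v_11[OF z(2), THEN conjunct1] d_h_11[OF z(2), THEN conjunct1] d_D_11[OF z(2), THEN conjunct1]
  interpret C3: group "cochains H I 0 3" by simp
  interpret C12: comm_group "cochains H I (Suc 0) 2" by (rule comm_group_cochains[OF comm_group_I])
  interpret C21: comm_group "cochains H I 2 (Suc 0)" by (rule comm_group_cochains[OF comm_group_I])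
  have fp: "(\<Otimes>\<^bsub>cochains H I 2 1\<^esub>k\<in>{1..2}. d_D H I dia lt (2 - k) k (z (2 - k)))
    = d_D H I dia lt 1 1 (z 1) \<otimes>\<^bsub>cochains H I 2 1\<^esub> d_D H I dia lt 0 2 (z 0)"
  proof -
    have "{1..2::nat} = {1, 2}" by auto
    then show ?thesis using d by (simp add: Pi_iff)
  qed
  have r: "r \<in> {0..<3} \<longleftrightarrow> r = 0 \<or> r = 1 \<or> r = (2::nat)" for r by auto
  have "differential H I dia lt 2 z r = (if r = 0 then d_v H I 0 2 (z 0)
    else if r = 1 then d_h H I dia 0 2 (z 0) \<otimes>\<^bsub>cochains H I 1 2\<^esub> d_v H I 1 1 (z 1)
    else d_h H I dia 1 1 (z 1) \<otimes>\<^bsub>cochains H I 2 1\<^esub>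
      (d_D H I dia lt 1 1 (z 1) \<otimes>\<^bsub>cochains H I 2 1\<^esub> d_D H I dia lt 0 2 (z 0)))" if "r \<in> {0..<3}" for r
    using that d fp unfolding r
    by (elim disjE) (simp_all add: differential_def total_cochains_def total_h_def total_v_def total_D_def
        numeral_3_eq_3[symmetric] numeral_2_eq_2[symmetric])
  moreover have "differential H I dia lt 2 z r = undefined" if "r \<notin> {0..<3}" for r
    using that by (simp add: differential_def total_cochains_def)
  ultimately show ?thesis by (auto simp: fun_eq_iff)
qed

text \<open>The three long equations are associativity, the law for \<open>a \<cdot> (b + c)\<close>
  and the law for \<open>(a + b) \<cdot> c\<close>, written for the elements of a normalized section
  and compared in \<open>I\<close>. The earlier clauses express commutativity and the normalization
  of the section.\<close>

definition factor_set :: "('h \<Rightarrow> 'h \<Rightarrow> 'i) \<Rightarrow> ('h \<Rightarrow> 'h \<Rightarrow> 'i) \<Rightarrow> bool" where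
  "factor_set \<beta> \<gamma> \<longleftrightarrow>
     (\<forall>a\<in>carrier H. \<forall>b\<in>carrier H. \<beta> a b \<in> carrier I \<and> \<gamma> a b \<in> carrier I \<and> \<beta> a b = \<beta> b a) \<and>
     (\<forall>a\<in>carrier H. \<beta> \<one>\<^bsub>H\<^esub> a = \<one>\<^bsub>I\<^esub> \<and> \<gamma> \<one>\<^bsub>H\<^esub> a = \<one>\<^bsub>I\<^esub> \<and> \<gamma> a \<one>\<^bsub>H\<^esub> = \<one>\<^bsub>I\<^esub>) \<and>
     (\<forall>a\<in>carrier H. \<forall>b\<in>carrier H. \<forall>c\<in>carrier H.
        \<beta> a b +\<^sub>I \<beta> (a +\<^sub>H b) c = \<beta> b c +\<^sub>I \<beta> a (b +\<^sub>H c) \<and>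
        a \<diamondop> \<beta> b c +\<^sub>I \<gamma> a (b +\<^sub>H c) = \<gamma> a b +\<^sub>I \<gamma> a c +\<^sub>I \<beta> (a \<cdot>\<^sub>H b) (a \<cdot>\<^sub>H c) \<and>
        \<gamma> (a +\<^sub>H b) c +\<^sub>I ((a +\<^sub>H b) \<diamondop> \<beta> a b) \<leftthreetimes> ((a +\<^sub>H b) \<cdot>\<^sub>H c) =
          (a \<cdot>\<^sub>H b) \<diamondop> \<gamma> a c +\<^sub>I \<gamma> (a \<cdot>\<^sub>H b) (a \<cdot>\<^sub>H c) +\<^sub>I ((a \<cdot>\<^sub>H b) \<diamondop> \<gamma> a b) \<leftthreetimes> ((a +\<^sub>H b) \<cdot>\<^sub>H c))"

lemma factor_set_cong:
  assumes "\<And>a b. a \<in> carrier H \<Longrightarrow> b \<in> carrier H \<Longrightarrow> \<beta> a b = \<beta>' a b"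
    "\<And>a b. a \<in> carrier H \<Longrightarrow> b \<in> carrier H \<Longrightarrow> \<gamma> a b = \<gamma>' a b"
  shows "factor_set \<beta> \<gamma> \<longleftrightarrow> factor_set \<beta>' \<gamma>'"
  unfolding factor_set_def by (intro conj_cong ball_cong refl) (simp_all add: assms)

text \<open>If \<open>\<beta>\<close>, \<open>\<gamma>\<close> belong to a section \<open>s\<close>,
  then \<open>\<beta>'\<close>, \<open>\<gamma>'\<close> are what the section
  \<open>h \<mapsto> \<iota> (f h) + s h\<close> yields. The equations are arranged without
  inverses.\<close>

definition cohomologous ::
  "('h \<Rightarrow> 'h \<Rightarrow> 'i) \<Rightarrow> ('h \<Rightarrow> 'h \<Rightarrow> 'i) \<Rightarrow> ('h \<Rightarrow> 'h \<Rightarrow> 'i) \<Rightarrow> ('h \<Rightarrow> 'h \<Rightarrow> 'i) \<Rightarrow> bool" where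
  "cohomologous \<beta> \<gamma> \<beta>' \<gamma>' \<longleftrightarrow> (\<exists>f \<in> carrier H \<rightarrow> carrier I. f \<one>\<^bsub>H\<^esub> = \<one>\<^bsub>I\<^esub> \<and>
     (\<forall>a\<in>carrier H. \<forall>b\<in>carrier H.
        \<beta>' a b +\<^sub>I f (a +\<^sub>H b) = f a +\<^sub>I f b +\<^sub>I \<beta> a b \<and>
        \<gamma>' a b +\<^sub>I f (a \<cdot>\<^sub>H b) = a \<diamondop> f b +\<^sub>I \<gamma> a b +\<^sub>I (a \<diamondop> f a) \<leftthreetimes> (a \<cdot>\<^sub>H b)))"

text \<open>The inverse makes up for the opposite signs of \<open>\<beta>\<close> in the cocycle condition of bidegree \<open>(1, 2)\<close>
  and in the distributivity law of an extension.\<close>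

definition cochain_add :: "(nat \<Rightarrow> 'h chain \<Rightarrow> 'i) \<Rightarrow> 'h \<Rightarrow> 'h \<Rightarrow> 'i" where
  "cochain_add z a b = inv\<^bsub>I\<^esub> val (z 0) [] [a, b]"

definition cochain_dot :: "(nat \<Rightarrow> 'h chain \<Rightarrow> 'i) \<Rightarrow> 'h \<Rightarrow> 'h \<Rightarrow> 'i" where
  "cochain_dot z a b = val (z 1) [a] [b]"

abbreviation "cocycles \<equiv> kernel (total_cochains H I 2) (total_cochains H I 3) (differential H I dia lt 2)"
abbreviation "coboundaries \<equiv> differential H I dia lt 1 ` carrier (total_cochains H I 1)"

text \<open>The components of the differential in bidegrees \<open>(0, 3)\<close>,
  \<open>(1, 2)\<close> and \<open>(2, 1)\<close> give the three long equations of
  \<open>factor_set\<close>, in this order. The remaining clauses hold for every cochain, by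
  symmetry and by the convention on zero entries.\<close>

lemma cocycles_iff:
  assumes z: "z \<in> carrier (total_cochains H I 2)"
  shows "z \<in> cocycles \<longleftrightarrow> factor_set (cochain_add z) (cochain_dot z)"
proof -
  have z01: "z 0 \<in> carrier (cochains H I 0 2)" "z 1 \<in> carrier (cochains H I 1 1)"
    using z total_cochains_2 by blast+
  note d = d_v_02[OF z01(1)] d_h_02[OF z01(1)] d_D_02[OF z01(1)]
    d_v_11[OF z01(2)] d_h_11[OF z01(2)] d_D_11[OF z01(2)]
  interpret C03: comm_group "cochains H I 0 3" by (rule comm_group_cochains[OF comm_group_I])
  interpret C12: comm_group "cochains H I (Suc 0) 2" by (rule comm_group_cochains[OF comm_group_I])
  interpret C21: comm_group "cochains H I 2 (Suc 0)" by (rule comm_group_cochains[OF comm_group_I])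
  let ?z = "\<lambda>a b. val (z 0) [] [a, b]" and ?g = "\<lambda>a b. val (z 1) [a] [b]"
  have z': "z 0 \<in> carrier (cochains H I 0 2)" "z (Suc 0) \<in> carrier (cochains H I (Suc 0) (Suc 0))"
    using z01 by simp_all
  have "z \<in> cocycles \<longleftrightarrow> differential H I dia lt 2 z = \<one>\<^bsub>total_cochains H I 3\<^esub>"
    using z by (simp add: kernel_def)
  also have "\<dots> \<longleftrightarrow> (\<forall>r\<in>{0..<3}. differential H I dia lt 2 z r = \<one>\<^bsub>cochains H I r (3 - r)\<^esub>)"
    by (auto simp: differential_2[OF z] total_cochains_def fun_eq_iff)
  also have "{0..<3} = {0, 1, 2::nat}" by auto
  also have "(\<forall>r\<in>{0, 1, 2}. differential H I dia lt 2 z r = \<one>\<^bsub>cochains H I r (3 - r)\<^esub>) \<longleftrightarrow>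
      d_v H I 0 2 (z 0) = \<one>\<^bsub>cochains H I 0 3\<^esub> \<and>
      d_h H I dia 0 2 (z 0) \<otimes>\<^bsub>cochains H I 1 2\<^esub> d_v H I 1 1 (z 1) = \<one>\<^bsub>cochains H I 1 2\<^esub> \<and>
      d_h H I dia 1 1 (z 1) \<otimes>\<^bsub>cochains H I 2 1\<^esub>
        (d_D H I dia lt 1 1 (z 1) \<otimes>\<^bsub>cochains H I 2 1\<^esub> d_D H I dia lt 0 2 (z 0)) = \<one>\<^bsub>cochains H I 2 1\<^esub>"
    by (simp add: differential_2[OF z])
  also have "d_v H I 0 2 (z 0) = \<one>\<^bsub>cochains H I 0 3\<^esub> \<longleftrightarrow>
     (\<forall>a\<in>carrier H. \<forall>b\<in>carrier H. \<forall>c\<in>carrier H.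
        cochain_add z a b +\<^sub>I cochain_add z (a +\<^sub>H b) c = cochain_add z b c +\<^sub>I cochain_add z a (b +\<^sub>H c))"
    (is "_ \<longleftrightarrow> ?A")
    using d(1) z'
    \<comment> \<open>Matching the first identity leaves \<open>w\<close> undetermined, so a value
      is supplied.\<close>
    by (simp add: cochain_eq_one_iff ball_tuples cochain_add_def I.cocycle_identities(1)[where w = "\<one>\<^bsub>I\<^esub>"])
  also have "d_h H I dia 0 2 (z 0) \<otimes>\<^bsub>cochains H I 1 2\<^esub> d_v H I 1 1 (z 1) = \<one>\<^bsub>cochains H I 1 2\<^esub> \<longleftrightarrow>
     (\<forall>a\<in>carrier H. \<forall>b\<in>carrier H. \<forall>c\<in>carrier H.
        a \<diamondop> cochain_add z b c +\<^sub>I cochain_dot z a (b +\<^sub>H c)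
        = cochain_dot z a b +\<^sub>I cochain_dot z a c +\<^sub>I cochain_add z (a \<cdot>\<^sub>H b) (a \<cdot>\<^sub>H c))"
    (is "_ \<longleftrightarrow> ?B")
    using d(2,4) z'
    by (simp add: cochain_eq_one_iff cochain_value_mult[OF comm_group_I] ball_tuples tuples_simps
        cochain_add_def cochain_dot_def dia_inv I.cocycle_identities(2))
  also have "d_h H I dia 1 1 (z 1) \<otimes>\<^bsub>cochains H I 2 1\<^esub>
        (d_D H I dia lt 1 1 (z 1) \<otimes>\<^bsub>cochains H I 2 1\<^esub> d_D H I dia lt 0 2 (z 0)) = \<one>\<^bsub>cochains H I 2 1\<^esub> \<longleftrightarrow>
     (\<forall>a\<in>carrier H. \<forall>b\<in>carrier H. \<forall>c\<in>carrier H.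
        cochain_dot z (a +\<^sub>H b) c +\<^sub>I ((a +\<^sub>H b) \<diamondop> cochain_add z a b) \<leftthreetimes> ((a +\<^sub>H b) \<cdot>\<^sub>H c) =
          (a \<cdot>\<^sub>H b) \<diamondop> cochain_dot z a c +\<^sub>I cochain_dot z (a \<cdot>\<^sub>H b) (a \<cdot>\<^sub>H c)
            +\<^sub>I ((a \<cdot>\<^sub>H b) \<diamondop> cochain_dot z a b) \<leftthreetimes> ((a +\<^sub>H b) \<cdot>\<^sub>H c))"
    (is "_ \<longleftrightarrow> ?C")
    using d(3,5,6) z'
    by (simp add: cochain_eq_one_iff cochain_value_mult[OF comm_group_I] ball_tuples tuples_simps
        cochain_add_def cochain_dot_def dia_inv lt_inv I.cocycle_identities(3))
  finally have eq: "z \<in> cocycles \<longleftrightarrow> ?A \<and> ?B \<and> ?C" .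
  have "(\<forall>a\<in>carrier H. \<forall>b\<in>carrier H. cochain_add z a b \<in> carrier I \<and> cochain_dot z a b \<in> carrier I \<and>
      cochain_add z a b = cochain_add z b a) \<and>
     (\<forall>a\<in>carrier H. cochain_add z \<one>\<^bsub>H\<^esub> a = \<one>\<^bsub>I\<^esub> \<and> cochain_dot z \<one>\<^bsub>H\<^esub> a = \<one>\<^bsub>I\<^esub> \<and> cochain_dot z a \<one>\<^bsub>H\<^esub> = \<one>\<^bsub>I\<^esub>)"
    using z' cochain_value_swap[of _ H _ I "z 0" "[]"] by (auto simp: cochain_add_def cochain_dot_def)
  then show ?thesis
    unfolding factor_set_def eq by blast
qed

text \<open>Symmetry of \<open>\<beta>\<close> is the shuffle condition in bidegree
  \<open>(0, 2)\<close> and normalization is the convention on zero entries, so both functions are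
  values of cochains. The inverse in \<open>?u\<close> undoes the one in
  \<open>cochain_add\<close>.\<close>

lemma factor_set_realized:
  assumes "factor_set \<beta> \<gamma>"
  shows "\<exists>z\<in>cocycles. \<forall>a\<in>carrier H. \<forall>b\<in>carrier H. cochain_add z a b = \<beta> a b \<and> cochain_dot z a b = \<gamma> a b"
proof -
  let ?u = "cochain_with_values H I 0 2 (\<lambda>hs ks. inv\<^bsub>I\<^esub> \<beta> (ks ! 0) (ks ! 1))"
  let ?v = "cochain_with_values H I 1 1 (\<lambda>hs ks. \<gamma> (hs ! 0) (ks ! 0))"
  have u: "?u \<in> carrier (cochains H I 0 2) \<and>
      (\<forall>a\<in>carrier H. \<forall>b\<in>carrier H. val ?u [] [a, b] = inv\<^bsub>I\<^esub> \<beta> a b)"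
  proof (rule cochain_with_values_02)
    show "inv\<^bsub>I\<^esub> \<beta> a b = inv\<^bsub>I\<^esub> \<beta> b a" if "a \<in> carrier H" "b \<in> carrier H" for a b
      using assms that unfolding factor_set_def by metis
  qed (use assms in \<open>auto simp: factor_set_def\<close>)
  have v: "?v \<in> carrier (cochains H I 1 1) \<and> (\<forall>a\<in>carrier H. \<forall>b\<in>carrier H. val ?v [a] [b] = \<gamma> a b)"
    by (rule cochain_with_values_11) (use assms in \<open>auto simp: factor_set_def\<close>)
  define z where "z = (\<lambda>r\<in>{0..<2::nat}. if r = 0 then ?u else ?v)"
  have z01: "z 0 = ?u" "z 1 = ?v" by (simp_all add: z_def)
  have z: "z \<in> carrier (total_cochains H I 2)"
    unfolding total_cochains_2 z01 using u v by (simp add: z_def)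
  have eq: "cochain_add z a b = \<beta> a b" "cochain_dot z a b = \<gamma> a b" if "a \<in> carrier H" "b \<in> carrier H" for a b
    using that u v assms unfolding cochain_add_def cochain_dot_def z01 by (simp_all add: factor_set_def)
  then have "factor_set (cochain_add z) (cochain_dot z)"
    using assms factor_set_cong by metis
  then show ?thesis using cocycles_iff[OF z] eq by blast
qed

section \<open>Coboundaries and their cosets\<close>

lemma differential_1_values:
  assumes f: "f \<in> carrier (cochains H I 0 1)" and D: "x = differential H I dia lt 1 (\<lambda>r\<in>{0..<1}. f)"
  shows "x \<in> carrier (total_cochains H I 2)"
    and "\<And>a b. a \<in> carrier H \<Longrightarrow> b \<in> carrier H
      \<Longrightarrow> val (x 0) [] [a, b] = (val f [] [a] +\<^sub>I val f [] [b]) -\<^sub>I val f [] [a +\<^sub>H b]"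
    and "\<And>a b. a \<in> carrier H \<Longrightarrow> b \<in> carrier H
      \<Longrightarrow> val (x 1) [a] [b] = (val f [] [a \<cdot>\<^sub>H b] -\<^sub>I a \<diamondop> val f [] [b]) -\<^sub>I (a \<diamondop> val f [] [a]) \<leftthreetimes> (a \<cdot>\<^sub>H b)"
proof -
  let ?f = "\<lambda>r\<in>{0..<1::nat}. f"
  have f': "?f \<in> carrier (total_cochains H I 1)" using f unfolding total_cochains_1 by simp
  have f0: "?f 0 = f" by simp
  note d = differential_1[OF f'] d_v_01[OF f] d_h_01[OF f] d_D_01[OF f]
  show "x \<in> carrier (total_cochains H I 2)" using d(1) D by simp
  fix a b assume ab: "a \<in> carrier H" "b \<in> carrier H"
  show "val (x 0) [] [a, b] = (val f [] [a] +\<^sub>I val f [] [b]) -\<^sub>I val f [] [a +\<^sub>H b]"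
    unfolding D d(2) f0 using d(4) ab by blast
  have "[a] \<in> tuples H 1" "[b] \<in> tuples H 1" using ab by (simp_all add: tuples_simps)
  then show "val (x 1) [a] [b] = (val f [] [a \<cdot>\<^sub>H b] -\<^sub>I a \<diamondop> val f [] [b]) -\<^sub>I (a \<diamondop> val f [] [a]) \<leftthreetimes> (a \<cdot>\<^sub>H b)"
    unfolding D d(3) f0 using d(5,6) ab by (simp only: cochain_value_mult[OF comm_group_I])
qed

text \<open>In degree 1 the direct sum has the single index 0, so a total cochain is a wrapped
  cochain of bidegree \<open>(0, 1)\<close>. This lets 1-cochains be quantified over without the
  wrapping.\<close>

lemma total_cochains_1_eq:
  "carrier (total_cochains H I 1) = (\<lambda>f. \<lambda>r\<in>{0..<1}. f) ` carrier (cochains H I 0 1)"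
proof (intro equalityI subsetI)
  fix g assume g: "g \<in> carrier (total_cochains H I 1)"
  then have "g = (\<lambda>r\<in>{0..<1}. g 0)"
    by (auto simp: total_cochains_1[unfolded One_nat_def] extensional_def fun_eq_iff)
  then show "g \<in> (\<lambda>f. \<lambda>r\<in>{0..<1}. f) ` carrier (cochains H I 0 1)"
    using g total_cochains_1 by blast
qed (auto simp: total_cochains_1[unfolded One_nat_def])

lemma cochain_01_with_values:
  assumes "f \<in> carrier H \<rightarrow> carrier I" "f \<one>\<^bsub>H\<^esub> = \<one>\<^bsub>I\<^esub>"
  shows "\<exists>g\<in>carrier (cochains H I 0 1). \<forall>a\<in>carrier H. val g [] [a] = f a"
proof -
  let ?F = "\<lambda>hs ks. f (ks ! 0)"
  have c: "?F hs ks \<in> carrier I" if "hs \<in> nonzero_tuples H 0" "ks \<in> nonzero_tuples H 1" for hs ks :: "'h list"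
    using that assms by (auto simp: nonzero_tuples_simps)
  have z: "?F hs ks = \<one>\<^bsub>I\<^esub>" if "hs \<in> tuples H 0" "ks \<in> tuples H 1" "\<one>\<^bsub>H\<^esub> \<in> set hs \<union> set ks" for hs ks
    using that assms by (auto simp: nonzero_tuples_simps)
  have "cochain_with_values H I 0 1 ?F \<in> carrier (cochains H I 0 1)"
    by (rule cochain_with_values_closed[where H = H and F = ?F and r = 0 and s = 1, OF comm_group_I c kills_shuffles_1])
  moreover have "val (cochain_with_values H I 0 1 ?F) [] [a] = f a" if "a \<in> carrier H" for a
    by (rule cochain_value_cochain_with_values[where H = H and F = ?F and r = 0 and s = 1 and hs = "[]" and ks = "[a]",
          simplified nth_Cons_0])
      (use comm_group_I c kills_shuffles_1 z that in \<open>auto simp: tuples_simps tuples_0\<close>)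
  ultimately show ?thesis by blast
qed

lemma total_2_eqI:
  assumes x: "x \<in> carrier (total_cochains H I 2)" and y: "y \<in> carrier (total_cochains H I 2)"
    and "\<And>a b. a \<in> carrier H \<Longrightarrow> b \<in> carrier H \<Longrightarrow> val (x 0) [] [a, b] = val (y 0) [] [a, b]"
    and "\<And>a b. a \<in> carrier H \<Longrightarrow> b \<in> carrier H \<Longrightarrow> val (x 1) [a] [b] = val (y 1) [a] [b]"
  shows "x = y"
proof (rule extensionalityI)
  show "x \<in> extensional {0..<2}" "y \<in> extensional {0..<2}"
    using x y total_cochains_2 by blast+
  have c: "x 0 \<in> carrier (cochains H I 0 2)" "y 0 \<in> carrier (cochains H I 0 2)"
    "x 1 \<in> carrier (cochains H I 1 1)" "y 1 \<in> carrier (cochains H I 1 1)"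
    using x y total_cochains_2 by blast+
  have "x 0 = y 0" "x 1 = y 1"
    unfolding cochain_eq_iff[OF comm_group_I c(1,2)] cochain_eq_iff[OF comm_group_I c(3,4)]
    using assms(3,4) by (simp_all add: ball_tuples)
  then show "x r = y r" if "r \<in> {0..<2}" for r
    using that by (cases r) auto
qed

lemma total_2_mult:
  assumes "x \<in> carrier (total_cochains H I 2)" "y \<in> carrier (total_cochains H I 2)"
    "a \<in> carrier H" "b \<in> carrier H"
  shows "val ((x \<otimes>\<^bsub>total_cochains H I 2\<^esub> y) 0) [] [a, b] = val (x 0) [] [a, b] +\<^sub>I val (y 0) [] [a, b]"
    and "val ((x \<otimes>\<^bsub>total_cochains H I 2\<^esub> y) 1) [a] [b] = val (x 1) [a] [b] +\<^sub>I val (y 1) [a] [b]"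
  using assms by (simp_all add: total_cochains_def cochain_value_mult[OF comm_group_I] tuples_simps tuples_0)

text \<open>\<open>\<diamondop>\<close> and \<open>\<leftthreetimes>\<close> are additive in their
  \<open>I\<close>-argument, so the differential on degree 1 is a homomorphism and its image a
  subgroup. Additivity is checked on values, since these determine a total cochain of degree
  2.\<close>

lemma coboundaries_subgroup: "subgroup coboundaries (total_cochains H I 2)"
proof -
  let ?T = "total_cochains H I 2" and ?C = "cochains H I 0 1"
  let ?d = "\<lambda>f. differential H I dia lt 1 (\<lambda>r\<in>{0..<1}. f)"
  interpret C: comm_group ?C by (rule comm_group_cochains[OF comm_group_I])
  note dv = differential_1_values[OF _ refl]
  have "?d \<in> hom ?C ?T"
  proof (rule homI)
    show "?d f \<in> carrier ?T" if "f \<in> carrier ?C" for f using dv(1)[OF that] .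
    fix f g assume fg: "f \<in> carrier ?C" "g \<in> carrier ?C"
    note fg' = fg[unfolded One_nat_def]
    have m: "val (f \<otimes>\<^bsub>?C\<^esub> g) [] [a] = val f [] [a] +\<^sub>I val g [] [a]" if "a \<in> carrier H" for a
      using that cochain_value_mult[OF comm_group_I, of "[]" H 0 "[a]" 1] by (simp add: tuples_simps tuples_0)
    show "?d (f \<otimes>\<^bsub>?C\<^esub> g) = ?d f \<otimes>\<^bsub>?T\<^esub> ?d g"
    proof (rule total_2_eqI)
      show "?d (f \<otimes>\<^bsub>?C\<^esub> g) \<in> carrier ?T" "?d f \<otimes>\<^bsub>?T\<^esub> ?d g \<in> carrier ?T"
        using dv(1) fg C.m_closed group.is_monoid[OF group_total_cochains] monoid.m_closed by (metis, metis)
      fix a b assume ab: "a \<in> carrier H" "b \<in> carrier H"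
      show "val (?d (f \<otimes>\<^bsub>?C\<^esub> g) 0) [] [a, b] = val ((?d f \<otimes>\<^bsub>?T\<^esub> ?d g) 0) [] [a, b]"
        using ab fg'
        by (simp only: total_2_mult[OF dv(1)[OF fg(1)] dv(1)[OF fg(2)] ab] dv(2)[OF _ ab] fg C.m_closed)
          (simp add: m[unfolded One_nat_def] I.inv_mult I.m_ac)
      show "val (?d (f \<otimes>\<^bsub>?C\<^esub> g) 1) [a] [b] = val ((?d f \<otimes>\<^bsub>?T\<^esub> ?d g) 1) [a] [b]"
        using ab fg'
        by (simp only: total_2_mult[OF dv(1)[OF fg(1)] dv(1)[OF fg(2)] ab] dv(3)[OF _ ab] fg C.m_closed)
          (simp add: m[unfolded One_nat_def] dia_add add_lt I.inv_mult I.m_ac)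
    qed
  qed
  then interpret d: group_hom ?C ?T ?d
    by (simp add: group_hom_def group_hom_axioms_def)
  show ?thesis
    using d.img_is_subgroup by (simp only: total_cochains_1_eq image_image)
qed

text \<open>Both sides say that \<open>z'\<close> arises from \<open>z\<close> by a function on
  \<open>H\<close> vanishing at zero: on the left a 1-cochain whose differential is added, on the
  right a change of section. The two functions are negatives of each other.\<close>

lemma coboundary_coset_eq_iff:
  assumes z: "z \<in> carrier (total_cochains H I 2)" and z': "z' \<in> carrier (total_cochains H I 2)"
  shows "coboundaries #>\<^bsub>total_cochains H I 2\<^esub> z = coboundaries #>\<^bsub>total_cochains H I 2\<^esub> z' \<longleftrightarrow>
    cohomologous (cochain_add z) (cochain_dot z) (cochain_add z') (cochain_dot z')"
proof -
  let ?T = "total_cochains H I 2" and ?C = "cochains H I 0 1"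
  let ?d = "\<lambda>f. differential H I dia lt 1 (\<lambda>r\<in>{0..<1}. f)"
  interpret T: group ?T by simp
  note dv = differential_1_values[OF _ refl]
  have zz: "z 0 \<in> carrier (cochains H I 0 2)" "z (Suc 0) \<in> carrier (cochains H I (Suc 0) (Suc 0))"
    "z' 0 \<in> carrier (cochains H I 0 2)" "z' (Suc 0) \<in> carrier (cochains H I (Suc 0) (Suc 0))"
    using z z' total_cochains_2 by auto
  have "coboundaries #>\<^bsub>?T\<^esub> z = coboundaries #>\<^bsub>?T\<^esub> z' \<longleftrightarrow> z' \<in> coboundaries #>\<^bsub>?T\<^esub> z"
    using T.repr_independence[OF _ z coboundaries_subgroup] T.rcos_self[OF z' coboundaries_subgroup] by auto
  also have "\<dots> \<longleftrightarrow> (\<exists>f\<in>carrier ?C. z' = ?d f \<otimes>\<^bsub>?T\<^esub> z)"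
    unfolding r_coset_def total_cochains_1_eq by auto
  also have "\<dots> \<longleftrightarrow> (\<exists>f\<in>carrier ?C. \<forall>a\<in>carrier H. \<forall>b\<in>carrier H.
      cochain_add z' a b -\<^sub>I val f [] [a +\<^sub>H b] = inv\<^bsub>I\<^esub> val f [] [a] -\<^sub>I val f [] [b] +\<^sub>I cochain_add z a b \<and>
      cochain_dot z' a b -\<^sub>I val f [] [a \<cdot>\<^sub>H b] = inv\<^bsub>I\<^esub> (a \<diamondop> val f [] [b]) +\<^sub>I cochain_dot z a b
        -\<^sub>I (a \<diamondop> val f [] [a]) \<leftthreetimes> (a \<cdot>\<^sub>H b))"
  proof (rule bex_cong[OF refl])
    fix f assume f: "f \<in> carrier ?C"
    have f': "f \<in> carrier (cochains H I 0 (Suc 0))" using f by simp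
    have dz: "?d f \<otimes>\<^bsub>?T\<^esub> z \<in> carrier ?T" using dv(1)[OF f] z by (rule T.m_closed)
    have "z' = ?d f \<otimes>\<^bsub>?T\<^esub> z \<longleftrightarrow> (\<forall>a\<in>carrier H. \<forall>b\<in>carrier H.
        val (z' 0) [] [a, b] = val ((?d f \<otimes>\<^bsub>?T\<^esub> z) 0) [] [a, b] \<and>
        val (z' 1) [a] [b] = val ((?d f \<otimes>\<^bsub>?T\<^esub> z) 1) [a] [b])"
      using total_2_eqI[OF z' dz] by metis
    also have "\<dots> \<longleftrightarrow> (\<forall>a\<in>carrier H. \<forall>b\<in>carrier H.
        val (z' 0) [] [a, b] = (val f [] [a] +\<^sub>I val f [] [b]) -\<^sub>I val f [] [a +\<^sub>H b] +\<^sub>I val (z 0) [] [a, b] \<and>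
        val (z' 1) [a] [b] = (val f [] [a \<cdot>\<^sub>H b] -\<^sub>I a \<diamondop> val f [] [b])
          -\<^sub>I (a \<diamondop> val f [] [a]) \<leftthreetimes> (a \<cdot>\<^sub>H b) +\<^sub>I val (z 1) [a] [b])"
      by (simp only: total_2_mult[OF dv(1)[OF f] z] dv(2,3)[OF f] cong: ball_cong)
    also have "\<dots> \<longleftrightarrow> (\<forall>a\<in>carrier H. \<forall>b\<in>carrier H.
      cochain_add z' a b -\<^sub>I val f [] [a +\<^sub>H b] = inv\<^bsub>I\<^esub> val f [] [a] -\<^sub>I val f [] [b] +\<^sub>I cochain_add z a b \<and>
      cochain_dot z' a b -\<^sub>I val f [] [a \<cdot>\<^sub>H b] = inv\<^bsub>I\<^esub> (a \<diamondop> val f [] [b]) +\<^sub>I cochain_dot z a b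
        -\<^sub>I (a \<diamondop> val f [] [a]) \<leftthreetimes> (a \<cdot>\<^sub>H b))"
      unfolding cochain_add_def cochain_dot_def
      by (intro ball_cong refl conj_cong I.cocycle_identities(4) I.cocycle_identities(5)) (use zz f' in simp_all)
    finally show "z' = ?d f \<otimes>\<^bsub>?T\<^esub> z \<longleftrightarrow> (\<forall>a\<in>carrier H. \<forall>b\<in>carrier H.
      cochain_add z' a b -\<^sub>I val f [] [a +\<^sub>H b] = inv\<^bsub>I\<^esub> val f [] [a] -\<^sub>I val f [] [b] +\<^sub>I cochain_add z a b \<and>
      cochain_dot z' a b -\<^sub>I val f [] [a \<cdot>\<^sub>H b] = inv\<^bsub>I\<^esub> (a \<diamondop> val f [] [b]) +\<^sub>I cochain_dot z a b
        -\<^sub>I (a \<diamondop> val f [] [a]) \<leftthreetimes> (a \<cdot>\<^sub>H b))" .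
  qed
  also have "\<dots> \<longleftrightarrow> cohomologous (cochain_add z) (cochain_dot z) (cochain_add z') (cochain_dot z')"
  proof
    assume "\<exists>f\<in>carrier ?C. \<forall>a\<in>carrier H. \<forall>b\<in>carrier H.
      cochain_add z' a b -\<^sub>I val f [] [a +\<^sub>H b] = inv\<^bsub>I\<^esub> val f [] [a] -\<^sub>I val f [] [b] +\<^sub>I cochain_add z a b \<and>
      cochain_dot z' a b -\<^sub>I val f [] [a \<cdot>\<^sub>H b] = inv\<^bsub>I\<^esub> (a \<diamondop> val f [] [b]) +\<^sub>I cochain_dot z a b
        -\<^sub>I (a \<diamondop> val f [] [a]) \<leftthreetimes> (a \<cdot>\<^sub>H b)" (is "\<exists>f\<in>_. ?P f")
    then obtain f where f: "f \<in> carrier ?C" "?P f" by blast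
    \<comment> \<open>The sign in \<open>cochain_add\<close> makes the change of section the
      negative of the 1-cochain.\<close>
    then show "cohomologous (cochain_add z) (cochain_dot z) (cochain_add z') (cochain_dot z')"
      unfolding cohomologous_def
      by (intro bexI[of _ "\<lambda>a. inv\<^bsub>I\<^esub> val f [] [a]"]) (simp_all add: Pi_iff dia_inv lt_inv)
  next
    assume "cohomologous (cochain_add z) (cochain_dot z) (cochain_add z') (cochain_dot z')"
    then obtain f where f: "f \<in> carrier H \<rightarrow> carrier I" "f \<one>\<^bsub>H\<^esub> = \<one>\<^bsub>I\<^esub>"
      and eq: "\<forall>a\<in>carrier H. \<forall>b\<in>carrier H.
        cochain_add z' a b +\<^sub>I f (a +\<^sub>H b) = f a +\<^sub>I f b +\<^sub>I cochain_add z a b \<and>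
        cochain_dot z' a b +\<^sub>I f (a \<cdot>\<^sub>H b) = a \<diamondop> f b +\<^sub>I cochain_dot z a b +\<^sub>I (a \<diamondop> f a) \<leftthreetimes> (a \<cdot>\<^sub>H b)"
      unfolding cohomologous_def by blast
    \<comment> \<open>The same sign in the opposite direction: the 1-cochain sought has the values
      \<open>- f a\<close>.\<close>
    have "(\<lambda>a. inv\<^bsub>I\<^esub> f a) \<in> carrier H \<rightarrow> carrier I" "inv\<^bsub>I\<^esub> f \<one>\<^bsub>H\<^esub> = \<one>\<^bsub>I\<^esub>"
      using f by auto
    then obtain g where g: "g \<in> carrier ?C" "\<forall>a\<in>carrier H. val g [] [a] = inv\<^bsub>I\<^esub> f a"
      using cochain_01_with_values by blast
    show "\<exists>f\<in>carrier ?C. \<forall>a\<in>carrier H. \<forall>b\<in>carrier H.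
      cochain_add z' a b -\<^sub>I val f [] [a +\<^sub>H b] = inv\<^bsub>I\<^esub> val f [] [a] -\<^sub>I val f [] [b] +\<^sub>I cochain_add z a b \<and>
      cochain_dot z' a b -\<^sub>I val f [] [a \<cdot>\<^sub>H b] = inv\<^bsub>I\<^esub> (a \<diamondop> val f [] [b]) +\<^sub>I cochain_dot z a b
        -\<^sub>I (a \<diamondop> val f [] [a]) \<leftthreetimes> (a \<cdot>\<^sub>H b)"
      using f eq by (intro bexI[OF _ g(1)]) (simp add: g(2) Pi_iff dia_inv lt_inv)
  qed
  finally show ?thesis .
qed

lemma carrier_cohomology_2:
  "carrier (cohomology H I dia lt 2) = (\<lambda>z. coboundaries #>\<^bsub>total_cochains H I 2\<^esub> z) ` cocycles"
  by (simp add: cohomology_def carrier_FactGroup r_coset_def)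

end

section \<open>Extensions in coordinates\<close>

text \<open>\<open>f\<close> is constant on each class, so the image of a class is a singleton whose
  only element is recovered by \<open>the_elem\<close>. Applied once equivalence of extensions has
  been brought to the form \<open>f x = f y\<close>.\<close>

lemma bij_betw_quotient_image:
  "bij_betw (\<lambda>X. the_elem (f ` X)) (A // {(x, y). x \<in> A \<and> y \<in> A \<and> f x = f y}) (f ` A)"
proof -
  define c where "c x = {y \<in> A. f x = f y}" for x
  have q: "A // {(x, y). x \<in> A \<and> y \<in> A \<and> f x = f y} = c ` A"
    by (auto simp: quotient_def c_def)
  have el: "the_elem (f ` c x) = f x" if "x \<in> A" for x
  proof -
    have "f ` c x = {f x}" using that by (auto simp: c_def)
    then show ?thesis by simp
  qed
  show ?thesis
    unfolding q bij_betw_def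
  proof
    show "inj_on (\<lambda>X. the_elem (f ` X)) (c ` A)"
    proof (rule inj_onI)
      fix X Y assume "X \<in> c ` A" "Y \<in> c ` A" and eq: "the_elem (f ` X) = the_elem (f ` Y)"
      then obtain x y where xy: "x \<in> A" "X = c x" "y \<in> A" "Y = c y"
        by blast
      then have "f x = f y" using eq by (simp add: el)
      then show "X = Y" by (simp add: xy c_def)
    qed
    show "(\<lambda>X. the_elem (f ` X)) ` c ` A = f ` A"
      unfolding image_image by (rule image_cong) (simp_all add: el)
  qed
qed

context lcs_actions
begin

text \<open>Read \<open>\<kappa> y h\<close> as \<open>\<iota> y + s h\<close>. The product formula
  comes from \<open>(s h + \<iota> y) \<cdot> x = \<iota> (h \<diamondop> y) \<cdot> (s h \<cdot>
  x)\<close>: on \<open>x = \<iota> y'\<close> the left factor acts trivially and leaves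
  \<open>h \<diamondop> y'\<close>, while on \<open>x = s h'\<close> it adds
  \<open>(h \<diamondop> y) \<leftthreetimes> (h \<cdot> h')\<close> to
  \<open>\<gamma> h h'\<close>.\<close>

definition coordinates ::
  "('h \<Rightarrow> 'h \<Rightarrow> 'i) \<Rightarrow> ('h \<Rightarrow> 'h \<Rightarrow> 'i) \<Rightarrow> ('i \<Rightarrow> 'h \<Rightarrow> 'b) \<Rightarrow> ('i, 'b, 'h) extension \<Rightarrow> bool" where
  "coordinates \<beta> \<gamma> \<kappa> = (\<lambda>(\<iota>, B, \<pi>).
     bij_betw (case_prod \<kappa>) (carrier I \<times> carrier H) (carrier B) \<and>
     (\<forall>y\<in>carrier I. \<kappa> y \<one>\<^bsub>H\<^esub> = \<iota> y) \<and>
     (\<forall>y\<in>carrier I. \<forall>h\<in>carrier H. \<pi> (\<kappa> y h) = h) \<and>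
     (\<forall>y\<in>carrier I. \<forall>h\<in>carrier H. \<forall>y'\<in>carrier I. \<forall>h'\<in>carrier H.
        \<kappa> y h \<otimes>\<^bsub>B\<^esub> \<kappa> y' h' = \<kappa> (y +\<^sub>I y' +\<^sub>I \<beta> h h') (h +\<^sub>H h') \<and>
        \<kappa> y h \<cdot>\<^bsub>B\<^esub> \<kappa> y' h' = \<kappa> (h \<diamondop> y' +\<^sub>I \<gamma> h h' +\<^sub>I (h \<diamondop> y) \<leftthreetimes> (h \<cdot>\<^sub>H h')) (h \<cdot>\<^sub>H h')))"

lemma coordinates_cong:
  assumes "\<And>a b. a \<in> carrier H \<Longrightarrow> b \<in> carrier H \<Longrightarrow> \<beta> a b = \<beta>' a b"
    "\<And>a b. a \<in> carrier H \<Longrightarrow> b \<in> carrier H \<Longrightarrow> \<gamma> a b = \<gamma>' a b"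
  shows "coordinates \<beta> \<gamma> \<kappa> E \<longleftrightarrow> coordinates \<beta>' \<gamma>' \<kappa> E"
  unfolding coordinates_def case_prod_beta
  by (intro conj_cong ball_cong refl) (simp_all add: assms)

end

text \<open>No algebraic law is assumed of \<open>B\<close>, nor any cocycle condition of
  \<open>\<beta>\<close> and \<open>\<gamma>\<close>. The same setting then serves both directions:
  deriving a factor set from a given \<open>B\<close>, and proving the laws of a \<open>B\<close>
  built from a factor set.\<close>

locale coordinatized = lcs_actions H I dia lt
  for H :: "'h linear_cycle_set" and I :: "'i linear_cycle_set"
    and dia (infixr "\<diamondop>" 75) and lt (infixl "\<leftthreetimes>" 75) +
  fixes \<beta> \<gamma> :: "'h \<Rightarrow> 'h \<Rightarrow> 'i" and \<kappa> :: "'i \<Rightarrow> 'h \<Rightarrow> 'b" and \<iota> B \<pi>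
  assumes coords: "coordinates \<beta> \<gamma> \<kappa> (\<iota>, B, \<pi>)"
    and factors_closed: "\<And>a b. a \<in> carrier H \<Longrightarrow> b \<in> carrier H \<Longrightarrow> \<beta> a b \<in> carrier I \<and> \<gamma> a b \<in> carrier I"
begin

lemma \<beta>_closed [simp]: "a \<in> carrier H \<Longrightarrow> b \<in> carrier H \<Longrightarrow> \<beta> a b \<in> carrier I"
  and \<gamma>_closed [simp]: "a \<in> carrier H \<Longrightarrow> b \<in> carrier H \<Longrightarrow> \<gamma> a b \<in> carrier I"
  using factors_closed by blast+

lemma \<kappa>_one: "y \<in> carrier I \<Longrightarrow> \<kappa> y \<one>\<^bsub>H\<^esub> = \<iota> y"
  and \<pi>_\<kappa> [simp]: "y \<in> carrier I \<Longrightarrow> h \<in> carrier H \<Longrightarrow> \<pi> (\<kappa> y h) = h"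
  and \<kappa>_add: "y \<in> carrier I \<Longrightarrow> h \<in> carrier H \<Longrightarrow> y' \<in> carrier I \<Longrightarrow> h' \<in> carrier H
    \<Longrightarrow> \<kappa> y h \<otimes>\<^bsub>B\<^esub> \<kappa> y' h' = \<kappa> (y +\<^sub>I y' +\<^sub>I \<beta> h h') (h +\<^sub>H h')"
  and \<kappa>_dot: "y \<in> carrier I \<Longrightarrow> h \<in> carrier H \<Longrightarrow> y' \<in> carrier I \<Longrightarrow> h' \<in> carrier H
    \<Longrightarrow> \<kappa> y h \<cdot>\<^bsub>B\<^esub> \<kappa> y' h' = \<kappa> (h \<diamondop> y' +\<^sub>I \<gamma> h h' +\<^sub>I (h \<diamondop> y) \<leftthreetimes> (h \<cdot>\<^sub>H h')) (h \<cdot>\<^sub>H h')"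
  using coords unfolding coordinates_def prod.case by (elim conjE; simp only:)+

lemma \<kappa>_bij: "bij_betw (case_prod \<kappa>) (carrier I \<times> carrier H) (carrier B)"
  using coords unfolding coordinates_def prod.case by (rule conjunct1)

lemma \<kappa>_closed [simp]: "y \<in> carrier I \<Longrightarrow> h \<in> carrier H \<Longrightarrow> \<kappa> y h \<in> carrier B"
  using bij_betw_apply[OF \<kappa>_bij, of "(y, h)"] by simp

lemma \<kappa>_eq_iff [simp]:
  assumes "y \<in> carrier I" "h \<in> carrier H" "y' \<in> carrier I" "h' \<in> carrier H"
  shows "\<kappa> y h = \<kappa> y' h' \<longleftrightarrow> y = y' \<and> h = h'"
  using assms inj_onD[OF bij_betw_imp_inj_on[OF \<kappa>_bij], of "(y, h)" "(y', h')"] by auto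

lemma carrier_cases:
  assumes "b \<in> carrier B"
  obtains y h where "y \<in> carrier I" "h \<in> carrier H" "b = \<kappa> y h"
  using assms unfolding bij_betw_imp_surj_on[OF \<kappa>_bij, symmetric] by (elim imageE SigmaE) (simp add: that)

text \<open>Each axiom of \<open>B\<close> is evaluated on the section elements
  \<open>\<kappa> 0 a\<close>, and injectivity of \<open>\<kappa>\<close> turns the result into an
  equation in \<open>I\<close>. That zero of \<open>B\<close> sits at the origin of the coordinates
  gives the normalization clauses.\<close>

lemma factor_set_if_linear_cycle_set:
  assumes B: "linear_cycle_set B" and one: "\<one>\<^bsub>B\<^esub> = \<kappa> \<one>\<^bsub>I\<^esub> \<one>\<^bsub>H\<^esub>"
  shows "factor_set \<beta> \<gamma>"
proof -
  interpret B: linear_cycle_set B by fact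
  let ?s = "\<kappa> \<one>\<^bsub>I\<^esub>"
  have sym: "\<beta> a b = \<beta> b a" if "a \<in> carrier H" "b \<in> carrier H" for a b
    using that B.m_comm[of "?s a" "?s b"] by (simp add: \<kappa>_add)
  have z1: "\<beta> \<one>\<^bsub>H\<^esub> a = \<one>\<^bsub>I\<^esub>" if "a \<in> carrier H" for a
    using that B.l_one[of "?s a"] by (simp add: \<kappa>_add one)
  have z2: "\<gamma> \<one>\<^bsub>H\<^esub> a = \<one>\<^bsub>I\<^esub>" if "a \<in> carrier H" for a
    using that B.one_cdot[of "?s a"] by (simp add: \<kappa>_dot one)
  have z3: "\<gamma> a \<one>\<^bsub>H\<^esub> = \<one>\<^bsub>I\<^esub>" if "a \<in> carrier H" for a
    using that B.cdot_one[of "?s a"] by (simp add: \<kappa>_dot one)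
  have c1: "\<beta> a b +\<^sub>I \<beta> (a +\<^sub>H b) c = \<beta> b c +\<^sub>I \<beta> a (b +\<^sub>H c)"
    if "a \<in> carrier H" "b \<in> carrier H" "c \<in> carrier H" for a b c
    using that B.m_assoc[of "?s a" "?s b" "?s c"] by (simp add: \<kappa>_add)
  have c2: "a \<diamondop> \<beta> b c +\<^sub>I \<gamma> a (b +\<^sub>H c) = \<gamma> a b +\<^sub>I \<gamma> a c +\<^sub>I \<beta> (a \<cdot>\<^sub>H b) (a \<cdot>\<^sub>H c)"
    if "a \<in> carrier H" "b \<in> carrier H" "c \<in> carrier H" for a b c
    using that B.cdot_add_right[of "?s a" "?s b" "?s c"] by (simp add: \<kappa>_add \<kappa>_dot)
  have c3: "\<gamma> (a +\<^sub>H b) c +\<^sub>I ((a +\<^sub>H b) \<diamondop> \<beta> a b) \<leftthreetimes> ((a +\<^sub>H b) \<cdot>\<^sub>H c) =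
          (a \<cdot>\<^sub>H b) \<diamondop> \<gamma> a c +\<^sub>I \<gamma> (a \<cdot>\<^sub>H b) (a \<cdot>\<^sub>H c) +\<^sub>I ((a \<cdot>\<^sub>H b) \<diamondop> \<gamma> a b) \<leftthreetimes> ((a +\<^sub>H b) \<cdot>\<^sub>H c)"
    if "a \<in> carrier H" "b \<in> carrier H" "c \<in> carrier H" for a b c
    using that B.cdot_add_left[of "?s a" "?s b" "?s c"] by (simp add: \<kappa>_add \<kappa>_dot H.cdot_add_left)
  show ?thesis
    unfolding factor_set_def
    by (intro conjI ballI) (simp_all only: \<beta>_closed \<gamma>_closed z1 z2 z3 c1 c2 c3, rule sym)
qed

text \<open>In every axiom the terms free of fibre coordinates match by the factor set conditions,
  and the terms containing them match by the identities of the two actions.\<close>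

lemma linear_cycle_set_if_factor_set:
  assumes fs: "factor_set \<beta> \<gamma>" and one: "\<one>\<^bsub>B\<^esub> = \<kappa> \<one>\<^bsub>I\<^esub> \<one>\<^bsub>H\<^esub>"
  shows "linear_cycle_set B"
proof -
  have sym: "\<And>a b. a \<in> carrier H \<Longrightarrow> b \<in> carrier H \<Longrightarrow> \<beta> a b = \<beta> b a"
    and zero: "\<And>a. a \<in> carrier H \<Longrightarrow> \<beta> \<one>\<^bsub>H\<^esub> a = \<one>\<^bsub>I\<^esub>"
    and c1: "\<And>a b c. a \<in> carrier H \<Longrightarrow> b \<in> carrier H \<Longrightarrow> c \<in> carrier H
      \<Longrightarrow> \<beta> a b +\<^sub>I \<beta> (a +\<^sub>H b) c = \<beta> b c +\<^sub>I \<beta> a (b +\<^sub>H c)"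
    and c2: "\<And>a b c. a \<in> carrier H \<Longrightarrow> b \<in> carrier H \<Longrightarrow> c \<in> carrier H
      \<Longrightarrow> a \<diamondop> \<beta> b c +\<^sub>I \<gamma> a (b +\<^sub>H c) = \<gamma> a b +\<^sub>I \<gamma> a c +\<^sub>I \<beta> (a \<cdot>\<^sub>H b) (a \<cdot>\<^sub>H c)"
    and c3: "\<And>a b c. a \<in> carrier H \<Longrightarrow> b \<in> carrier H \<Longrightarrow> c \<in> carrier H
      \<Longrightarrow> \<gamma> (a +\<^sub>H b) c +\<^sub>I ((a +\<^sub>H b) \<diamondop> \<beta> a b) \<leftthreetimes> ((a +\<^sub>H b) \<cdot>\<^sub>H c) =
          (a \<cdot>\<^sub>H b) \<diamondop> \<gamma> a c +\<^sub>I \<gamma> (a \<cdot>\<^sub>H b) (a \<cdot>\<^sub>H c) +\<^sub>I ((a \<cdot>\<^sub>H b) \<diamondop> \<gamma> a b) \<leftthreetimes> ((a +\<^sub>H b) \<cdot>\<^sub>H c)"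
    using fs unfolding factor_set_def by blast+
  have grp: "comm_group B"
  proof (rule comm_groupI)
    show "\<one>\<^bsub>B\<^esub> \<in> carrier B" by (simp add: one)
    fix x y z assume "x \<in> carrier B" "y \<in> carrier B" "z \<in> carrier B"
    then obtain u a v b w c where x: "u \<in> carrier I" "a \<in> carrier H" "x = \<kappa> u a"
      and y: "v \<in> carrier I" "b \<in> carrier H" "y = \<kappa> v b" and z: "w \<in> carrier I" "c \<in> carrier H" "z = \<kappa> w c"
      by (metis carrier_cases)
    show "x \<otimes>\<^bsub>B\<^esub> y \<in> carrier B" using x y by (simp add: \<kappa>_add)
    show "x \<otimes>\<^bsub>B\<^esub> y = y \<otimes>\<^bsub>B\<^esub> x"
      using x y sym[of a b] by (simp add: \<kappa>_add I.m_comm H.m_comm)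
    show "\<one>\<^bsub>B\<^esub> \<otimes>\<^bsub>B\<^esub> x = x" using x by (simp add: one \<kappa>_add zero)
    \<comment> \<open>The sum with an element over \<open>- a\<close> picks up
      \<open>\<beta> (- a) a\<close>, so the negative has to subtract this as well as
      \<open>u\<close>.\<close>
    show "\<exists>y\<in>carrier B. y \<otimes>\<^bsub>B\<^esub> x = \<one>\<^bsub>B\<^esub>"
      using x by (intro bexI[of _ "\<kappa> (inv\<^bsub>I\<^esub> u -\<^sub>I \<beta> (inv\<^bsub>H\<^esub> a) a) (inv\<^bsub>H\<^esub> a)"])
        (simp_all add: \<kappa>_add one H.l_inv I.m_ac)
    have "\<beta> a b +\<^sub>I \<beta> (a +\<^sub>H b) c +\<^sub>I (u +\<^sub>I v +\<^sub>I w) = \<beta> b c +\<^sub>I \<beta> a (b +\<^sub>H c) +\<^sub>I (u +\<^sub>I v +\<^sub>I w)"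
      using c1 x y z by simp
    then show "x \<otimes>\<^bsub>B\<^esub> y \<otimes>\<^bsub>B\<^esub> z = x \<otimes>\<^bsub>B\<^esub> (y \<otimes>\<^bsub>B\<^esub> z)"
      using x y z by (simp add: \<kappa>_add H.m_assoc) (simp add: I.m_ac)
  qed
  \<comment> \<open>The map is triangular: the \<open>H\<close>-coordinate goes through the
    bijection \<open>h \<cdot> _\<close>, and once it is fixed the \<open>I\<close>-coordinate goes
    through \<open>h \<diamondop> _\<close> followed by a translation.\<close>
  have bij: "bij_betw (\<lambda>x. b \<cdot>\<^bsub>B\<^esub> x) (carrier B) (carrier B)" if b: "b \<in> carrier B" for b
  proof -
    obtain u h where u: "u \<in> carrier I" "h \<in> carrier H" "b = \<kappa> u h"
      using carrier_cases[OF b] by blast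
    have Hbij: "bij_betw (\<lambda>k. h \<cdot>\<^sub>H k) (carrier H) (carrier H)" and Ibij: "bij_betw (\<lambda>y. h \<diamondop> y) (carrier I) (carrier I)"
      using H.cdot_bij dia_bij u by auto
    show ?thesis
      unfolding bij_betw_def
    proof (intro conjI inj_onI equalityI subsetI)
      fix x x' assume x: "x \<in> carrier B" "x' \<in> carrier B" and eq: "b \<cdot>\<^bsub>B\<^esub> x = b \<cdot>\<^bsub>B\<^esub> x'"
      obtain v k v' k' where v: "v \<in> carrier I" "k \<in> carrier H" "x = \<kappa> v k"
        "v' \<in> carrier I" "k' \<in> carrier H" "x' = \<kappa> v' k'"
        using x by (metis carrier_cases)
      have "h \<cdot>\<^sub>H k = h \<cdot>\<^sub>H k'" using eq u v by (simp add: \<kappa>_dot)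
      then have k: "k = k'" using Hbij v by (auto simp: bij_betw_def inj_on_def)
      then have "h \<diamondop> v = h \<diamondop> v'" using eq u v by (simp add: \<kappa>_dot I.m_assoc)
      then have "v = v'" using Ibij v by (auto simp: bij_betw_def inj_on_def)
      then show "x = x'" using k v by simp
    next
      fix x assume "x \<in> (\<lambda>x. b \<cdot>\<^bsub>B\<^esub> x) ` carrier B"
      then show "x \<in> carrier B" using u by (auto elim!: carrier_cases simp: \<kappa>_dot)
    next
      fix x assume "x \<in> carrier B"
      then obtain w k where w: "w \<in> carrier I" "k \<in> carrier H" "x = \<kappa> w k" by (metis carrier_cases)
      have "k \<in> (\<lambda>k. h \<cdot>\<^sub>H k) ` carrier H" using Hbij w by (simp add: bij_betw_def)
      then obtain k' where k': "k' \<in> carrier H" "h \<cdot>\<^sub>H k' = k" by auto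
      \<comment> \<open>The translation part: all of the first coordinate of the product except
        \<open>h \<diamondop> v\<close>.\<close>
      let ?c = "\<gamma> h k' +\<^sub>I (h \<diamondop> u) \<leftthreetimes> k"
      have c: "?c \<in> carrier I" using u k' w by simp
      then have "w -\<^sub>I ?c \<in> (\<lambda>y. h \<diamondop> y) ` carrier I"
        using Ibij w by (simp add: bij_betw_def)
      then obtain v where v: "v \<in> carrier I" "h \<diamondop> v = w -\<^sub>I ?c" by auto
      have "h \<diamondop> v +\<^sub>I \<gamma> h k' +\<^sub>I (h \<diamondop> u) \<leftthreetimes> (h \<cdot>\<^sub>H k') = (w -\<^sub>I ?c) +\<^sub>I ?c"
        using v k' u w by (simp add: I.m_assoc del: I.inv_mult_group)
      also have "\<dots> = w" using c w by (simp add: I.m_assoc I.l_inv del: I.inv_mult_group)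
      finally have "b \<cdot>\<^bsub>B\<^esub> \<kappa> v k' = x"
        using u v w k' by (simp add: \<kappa>_dot)
      then show "x \<in> (\<lambda>x. b \<cdot>\<^bsub>B\<^esub> x) ` carrier B" using v k' by force
    qed
  qed
  show ?thesis
  proof (intro linear_cycle_set.intro grp linear_cycle_set_axioms.intro bij)
    fix x y z assume "x \<in> carrier B" "y \<in> carrier B" "z \<in> carrier B"
    then obtain u a v b w c where x: "u \<in> carrier I" "a \<in> carrier H" "x = \<kappa> u a"
      and y: "v \<in> carrier I" "b \<in> carrier H" "y = \<kappa> v b" and z: "w \<in> carrier I" "c \<in> carrier H" "z = \<kappa> w c"
      by (metis carrier_cases)
    let ?L = "(a \<diamondop> u) \<leftthreetimes> (a \<cdot>\<^sub>H b)" and ?M = "(a \<diamondop> u) \<leftthreetimes> (a \<cdot>\<^sub>H c)"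
    have "(a \<diamondop> v +\<^sub>I a \<diamondop> w +\<^sub>I ?L +\<^sub>I ?M) +\<^sub>I (a \<diamondop> \<beta> b c +\<^sub>I \<gamma> a (b +\<^sub>H c))
      = (a \<diamondop> v +\<^sub>I a \<diamondop> w +\<^sub>I ?L +\<^sub>I ?M) +\<^sub>I (\<gamma> a b +\<^sub>I \<gamma> a c +\<^sub>I \<beta> (a \<cdot>\<^sub>H b) (a \<cdot>\<^sub>H c))"
      using c2 x y z by simp
    then show "x \<cdot>\<^bsub>B\<^esub> (y \<otimes>\<^bsub>B\<^esub> z) = (x \<cdot>\<^bsub>B\<^esub> y) \<otimes>\<^bsub>B\<^esub> (x \<cdot>\<^bsub>B\<^esub> z)"
      using x y z by (simp add: \<kappa>_add \<kappa>_dot dia_add lt_add H.cdot_add_right) (simp add: I.m_ac)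
    let ?ab = "a \<cdot>\<^sub>H b" and ?ac = "a \<cdot>\<^sub>H c" and ?k = "(a +\<^sub>H b) \<cdot>\<^sub>H c"
    have k: "?ab \<cdot>\<^sub>H ?ac = ?k" using x y z by (simp add: H.cdot_add_left)
    \<comment> \<open>On the right-hand side \<open>u\<close> enters twice, through
      \<open>x \<cdot> y\<close> and through \<open>x \<cdot> z\<close>; on the left only once. The
      law \<open>dia_lt\<close> at \<open>a \<cdot> b\<close>, \<open>a \<cdot> c\<close> and
      \<open>a \<diamondop> u\<close> is exactly what balances this, while \<open>v\<close> and
      \<open>w\<close> need only \<open>add_dia\<close>.\<close>
    have e1: "((a +\<^sub>H b) \<diamondop> u) \<leftthreetimes> ?k = ?ab \<diamondop> ((a \<diamondop> u) \<leftthreetimes> ?ac) +\<^sub>I (?ab \<diamondop> ((a \<diamondop> u) \<leftthreetimes> ?ab)) \<leftthreetimes> ?k"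
      using x y z dia_lt[of ?ab ?ac "a \<diamondop> u"] by (simp add: add_dia k)
    have e2: "((a +\<^sub>H b) \<diamondop> v) \<leftthreetimes> ?k = (?ab \<diamondop> (a \<diamondop> v)) \<leftthreetimes> ?k"
      using x y z by (simp add: add_dia)
    have e3: "(a +\<^sub>H b) \<diamondop> w = ?ab \<diamondop> (a \<diamondop> w)" using x y z by (simp add: add_dia)
    have "(?ab \<diamondop> (a \<diamondop> w) +\<^sub>I ((a +\<^sub>H b) \<diamondop> u) \<leftthreetimes> ?k +\<^sub>I ((a +\<^sub>H b) \<diamondop> v) \<leftthreetimes> ?k)
        +\<^sub>I (\<gamma> (a +\<^sub>H b) c +\<^sub>I ((a +\<^sub>H b) \<diamondop> \<beta> a b) \<leftthreetimes> ?k)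
      = (?ab \<diamondop> (a \<diamondop> w) +\<^sub>I (?ab \<diamondop> ((a \<diamondop> u) \<leftthreetimes> ?ac) +\<^sub>I (?ab \<diamondop> ((a \<diamondop> u) \<leftthreetimes> ?ab)) \<leftthreetimes> ?k) +\<^sub>I (?ab \<diamondop> (a \<diamondop> v)) \<leftthreetimes> ?k)
        +\<^sub>I (?ab \<diamondop> \<gamma> a c +\<^sub>I \<gamma> ?ab ?ac +\<^sub>I (?ab \<diamondop> \<gamma> a b) \<leftthreetimes> ?k)"
      using c3[of a b c] e1 e2 x y z by simp
    then show "(x \<otimes>\<^bsub>B\<^esub> y) \<cdot>\<^bsub>B\<^esub> z = (x \<cdot>\<^bsub>B\<^esub> y) \<cdot>\<^bsub>B\<^esub> (x \<cdot>\<^bsub>B\<^esub> z)"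
      using x y z by (simp add: \<kappa>_add \<kappa>_dot k dia_add[of "a +\<^sub>H b"] dia_add[of ?ab] add_lt e3) (simp add: I.m_ac)
  qed
qed

lemma in_extensions_with_actions:
  assumes fs: "factor_set \<beta> \<gamma>" and one: "\<one>\<^bsub>B\<^esub> = \<kappa> \<one>\<^bsub>I\<^esub> \<one>\<^bsub>H\<^esub>"
  shows "(\<iota>, B, \<pi>) \<in> extensions_with_actions H I dia lt"
proof -
  interpret B: linear_cycle_set B by (rule linear_cycle_set_if_factor_set[OF assms])
  have \<beta>1: "\<And>a. a \<in> carrier H \<Longrightarrow> \<beta> \<one>\<^bsub>H\<^esub> a = \<one>\<^bsub>I\<^esub>" and \<gamma>1: "\<And>a. a \<in> carrier H \<Longrightarrow> \<gamma> \<one>\<^bsub>H\<^esub> a = \<one>\<^bsub>I\<^esub>"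
    and \<gamma>2: "\<And>a. a \<in> carrier H \<Longrightarrow> \<gamma> a \<one>\<^bsub>H\<^esub> = \<one>\<^bsub>I\<^esub>"
    using fs unfolding factor_set_def by blast+
  have \<iota>: "\<iota> \<in> lcs_hom I B"
    unfolding lcs_hom_def hom_def
    by (auto simp: \<kappa>_one[symmetric] \<kappa>_add \<kappa>_dot \<beta>1 \<gamma>1 I.cdot_trivial)
  have \<pi>: "\<pi> \<in> lcs_hom B H"
    unfolding lcs_hom_def hom_def by (auto elim!: carrier_cases simp: \<kappa>_add \<kappa>_dot)
  have inj: "inj_on \<iota> (carrier I)"
    by (rule inj_onI) (simp add: \<kappa>_one[symmetric])
  have ker: "\<iota> ` carrier I = kernel B H \<pi>"
  proof (intro equalityI subsetI)
    fix b assume "b \<in> kernel B H \<pi>"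
    then have "b \<in> carrier B" "\<pi> b = \<one>\<^bsub>H\<^esub>" by (auto simp: kernel_def)
    then show "b \<in> \<iota> ` carrier I"
      by (auto elim!: carrier_cases simp: \<kappa>_one)
  qed (auto simp: kernel_def \<kappa>_one[symmetric])
  have surj: "\<pi> ` carrier B = carrier H"
  proof (intro equalityI subsetI)
    fix h assume "h \<in> carrier H"
    then show "h \<in> \<pi> ` carrier B" by (intro image_eqI[of _ _ "\<kappa> \<one>\<^bsub>I\<^esub> h"]) simp_all
  qed (auto elim!: carrier_cases)
  have act: "s h \<cdot>\<^bsub>B\<^esub> \<iota> y = \<iota> (h \<diamondop> y) \<and> (\<iota> y \<cdot>\<^bsub>B\<^esub> s h) \<otimes>\<^bsub>B\<^esub> inv\<^bsub>B\<^esub> s h = \<iota> (y \<leftthreetimes> h)"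
    if s: "normalized_section H B \<pi> s" and h: "h \<in> carrier H" and y: "y \<in> carrier I" for s h y
  proof -
    have sh: "s h \<in> carrier B" "\<pi> (s h) = h" using s h by (auto simp: normalized_section_def)
    \<comment> \<open>An arbitrary normalized section has an unknown fibre coordinate
      \<open>u\<close> over \<open>h\<close>. It cancels in the second identity, and in the first it
      only meets \<open>\<leftthreetimes>\<close> at \<open>h \<cdot> 0 = 0\<close>, so the actions
      do not depend on the section.\<close>
    obtain u where u: "u \<in> carrier I" "s h = \<kappa> u h"
      using carrier_cases[OF sh(1)] sh(2) \<pi>_\<kappa> by metis
    have "\<iota> y \<cdot>\<^bsub>B\<^esub> s h = \<iota> (y \<leftthreetimes> h) \<otimes>\<^bsub>B\<^esub> s h"
      using u h y by (simp add: \<kappa>_one[symmetric] \<kappa>_dot \<kappa>_add \<beta>1 \<gamma>1 I.m_comm)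
    moreover have "\<iota> (y \<leftthreetimes> h) \<in> carrier B" using h y by (simp add: \<kappa>_one[symmetric])
    ultimately show ?thesis
      using u h y sh by (simp add: \<kappa>_one[symmetric] \<kappa>_dot \<gamma>2 B.m_assoc)
  qed
  show ?thesis
    unfolding extensions_with_actions_def is_extension_def
    using B.linear_cycle_set_axioms \<iota> \<pi> inj ker surj act by simp
qed

end

section \<open>Extensions and their morphisms expressed in coordinates\<close>

context lcs_actions
begin

text \<open>By exactness, two elements over the same point of \<open>H\<close> differ by some
  \<open>\<iota> y\<close>. Comparing sums and products of section elements with the section at the
  sum or product gives \<open>\<beta>\<close> and \<open>\<gamma>\<close>.\<close>

lemma extension_has_coordinates:
  assumes E: "(\<iota>, B, \<pi>) \<in> extensions_with_actions H I dia lt"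
  shows "\<exists>\<beta> \<gamma> \<kappa>. coordinatized H I dia lt \<beta> \<gamma> \<kappa> \<iota> B \<pi> \<and> \<one>\<^bsub>B\<^esub> = \<kappa> \<one>\<^bsub>I\<^esub> \<one>\<^bsub>H\<^esub>"
proof -
  have "is_extension H I (\<iota>, B, \<pi>)" using E by (simp add: extensions_with_actions_def)
  then have B: "linear_cycle_set B" and \<iota>: "\<iota> \<in> lcs_hom I B" and \<pi>: "\<pi> \<in> lcs_hom B H"
    and inj: "inj_on \<iota> (carrier I)" and ker: "\<iota> ` carrier I = kernel B H \<pi>" and surj: "\<pi> ` carrier B = carrier H"
    by (auto simp: is_extension_def)
  interpret B: linear_cycle_set B by (rule B)
  interpret \<iota>: group_hom I B \<iota>
    using \<iota> by (simp add: group_hom_def group_hom_axioms_def lcs_hom_def I.is_group B.is_group)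
  interpret \<pi>: group_hom B H \<pi>
    using \<pi> by (simp add: group_hom_def group_hom_axioms_def lcs_hom_def H.is_group B.is_group)
  have \<iota>_dot: "\<iota> y \<cdot>\<^bsub>B\<^esub> \<iota> y' = \<iota> y'" if "y \<in> carrier I" "y' \<in> carrier I" for y y'
  proof -
    have "\<iota> (y \<cdot>\<^bsub>I\<^esub> y') = \<iota> y \<cdot>\<^bsub>B\<^esub> \<iota> y'" using \<iota> that by (simp add: lcs_hom_def)
    then show ?thesis using that by (simp add: I.cdot_trivial)
  qed
  have \<pi>_dot: "\<pi> (x \<cdot>\<^bsub>B\<^esub> x') = \<pi> x \<cdot>\<^sub>H \<pi> x'" if "x \<in> carrier B" "x' \<in> carrier B" for x x'
    using \<pi> that by (auto simp: lcs_hom_def)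
  have \<pi>\<iota>: "\<pi> (\<iota> y) = \<one>\<^bsub>H\<^esub>" if "y \<in> carrier I" for y
    using ker that by (auto simp: kernel_def)
  have \<iota>_eq: "\<iota> y = \<iota> y' \<longleftrightarrow> y = y'" if "y \<in> carrier I" "y' \<in> carrier I" for y y'
    using inj that by (auto dest: inj_onD)
  have fibre: "\<exists>y\<in>carrier I. x = \<iota> y \<otimes>\<^bsub>B\<^esub> x'" if "x \<in> carrier B" "x' \<in> carrier B" "\<pi> x = \<pi> x'" for x x'
  proof -
    have "x \<otimes>\<^bsub>B\<^esub> inv\<^bsub>B\<^esub> x' \<in> kernel B H \<pi>" using that by (simp add: kernel_def)
    then obtain y where "y \<in> carrier I" "x \<otimes>\<^bsub>B\<^esub> inv\<^bsub>B\<^esub> x' = \<iota> y" using ker by (metis imageE)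
    then show ?thesis using that by (intro bexI[of _ y]) (simp_all add: B.m_assoc flip: \<open>x \<otimes>\<^bsub>B\<^esub> inv\<^bsub>B\<^esub> x' = \<iota> y\<close>)
  qed
  \<comment> \<open>The value at zero is prescribed, as a plain choice of preimages need not be
    normalized.\<close>
  define s where "s h = (if h = \<one>\<^bsub>H\<^esub> then \<one>\<^bsub>B\<^esub> else SOME b. b \<in> carrier B \<and> \<pi> b = h)" for h
  have s: "s h \<in> carrier B \<and> \<pi> (s h) = h" if "h \<in> carrier H" for h
  proof -
    have "\<exists>b. b \<in> carrier B \<and> \<pi> b = h" using surj that by (metis imageE)
    then show ?thesis unfolding s_def using someI_ex[of "\<lambda>b. b \<in> carrier B \<and> \<pi> b = h"] by simp
  qed
  have s_closed [simp]: "s h \<in> carrier B" and \<pi>s [simp]: "\<pi> (s h) = h" if "h \<in> carrier H" for h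
    using s that by auto
  have s1: "s \<one>\<^bsub>H\<^esub> = \<one>\<^bsub>B\<^esub>" by (simp add: s_def)
  have "normalized_section H B \<pi> s" using s1 by (simp add: normalized_section_def)
  then have act: "s h \<cdot>\<^bsub>B\<^esub> \<iota> y = \<iota> (h \<diamondop> y)" "(\<iota> y \<cdot>\<^bsub>B\<^esub> s h) \<otimes>\<^bsub>B\<^esub> inv\<^bsub>B\<^esub> s h = \<iota> (y \<leftthreetimes> h)"
    if "h \<in> carrier H" "y \<in> carrier I" for h y
    using E that by (auto simp: extensions_with_actions_def)
  have act2: "\<iota> y \<cdot>\<^bsub>B\<^esub> s h = \<iota> (y \<leftthreetimes> h) \<otimes>\<^bsub>B\<^esub> s h" if "h \<in> carrier H" "y \<in> carrier I" for h y
    using that by (simp add: B.m_assoc flip: act(2))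
  have "\<forall>a\<in>carrier H. \<forall>b\<in>carrier H. \<exists>y\<in>carrier I. s a \<otimes>\<^bsub>B\<^esub> s b = \<iota> y \<otimes>\<^bsub>B\<^esub> s (a +\<^sub>H b)"
    by (intro ballI fibre) simp_all
  then obtain \<beta> where \<beta>: "\<And>a b. a \<in> carrier H \<Longrightarrow> b \<in> carrier H
      \<Longrightarrow> \<beta> a b \<in> carrier I \<and> s a \<otimes>\<^bsub>B\<^esub> s b = \<iota> (\<beta> a b) \<otimes>\<^bsub>B\<^esub> s (a +\<^sub>H b)"
    by metis
  have "\<forall>a\<in>carrier H. \<forall>b\<in>carrier H. \<exists>y\<in>carrier I. s a \<cdot>\<^bsub>B\<^esub> s b = \<iota> y \<otimes>\<^bsub>B\<^esub> s (a \<cdot>\<^sub>H b)"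
    by (intro ballI fibre) (simp_all add: \<pi>_dot)
  then obtain \<gamma> where \<gamma>: "\<And>a b. a \<in> carrier H \<Longrightarrow> b \<in> carrier H
      \<Longrightarrow> \<gamma> a b \<in> carrier I \<and> s a \<cdot>\<^bsub>B\<^esub> s b = \<iota> (\<gamma> a b) \<otimes>\<^bsub>B\<^esub> s (a \<cdot>\<^sub>H b)"
    by metis
  note cl = \<beta>[THEN conjunct1] \<gamma>[THEN conjunct1] and eq = \<beta>[THEN conjunct2] \<gamma>[THEN conjunct2]
  define \<kappa> where "\<kappa> y h = \<iota> y \<otimes>\<^bsub>B\<^esub> s h" for y h
  have "coordinates \<beta> \<gamma> \<kappa> (\<iota>, B, \<pi>)"
    unfolding coordinates_def prod.case
  proof (intro conjI ballI)
    show "bij_betw (case_prod \<kappa>) (carrier I \<times> carrier H) (carrier B)"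
      unfolding bij_betw_def
    proof (intro conjI inj_onI equalityI subsetI)
      fix p q assume "p \<in> carrier I \<times> carrier H" "q \<in> carrier I \<times> carrier H"
        and pq: "case_prod \<kappa> p = case_prod \<kappa> q"
      then obtain y h y' h' where p: "p = (y, h)" "y \<in> carrier I" "h \<in> carrier H"
        and q: "q = (y', h')" "y' \<in> carrier I" "h' \<in> carrier H" by auto
      have k: "\<iota> y \<otimes>\<^bsub>B\<^esub> s h = \<iota> y' \<otimes>\<^bsub>B\<^esub> s h'" using pq p q by (simp add: \<kappa>_def)
      have "\<pi> (\<iota> y \<otimes>\<^bsub>B\<^esub> s h) = h" "\<pi> (\<iota> y' \<otimes>\<^bsub>B\<^esub> s h') = h'"
        using p q by (simp_all add: \<pi>\<iota>)
      then have "h = h'" using k by simp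
      then show "p = q" using k p q by (simp add: \<iota>_eq)
    next
      fix x assume "x \<in> case_prod \<kappa> ` (carrier I \<times> carrier H)"
      then show "x \<in> carrier B" by (auto simp: \<kappa>_def)
    next
      fix x assume x: "x \<in> carrier B"
      then obtain y where "y \<in> carrier I" "x = \<iota> y \<otimes>\<^bsub>B\<^esub> s (\<pi> x)"
        using fibre[of x "s (\<pi> x)"] by auto
      then show "x \<in> case_prod \<kappa> ` (carrier I \<times> carrier H)"
        using x by (intro image_eqI[of _ _ "(y, \<pi> x)"]) (simp_all add: \<kappa>_def)
    qed
    show "\<kappa> y \<one>\<^bsub>H\<^esub> = \<iota> y" if "y \<in> carrier I" for y using that by (simp add: \<kappa>_def s1)
    show "\<pi> (\<kappa> y h) = h" if "y \<in> carrier I" "h \<in> carrier H" for y h using that by (simp add: \<kappa>_def \<pi>\<iota>)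
    fix y h y' h' assume y: "y \<in> carrier I" "h \<in> carrier H" "y' \<in> carrier I" "h' \<in> carrier H"
    have "\<kappa> y h \<otimes>\<^bsub>B\<^esub> \<kappa> y' h' = (\<iota> y \<otimes>\<^bsub>B\<^esub> \<iota> y') \<otimes>\<^bsub>B\<^esub> (s h \<otimes>\<^bsub>B\<^esub> s h')"
      using y by (simp add: \<kappa>_def B.m_ac)
    also have "\<dots> = \<kappa> (y +\<^sub>I y' +\<^sub>I \<beta> h h') (h +\<^sub>H h')"
      using y cl by (simp add: eq \<kappa>_def B.m_assoc)
    finally show "\<kappa> y h \<otimes>\<^bsub>B\<^esub> \<kappa> y' h' = \<kappa> (y +\<^sub>I y' +\<^sub>I \<beta> h h') (h +\<^sub>H h')" .
    \<comment> \<open>The order is reversed so that \<open>cdot_add_left\<close> lets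
      \<open>s h\<close> act first: it turns \<open>\<iota> y\<close> into
      \<open>\<iota> (h \<diamondop> y)\<close>, which then acts on an element already split into an
      \<open>\<iota>\<close>-part and a section part.\<close>
    have k: "\<kappa> y h = s h \<otimes>\<^bsub>B\<^esub> \<iota> y" using y by (simp add: \<kappa>_def B.m_comm)
    have 1: "\<kappa> y h \<cdot>\<^bsub>B\<^esub> \<iota> y' = \<iota> (h \<diamondop> y')"
      using y by (simp add: k B.cdot_add_left act(1) \<iota>_dot)
    have "\<kappa> y h \<cdot>\<^bsub>B\<^esub> s h' = \<iota> (h \<diamondop> y) \<cdot>\<^bsub>B\<^esub> (\<iota> (\<gamma> h h') \<otimes>\<^bsub>B\<^esub> s (h \<cdot>\<^sub>H h'))"
      using y by (simp add: k B.cdot_add_left act(1) eq)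
    also have "\<dots> = \<iota> (\<gamma> h h') \<otimes>\<^bsub>B\<^esub> (\<iota> ((h \<diamondop> y) \<leftthreetimes> (h \<cdot>\<^sub>H h')) \<otimes>\<^bsub>B\<^esub> s (h \<cdot>\<^sub>H h'))"
      using y cl by (simp add: B.cdot_add_right act2 \<iota>_dot)
    finally have 2: "\<kappa> y h \<cdot>\<^bsub>B\<^esub> s h' = \<iota> (\<gamma> h h') \<otimes>\<^bsub>B\<^esub> (\<iota> ((h \<diamondop> y) \<leftthreetimes> (h \<cdot>\<^sub>H h')) \<otimes>\<^bsub>B\<^esub> s (h \<cdot>\<^sub>H h'))" .
    have "\<kappa> y h \<cdot>\<^bsub>B\<^esub> \<kappa> y' h' = (\<kappa> y h \<cdot>\<^bsub>B\<^esub> \<iota> y') \<otimes>\<^bsub>B\<^esub> (\<kappa> y h \<cdot>\<^bsub>B\<^esub> s h')"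
      using y by (subst (2) \<kappa>_def, intro B.cdot_add_right) (simp_all add: \<kappa>_def)
    also have "\<dots> = \<kappa> (h \<diamondop> y' +\<^sub>I \<gamma> h h' +\<^sub>I (h \<diamondop> y) \<leftthreetimes> (h \<cdot>\<^sub>H h')) (h \<cdot>\<^sub>H h')"
      unfolding 1 2 using y cl by (simp add: \<kappa>_def B.m_assoc)
    finally show "\<kappa> y h \<cdot>\<^bsub>B\<^esub> \<kappa> y' h' = \<kappa> (h \<diamondop> y' +\<^sub>I \<gamma> h h' +\<^sub>I (h \<diamondop> y) \<leftthreetimes> (h \<cdot>\<^sub>H h')) (h \<cdot>\<^sub>H h')" .
  qed
  then have "coordinatized H I dia lt \<beta> \<gamma> \<kappa> \<iota> B \<pi>"
    using cl lcs_actions_axioms by (simp add: coordinatized_def coordinatized_axioms_def)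
  moreover have "\<one>\<^bsub>B\<^esub> = \<kappa> \<one>\<^bsub>I\<^esub> \<one>\<^bsub>H\<^esub>" by (simp add: \<kappa>_def s1)
  ultimately show ?thesis by blast
qed

text \<open>A morphism compatible with \<open>\<iota>\<close> and \<open>\<pi>\<close> must be
  \<open>\<kappa> y h \<mapsto> \<kappa>' (y + f h) h\<close>, and it respects both operations
  exactly when \<open>f\<close> satisfies the equations of \<open>cohomologous\<close>. The factor
  set of the target comes first because \<open>f\<close> measures the image of the old section
  against the section of the target.\<close>

lemma equivalent_iff_cohomologous:
  assumes "coordinatized H I dia lt \<beta> \<gamma> \<kappa> \<iota> B \<pi>" "coordinatized H I dia lt \<beta>' \<gamma>' \<kappa>' \<iota>' B' \<pi>'"
    and fs: "factor_set \<beta> \<gamma>" "factor_set \<beta>' \<gamma>'"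
  shows "equivalent_extensions H I (\<iota>, B, \<pi>) (\<iota>', B', \<pi>') \<longleftrightarrow> cohomologous \<beta>' \<gamma>' \<beta> \<gamma>"
proof
  interpret C: coordinatized H I dia lt \<beta> \<gamma> \<kappa> \<iota> B \<pi> by fact
  interpret C': coordinatized H I dia lt \<beta>' \<gamma>' \<kappa>' \<iota>' B' \<pi>' by fact
  have \<beta>1: "\<beta> \<one>\<^bsub>H\<^esub> a = \<one>\<^bsub>I\<^esub>" "\<beta>' \<one>\<^bsub>H\<^esub> a = \<one>\<^bsub>I\<^esub>" if "a \<in> carrier H" for a
    using fs that unfolding factor_set_def by blast+
  {
    assume "equivalent_extensions H I (\<iota>, B, \<pi>) (\<iota>', B', \<pi>')"
    then obtain \<phi> where \<phi>: "\<phi> \<in> lcs_hom B B'" and \<pi>\<phi>: "\<And>b. b \<in> carrier B \<Longrightarrow> \<pi>' (\<phi> b) = \<pi> b"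
      and \<phi>\<iota>: "\<And>y. y \<in> carrier I \<Longrightarrow> \<phi> (\<iota> y) = \<iota>' y"
      by (auto simp: equivalent_extensions_def)
    have \<phi>_closed: "\<phi> x \<in> carrier B'" if "x \<in> carrier B" for x
      using \<phi> that by (auto simp: lcs_hom_def hom_def)
    have \<phi>_add: "\<phi> (x \<otimes>\<^bsub>B\<^esub> x') = \<phi> x \<otimes>\<^bsub>B'\<^esub> \<phi> x'" and \<phi>_dot: "\<phi> (x \<cdot>\<^bsub>B\<^esub> x') = \<phi> x \<cdot>\<^bsub>B'\<^esub> \<phi> x'"
      if "x \<in> carrier B" "x' \<in> carrier B" for x x'
      using \<phi> that by (auto simp: lcs_hom_def hom_mult)
    have "\<exists>y\<in>carrier I. \<phi> (\<kappa> \<one>\<^bsub>I\<^esub> h) = \<kappa>' y h" if h: "h \<in> carrier H" for h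
    proof -
      have "\<phi> (\<kappa> \<one>\<^bsub>I\<^esub> h) \<in> carrier B'" using h \<phi>_closed by simp
      then obtain y k where k: "y \<in> carrier I" "k \<in> carrier H" "\<phi> (\<kappa> \<one>\<^bsub>I\<^esub> h) = \<kappa>' y k"
        by (rule C'.carrier_cases)
      moreover have "k = h" using \<pi>\<phi>[of "\<kappa> \<one>\<^bsub>I\<^esub> h"] k h by simp
      ultimately show ?thesis by blast
    qed
    then obtain f where f: "\<And>h. h \<in> carrier H \<Longrightarrow> f h \<in> carrier I \<and> \<phi> (\<kappa> \<one>\<^bsub>I\<^esub> h) = \<kappa>' (f h) h"
      by metis
    note fc [simp] = f[THEN conjunct1] and fe = f[THEN conjunct2]
    have f1: "f \<one>\<^bsub>H\<^esub> = \<one>\<^bsub>I\<^esub>"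
      using fe[of "\<one>\<^bsub>H\<^esub>"] \<phi>\<iota>[of "\<one>\<^bsub>I\<^esub>"] by (simp add: C.\<kappa>_one C'.\<kappa>_one[symmetric])
    have \<phi>\<kappa>: "\<phi> (\<kappa> y h) = \<kappa>' (y +\<^sub>I f h) h" if y: "y \<in> carrier I" and h: "h \<in> carrier H" for y h
    proof -
      \<comment> \<open>Splitting off the part in the image of \<open>\<iota>\<close>, on which the
        morphism is prescribed, leaves a section element, where it is given by
        \<open>f\<close>.\<close>
      have "\<kappa> y h = \<kappa> y \<one>\<^bsub>H\<^esub> \<otimes>\<^bsub>B\<^esub> \<kappa> \<one>\<^bsub>I\<^esub> h" using y h by (simp add: C.\<kappa>_add \<beta>1)
      also have "\<phi> \<dots> = \<phi> (\<kappa> y \<one>\<^bsub>H\<^esub>) \<otimes>\<^bsub>B'\<^esub> \<phi> (\<kappa> \<one>\<^bsub>I\<^esub> h)"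
        using y h by (intro \<phi>_add) simp_all
      also have "\<dots> = \<kappa>' y \<one>\<^bsub>H\<^esub> \<otimes>\<^bsub>B'\<^esub> \<kappa>' (f h) h"
        using y h by (simp only: fe C.\<kappa>_one \<phi>\<iota> C'.\<kappa>_one)
      also have "\<dots> = \<kappa>' (y +\<^sub>I f h) h" using y h by (simp add: C'.\<kappa>_add \<beta>1)
      finally show ?thesis .
    qed
    show "cohomologous \<beta>' \<gamma>' \<beta> \<gamma>"
      unfolding cohomologous_def
    proof (intro bexI[of _ f] conjI ballI)
      fix a b assume ab: "a \<in> carrier H" "b \<in> carrier H"
      show "\<beta> a b +\<^sub>I f (a +\<^sub>H b) = f a +\<^sub>I f b +\<^sub>I \<beta>' a b"
        using ab \<phi>_add[of "\<kappa> \<one>\<^bsub>I\<^esub> a" "\<kappa> \<one>\<^bsub>I\<^esub> b"] by (simp add: C.\<kappa>_add \<phi>\<kappa> C'.\<kappa>_add)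
      show "\<gamma> a b +\<^sub>I f (a \<cdot>\<^sub>H b) = a \<diamondop> f b +\<^sub>I \<gamma>' a b +\<^sub>I (a \<diamondop> f a) \<leftthreetimes> (a \<cdot>\<^sub>H b)"
        using ab \<phi>_dot[of "\<kappa> \<one>\<^bsub>I\<^esub> a" "\<kappa> \<one>\<^bsub>I\<^esub> b"] by (simp add: C.\<kappa>_dot \<phi>\<kappa> C'.\<kappa>_dot)
    qed (use f1 in auto)
  }
  assume "cohomologous \<beta>' \<gamma>' \<beta> \<gamma>"
  then obtain f where fc: "f \<in> carrier H \<rightarrow> carrier I" and f1: "f \<one>\<^bsub>H\<^esub> = \<one>\<^bsub>I\<^esub>"
    and eq: "\<forall>a\<in>carrier H. \<forall>b\<in>carrier H. \<beta> a b +\<^sub>I f (a +\<^sub>H b) = f a +\<^sub>I f b +\<^sub>I \<beta>' a b \<and>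
        \<gamma> a b +\<^sub>I f (a \<cdot>\<^sub>H b) = a \<diamondop> f b +\<^sub>I \<gamma>' a b +\<^sub>I (a \<diamondop> f a) \<leftthreetimes> (a \<cdot>\<^sub>H b)"
    unfolding cohomologous_def by blast
  have fcl [simp]: "f h \<in> carrier I" if "h \<in> carrier H" for h using fc that by auto
  have eq1: "\<And>a b. a \<in> carrier H \<Longrightarrow> b \<in> carrier H \<Longrightarrow> \<beta> a b +\<^sub>I f (a +\<^sub>H b) = f a +\<^sub>I f b +\<^sub>I \<beta>' a b"
    and eq2: "\<And>a b. a \<in> carrier H \<Longrightarrow> b \<in> carrier H
      \<Longrightarrow> \<gamma> a b +\<^sub>I f (a \<cdot>\<^sub>H b) = a \<diamondop> f b +\<^sub>I \<gamma>' a b +\<^sub>I (a \<diamondop> f a) \<leftthreetimes> (a \<cdot>\<^sub>H b)"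
    using eq by blast+
  define \<phi> where "\<phi> b = (\<lambda>(y, h). \<kappa>' (y +\<^sub>I f h) h) (inv_into (carrier I \<times> carrier H) (case_prod \<kappa>) b)" for b
  have \<phi>\<kappa>: "\<phi> (\<kappa> y h) = \<kappa>' (y +\<^sub>I f h) h" if "y \<in> carrier I" "h \<in> carrier H" for y h
    using inv_into_f_f[OF bij_betw_imp_inj_on[OF C.\<kappa>_bij], of "(y, h)"] that by (simp add: \<phi>_def)
  have hom: "\<phi> (\<kappa> y h \<otimes>\<^bsub>B\<^esub> \<kappa> y' h') = \<phi> (\<kappa> y h) \<otimes>\<^bsub>B'\<^esub> \<phi> (\<kappa> y' h') \<and>
      \<phi> (\<kappa> y h \<cdot>\<^bsub>B\<^esub> \<kappa> y' h') = \<phi> (\<kappa> y h) \<cdot>\<^bsub>B'\<^esub> \<phi> (\<kappa> y' h')"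
    if y: "y \<in> carrier I" "h \<in> carrier H" "y' \<in> carrier I" "h' \<in> carrier H" for y h y' h'
  proof
    have "y +\<^sub>I y' +\<^sub>I (\<beta> h h' +\<^sub>I f (h +\<^sub>H h')) = y +\<^sub>I y' +\<^sub>I (f h +\<^sub>I f h' +\<^sub>I \<beta>' h h')"
      using eq1 y by simp
    then show "\<phi> (\<kappa> y h \<otimes>\<^bsub>B\<^esub> \<kappa> y' h') = \<phi> (\<kappa> y h) \<otimes>\<^bsub>B'\<^esub> \<phi> (\<kappa> y' h')"
      using y by (simp add: C.\<kappa>_add \<phi>\<kappa> C'.\<kappa>_add) (simp add: I.m_ac)
    have "h \<diamondop> y' +\<^sub>I \<gamma> h h' +\<^sub>I (h \<diamondop> y) \<leftthreetimes> (h \<cdot>\<^sub>H h') +\<^sub>I f (h \<cdot>\<^sub>H h')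
      = h \<diamondop> y' +\<^sub>I (h \<diamondop> y) \<leftthreetimes> (h \<cdot>\<^sub>H h') +\<^sub>I (\<gamma> h h' +\<^sub>I f (h \<cdot>\<^sub>H h'))"
      using y by (simp add: I.m_ac)
    then show "\<phi> (\<kappa> y h \<cdot>\<^bsub>B\<^esub> \<kappa> y' h') = \<phi> (\<kappa> y h) \<cdot>\<^bsub>B'\<^esub> \<phi> (\<kappa> y' h')"
      using y by (simp add: C.\<kappa>_dot \<phi>\<kappa> C'.\<kappa>_dot dia_add add_lt eq2) (simp add: I.m_ac)
  qed
  have "\<phi> \<in> lcs_hom B B'"
    unfolding lcs_hom_def hom_def
    by (auto elim!: C.carrier_cases simp: hom) (simp add: \<phi>\<kappa>)
  moreover have "\<pi>' (\<phi> b) = \<pi> b" if "b \<in> carrier B" for b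
    using that by (auto elim!: C.carrier_cases simp: \<phi>\<kappa>)
  moreover have "\<phi> (\<iota> y) = \<iota>' y" if "y \<in> carrier I" for y
    using that \<phi>\<kappa>[of y "\<one>\<^bsub>H\<^esub>"] by (simp add: C.\<kappa>_one C'.\<kappa>_one f1)
  ultimately show "equivalent_extensions H I (\<iota>, B, \<pi>) (\<iota>', B', \<pi>')"
    unfolding equivalent_extensions_def by auto
qed

text \<open>The operations demanded by \<open>coordinates\<close> are put on
  \<open>I \<times> H\<close> and transported along \<open>e\<close>, since the middle term has to
  be a subset of the given type.\<close>

lemma factor_set_extension:
  fixes e :: "'i \<times> 'h \<Rightarrow> 'b"
  assumes fs: "factor_set \<beta> \<gamma>" and e: "inj_on e (carrier I \<times> carrier H)"
  shows "\<exists>\<kappa> \<iota> (B :: 'b linear_cycle_set) \<pi>.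
    coordinatized H I dia lt \<beta> \<gamma> \<kappa> \<iota> B \<pi> \<and> (\<iota>, B, \<pi>) \<in> extensions_with_actions H I dia lt"
proof -
  let ?S = "carrier I \<times> carrier H"
  define c where "c = inv_into ?S e"
  have c: "c (e (y, h)) = (y, h)" if "y \<in> carrier I" "h \<in> carrier H" for y h
    using inv_into_f_f[OF e, of "(y, h)"] that by (simp add: c_def)
  define \<kappa> where "\<kappa> y h = e (y, h)" for y h
  define \<iota> where "\<iota> y = e (y, \<one>\<^bsub>H\<^esub>)" for y
  define \<pi> where "\<pi> b = snd (c b)" for b
  define B :: "'b linear_cycle_set" where "B = \<lparr>carrier = e ` ?S,
     monoid.mult = (\<lambda>x x'. case (c x, c x') of ((y, h), (y', h')) \<Rightarrow> e (y +\<^sub>I y' +\<^sub>I \<beta> h h', h +\<^sub>H h')),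
     one = e (\<one>\<^bsub>I\<^esub>, \<one>\<^bsub>H\<^esub>),
     cdot = (\<lambda>x x'. case (c x, c x') of ((y, h), (y', h')) \<Rightarrow>
       e (h \<diamondop> y' +\<^sub>I \<gamma> h h' +\<^sub>I (h \<diamondop> y) \<leftthreetimes> (h \<cdot>\<^sub>H h'), h \<cdot>\<^sub>H h'))\<rparr>"
  have ke: "case_prod \<kappa> = e" by (auto simp: \<kappa>_def)
  have "coordinates \<beta> \<gamma> \<kappa> (\<iota>, B, \<pi>)"
    unfolding coordinates_def prod.case ke
    by (intro conjI ballI) (simp_all add: bij_betw_def e B_def \<kappa>_def \<iota>_def \<pi>_def c)
  moreover have "\<beta> a b \<in> carrier I \<and> \<gamma> a b \<in> carrier I" if "a \<in> carrier H" "b \<in> carrier H" for a b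
    using fs that unfolding factor_set_def by blast
  ultimately have C: "coordinatized H I dia lt \<beta> \<gamma> \<kappa> \<iota> B \<pi>"
    using lcs_actions_axioms by (simp add: coordinatized_def coordinatized_axioms_def)
  moreover have "(\<iota>, B, \<pi>) \<in> extensions_with_actions H I dia lt"
    by (rule coordinatized.in_extensions_with_actions[OF C fs]) (simp add: B_def \<kappa>_def)
  ultimately show ?thesis by blast
qed

text \<open>Selecting one related cocycle per extension and passing to its class gives
  \<open>\<theta>\<close>. Two extensions have the same class exactly when they are equivalent, so
  \<open>\<theta>\<close> induces the bijection on the quotient.\<close>

lemma Ext_bij_cohomology:
  fixes e :: "'i \<times> 'h \<Rightarrow> 'b"
  assumes e: "inj_on e (carrier I \<times> carrier H)"
  shows "\<exists>\<Phi>. bij_betw \<Phi> (Ext H I dia lt :: ('i, 'b, 'h) extension set set)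
    (carrier (cohomology H I dia lt 2))"
proof -
  let ?X = "extensions_with_actions H I dia lt :: ('i, 'b, 'h) extension set"
  let ?c = "\<lambda>z. coboundaries #>\<^bsub>total_cochains H I 2\<^esub> z"
  \<comment> \<open>A relation rather than a function: different sections attach different cocycles
    to the same extension.\<close>
  define R where "R = (\<lambda>(\<iota>, B, \<pi>) z. z \<in> cocycles \<and>
    (\<exists>\<kappa>. coordinatized H I dia lt (cochain_add z) (cochain_dot z) \<kappa> \<iota> (B :: 'b linear_cycle_set) \<pi>))"
  have total: "\<exists>z. R E z" if EX: "E \<in> ?X" for E
  proof -
    obtain \<iota> B \<pi> where E: "E = (\<iota>, B, \<pi>)" by (cases E)
    obtain \<beta> \<gamma> \<kappa> where C: "coordinatized H I dia lt \<beta> \<gamma> \<kappa> \<iota> B \<pi>" and one: "\<one>\<^bsub>B\<^esub> = \<kappa> \<one>\<^bsub>I\<^esub> \<one>\<^bsub>H\<^esub>"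
      using extension_has_coordinates EX E by blast
    interpret C: coordinatized H I dia lt \<beta> \<gamma> \<kappa> \<iota> B \<pi> by (rule C)
    have "linear_cycle_set B" using EX E by (auto simp: extensions_with_actions_def is_extension_def)
    then have "factor_set \<beta> \<gamma>" using C.factor_set_if_linear_cycle_set one by blast
    then obtain z where z: "z \<in> cocycles"
      and eq: "\<forall>a\<in>carrier H. \<forall>b\<in>carrier H. cochain_add z a b = \<beta> a b \<and> cochain_dot z a b = \<gamma> a b"
      using factor_set_realized by blast
    have "coordinates (cochain_add z) (cochain_dot z) \<kappa> (\<iota>, B, \<pi>)"
      using C.coords coordinates_cong[of "cochain_add z" \<beta> "cochain_dot z" \<gamma>] eq by blast
    then have "coordinatized H I dia lt (cochain_add z) (cochain_dot z) \<kappa> \<iota> B \<pi>"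
      using lcs_actions_axioms eq by (simp add: coordinatized_def coordinatized_axioms_def)
    then show ?thesis using z E by (auto simp: R_def)
  qed
  define \<theta> where "\<theta> E = ?c (SOME z. R E z)" for E
  have fsz: "factor_set (cochain_add z) (cochain_dot z)" "z \<in> carrier (total_cochains H I 2)" if "z \<in> cocycles" for z
    using that cocycles_iff[of z] by (auto simp: kernel_def)
  have iff: "equivalent_extensions H I E E' \<longleftrightarrow> ?c z = ?c z'" if R: "R E z" "R E' z'" for E E' z z'
  proof -
    obtain \<iota> B \<pi> \<iota>' B' \<pi>' where E: "E = (\<iota>, B, \<pi>)" "E' = (\<iota>', B', \<pi>')" by (cases E, cases E')
    have z: "z \<in> cocycles" "z' \<in> cocycles" using R E by (auto simp: R_def)
    obtain \<kappa> \<kappa>' where "coordinatized H I dia lt (cochain_add z) (cochain_dot z) \<kappa> \<iota> B \<pi>"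
      "coordinatized H I dia lt (cochain_add z') (cochain_dot z') \<kappa>' \<iota>' B' \<pi>'"
      using R E by (auto simp: R_def)
    then have "equivalent_extensions H I E E' \<longleftrightarrow>
        cohomologous (cochain_add z') (cochain_dot z') (cochain_add z) (cochain_dot z)"
      unfolding E using equivalent_iff_cohomologous fsz z by blast
    also have "\<dots> \<longleftrightarrow> ?c z' = ?c z"
      using coboundary_coset_eq_iff fsz(2) z by blast
    finally show ?thesis by auto
  qed
  have \<theta>: "R E (SOME z. R E z)" if "E \<in> ?X" for E using total[OF that] by (rule someI_ex)
  \<comment> \<open>Equivalence becomes equality of values of \<open>\<theta>\<close>, the form in
    which the quotient is identified with an image.\<close>
  have rel: "{(E, E'). E \<in> ?X \<and> E' \<in> ?X \<and> equivalent_extensions H I E E'}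
      = {(E, E'). E \<in> ?X \<and> E' \<in> ?X \<and> \<theta> E = \<theta> E'}"
    using iff[OF \<theta> \<theta>] by (auto simp: \<theta>_def)
  have "\<theta> ` ?X = carrier (cohomology H I dia lt 2)"
    unfolding carrier_cohomology_2
  proof (intro equalityI subsetI)
    fix w assume "w \<in> \<theta> ` ?X"
    then obtain E where E: "E \<in> ?X" "w = \<theta> E" by blast
    then have "(SOME z. R E z) \<in> cocycles" using \<theta>[OF E(1)] by (cases E) (simp add: R_def)
    then show "w \<in> ?c ` cocycles" unfolding E(2) \<theta>_def by (rule imageI)
  next
    fix w assume "w \<in> ?c ` cocycles"
    then obtain z where z: "z \<in> cocycles" "w = ?c z" by blast
    obtain \<kappa> \<iota> \<pi> and B :: "'b linear_cycle_set"
      where "coordinatized H I dia lt (cochain_add z) (cochain_dot z) \<kappa> \<iota> B \<pi>" and E: "(\<iota>, B, \<pi>) \<in> ?X"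
      using factor_set_extension[OF fsz(1)[OF z(1)] e] by blast
    then have R: "R (\<iota>, B, \<pi>) z" using z by (auto simp: R_def)
    let ?E = "(\<iota>, B, \<pi>)"
    \<comment> \<open>The cocycle selected by \<open>\<theta>\<close> for this extension may differ
      from \<open>z\<close>. Comparing the extension with itself, once through \<open>z\<close> and
      once through the selected cocycle, shows that both have the same class.\<close>
    have "equivalent_extensions H I ?E ?E" using iff[OF R R] by simp
    then have "w = \<theta> ?E" using iff[OF R \<theta>[OF E]] z by (simp add: \<theta>_def)
    then show "w \<in> \<theta> ` ?X" using E by blast
  qed
  then show ?thesis
    unfolding Ext_def rel using bij_betw_quotient_image[of \<theta> ?X] by auto
qed

end

theorem corollary6p10:
  fixes H :: "'h linear_cycle_set"
    and I :: "'i linear_cycle_set"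
    and dia :: "'h \<Rightarrow> 'i \<Rightarrow> 'i"  (infixr "\<diamondop>" 75)
    and lt :: "'i \<Rightarrow> 'h \<Rightarrow> 'i"  (infixl "\<leftthreetimes>" 75)
    and e :: "'i \<times> 'h \<Rightarrow> 'b"
  assumes H: "linear_cycle_set H"
    and I: "trivial_linear_cycle_set I"
    and dia_closed: "\<And>h y. \<lbrakk>h \<in> carrier H; y \<in> carrier I\<rbrakk> \<Longrightarrow> h \<diamondop> y \<in> carrier I"
    and lt_closed: "\<And>y h. \<lbrakk>y \<in> carrier I; h \<in> carrier H\<rbrakk> \<Longrightarrow> y \<leftthreetimes> h \<in> carrier I"
    and dia_add: "\<And>h y y'. \<lbrakk>h \<in> carrier H; y \<in> carrier I; y' \<in> carrier I\<rbrakk>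
          \<Longrightarrow> h \<diamondop> (y \<otimes>\<^bsub>I\<^esub> y') = (h \<diamondop> y) \<otimes>\<^bsub>I\<^esub> (h \<diamondop> y')"
    and zero_dia: "\<And>y. y \<in> carrier I \<Longrightarrow> \<one>\<^bsub>H\<^esub> \<diamondop> y = y"
    and zero_lt: "\<And>h. h \<in> carrier H \<Longrightarrow> \<one>\<^bsub>I\<^esub> \<leftthreetimes> h = \<one>\<^bsub>I\<^esub>"
    and lt_zero: "\<And>y. y \<in> carrier I \<Longrightarrow> y \<leftthreetimes> \<one>\<^bsub>H\<^esub> = \<one>\<^bsub>I\<^esub>"
    and lt_add: "\<And>y h h'. \<lbrakk>y \<in> carrier I; h \<in> carrier H; h' \<in> carrier H\<rbrakk>
          \<Longrightarrow> y \<leftthreetimes> (h \<otimes>\<^bsub>H\<^esub> h') = (y \<leftthreetimes> h) \<otimes>\<^bsub>I\<^esub> (y \<leftthreetimes> h')"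
    and add_lt: "\<And>y y' h. \<lbrakk>y \<in> carrier I; y' \<in> carrier I; h \<in> carrier H\<rbrakk>
          \<Longrightarrow> (y \<otimes>\<^bsub>I\<^esub> y') \<leftthreetimes> h = (y \<leftthreetimes> h) \<otimes>\<^bsub>I\<^esub> (y' \<leftthreetimes> h)"
    and add_dia: "\<And>h h' y. \<lbrakk>h \<in> carrier H; h' \<in> carrier H; y \<in> carrier I\<rbrakk>
          \<Longrightarrow> (h \<otimes>\<^bsub>H\<^esub> h') \<diamondop> y = (h \<cdot>\<^bsub>H\<^esub> h') \<diamondop> (h \<diamondop> y)"
    and dia_lt: "\<And>h h' y. \<lbrakk>h \<in> carrier H; h' \<in> carrier H; y \<in> carrier I\<rbrakk>
          \<Longrightarrow> (h \<diamondop> y) \<leftthreetimes> (h \<cdot>\<^bsub>H\<^esub> h')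
            = (h \<diamondop> (y \<leftthreetimes> h')) \<otimes>\<^bsub>I\<^esub> ((h \<diamondop> (y \<leftthreetimes> h)) \<leftthreetimes> (h \<cdot>\<^bsub>H\<^esub> h'))"
    and dia_bij: "\<And>h. h \<in> carrier H \<Longrightarrow> bij_betw (\<lambda>y. h \<diamondop> y) (carrier I) (carrier I)"
    and universe: "inj_on e (carrier I \<times> carrier H)"
  shows "\<exists>\<Phi>. bij_betw \<Phi> (Ext H I dia lt :: ('i, 'b, 'h) extension set set)
                        (carrier (cohomology H I dia lt 2))"
proof -
  interpret lcs_actions H I dia lt
    using assms by (intro lcs_actions.intro lcs_actions_axioms.intro)
  show ?thesis by (rule Ext_bij_cohomology[OF universe])
qed

end
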